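(* Let $F$ be a rooted labeled forest with vertices $v_1,\dots,v_n$ and let $F'=CF=D\Delta F$, with vertices denoted $v_1',\dots,v_n'$. Then $F=D\Delta F'$, i.e., $C=D\Delta$ is an involution on the set of rooted labeled forests with $n$ vertices. Furthermore: 1. $v_{j_1},\dots,v_{j_p}$ are the projective vertices of $F$ if and only if $v_{j_1}',\dots,v_{j_p}'$ are the roots of $F'$. 2. $v_{k_1},\dots,v_{k_q}$ are the injective vertices of $F$ with $k_1<k_2<\cdots<k_q$ if and only if $v_{k_1}'$ is the first projective vertex of $F'$ and $v_{k_2}',\dots,v_{k_q}'$ (with $k_2<\cdots<k_q$) are its children. 3. Dually, $v_{\ell_q}$ is the last injective vertex of $F$ and $v_{\ell_1},\dots,v_{\ell_{q-1}}$ are its children if and only if $v_{\ell_1}'',\dots,v_{\ell_q}''$ (with $\ell_1<\cdots<\ell_q$) are the projective vertices of $F''=D\Delta^{-1}F$, whose vertices are denoted $v_1'',\dots,v_n''$.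
   Context: Let $K$ be a field, $Q: 1\to 2\to\cdots\to n$, $\Lambda=KQ$; modules are finite-dimensional representations of $Q$ over $K$. A complete exceptional sequence is a sequence $E_*=(E_1,\dots,E_n)$ of rigid indecomposable modules (up to isomorphism) such that $\mathrm{Hom}(E_j,E_i)=0=\mathrm{Ext}^1(E_j,E_i)$ for all $i<j$. A rooted labeled forest with $n$ vertices is a forest with vertices $v_1,\dots,v_n$ and a chosen root in each component. The forest of $E_*$ is the Hasse diagram (roots = maximal elements) of the order $v_i\le v_j$ iff $\mathrm{supp}\,E_i\subseteq \mathrm{supp}\,E_j$; this gives a bijection between complete exceptional sequences and rooted labeled forests with $n$ vertices. The braid group $B_n$ (generators $\sigma_1,\dots,\sigma_{n-1}$) acts on complete exceptional sequences by $\sigma_i(E_* )=(E_1,\dots,E_{i-1},E_i',E_i,E_{i+2},\dots,E_n)$, where $E_i'$ is the unique module making this a complete exceptional sequence, and hence acts on rooted labeled forests through the bijection. Products act as compositions of operators (rightmost factor first). The Garside element is $\Delta=\delta_{n-1}\delta_{n-2}\cdots\delta_2\delta_1$ with $\delta_k=\sigma_1\sigma_2\cdots\sigma_k$. Duality $D$ acts on rooted labeled forests by reversing the labels: $DF$ is the same rooted forest as $F$ with vertex labels $v_i'=v_{n-i+1}$. (It corresponds to $D(E_1,\dots,E_n)=(DE_n,\dots,DE_1)$ with $DM=\mathrm{Hom}_K(M,K)$.) Complex conjugation $C$ acts on rooted labeled forests as $C=D\Delta$. The projective vertices $v_{j_1},\dots,v_{j_p}$, $j_1<\cdots<j_p$,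 of a forest $F$ are given by: $v_{j_p}$ is the root of $F$ with the largest label; $v_{j_i}$ is the child of $v_{j_{i+1}}$ with largest label among those children whose label is less than $j_{i+1}$; the process stops at $v_{j_1}$ (the first projective vertex), which has no child with smaller label. The injective vertices $v_{k_1},\dots,v_{k_q}$, $k_1<\cdots<k_q$, of $F$ are given by: $v_{k_1}$ is the root of $F$ with the smallest label; $v_{k_{i+1}}$ is the child of $v_{k_i}$ with smallest label among those children whose label is greater than $k_i$; the process stops at $v_{k_q}$ (the last injective vertex), which has no child with larger label. *)

theory Defs
  imports "Jordan_Normal_Form.Matrix_Kernel"
begin

section \<open>Representations of the linear quiver\<close>

text \<open>
  A finite-dimensional representation of the quiver \<open>1 \<rightarrow> 2 \<rightarrow> \<dots> \<rightarrow> n\<close> over the field \<open>'k\<close> is taken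
  in coordinates: the space at vertex \<open>i\<close> is \<open>'k\<close> to the power \<open>vdim V i\<close>, and the arrow from \<open>i\<close>
  to \<open>i + 1\<close> is the matrix \<open>arrow V i\<close>, acting on column vectors. Every finite-dimensional
  representation is isomorphic to one of this form. Values of the two
  fields outside the vertices \<open>{1..n}\<close> and the arrows \<open>{1..<n}\<close> are never looked at.
\<close>

record 'k quiver_rep =
  vdim :: "nat \<Rightarrow> nat"
  arrow :: "nat \<Rightarrow> 'k mat"

definition is_rep :: "nat \<Rightarrow> 'k::field quiver_rep \<Rightarrow> bool" where
  "is_rep n V \<longleftrightarrow> (\<forall>i\<in>{1..<n}. arrow V i \<in> carrier_mat (vdim V (Suc i)) (vdim V i))"

definition rep_hom ::
  "nat \<Rightarrow> 'k::field quiver_rep \<Rightarrow> 'k quiver_rep \<Rightarrow> (nat \<Rightarrow> 'k mat) set" where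
  "rep_hom n V W = {f. (\<forall>i\<in>{1..n}. f i \<in> carrier_mat (vdim W i) (vdim V i)) \<and>
                       (\<forall>i\<in>{1..<n}. f (Suc i) * arrow V i = arrow W i * f i)}"

definition hom_vanishes :: "nat \<Rightarrow> 'k::field quiver_rep \<Rightarrow> 'k quiver_rep \<Rightarrow> bool" where
  "hom_vanishes n V W \<longleftrightarrow>
     (\<forall>f \<in> rep_hom n V W. \<forall>i\<in>{1..n}. f i = 0\<^sub>m (vdim W i) (vdim V i))"

definition short_exact ::
  "nat \<Rightarrow> 'k::field quiver_rep \<Rightarrow> (nat \<Rightarrow> 'k mat) \<Rightarrow> 'k quiver_rep \<Rightarrow> (nat \<Rightarrow> 'k mat) \<Rightarrow>
     'k quiver_rep \<Rightarrow> bool" where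
  "short_exact n W f X g V \<longleftrightarrow>
     f \<in> rep_hom n W X \<and> g \<in> rep_hom n X V \<and>
     (\<forall>i\<in>{1..n}.
        inj_on ((*\<^sub>v) (f i)) (carrier_vec (vdim W i)) \<and>
        (*\<^sub>v) (f i) ` carrier_vec (vdim W i) = mat_kernel (g i) \<and>
        (*\<^sub>v) (g i) ` carrier_vec (vdim X i) = carrier_vec (vdim V i))"

text \<open>
  \<open>Ext\<^sup>1(V, W)\<close> is the set of classes of extensions \<open>0 \<rightarrow> W \<rightarrow> X \<rightarrow> V \<rightarrow> 0\<close>, the zero class being
  that of the split ones.
\<close>

definition ext1_vanishes :: "nat \<Rightarrow> 'k::field quiver_rep \<Rightarrow> 'k quiver_rep \<Rightarrow> bool" where
  "ext1_vanishes n V W \<longleftrightarrow>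
     (\<forall>X f g. is_rep n X \<and> short_exact n W f X g V \<longrightarrow>
        (\<exists>s \<in> rep_hom n V X. \<forall>i\<in>{1..n}. g i * s i = 1\<^sub>m (vdim V i)))"

definition subrep :: "nat \<Rightarrow> 'k::field quiver_rep \<Rightarrow> (nat \<Rightarrow> 'k vec set) \<Rightarrow> bool" where
  "subrep n V U \<longleftrightarrow>
     (\<forall>i\<in>{1..n}. VectorSpace.subspace class_ring (U i) (module_vec TYPE('k) (vdim V i))) \<and>
     (\<forall>i\<in>{1..<n}. (*\<^sub>v) (arrow V i) ` U i \<subseteq> U (Suc i))"

definition internal_direct_sum ::
  "nat \<Rightarrow> 'k::field quiver_rep \<Rightarrow> (nat \<Rightarrow> 'k vec set) \<Rightarrow> (nat \<Rightarrow> 'k vec set) \<Rightarrow> bool" where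
  "internal_direct_sum n V U W \<longleftrightarrow>
     subrep n V U \<and> subrep n V W \<and>
     (\<forall>i\<in>{1..n}. U i \<inter> W i = {0\<^sub>v (vdim V i)} \<and>
                  {u + w | u w. u \<in> U i \<and> w \<in> W i} = carrier_vec (vdim V i))"

definition indecomposable :: "nat \<Rightarrow> 'k::field quiver_rep \<Rightarrow> bool" where
  "indecomposable n V \<longleftrightarrow>
     (\<exists>i\<in>{1..n}. vdim V i \<noteq> 0) \<and>
     (\<forall>U W. internal_direct_sum n V U W \<longrightarrow>
        (\<forall>i\<in>{1..n}. U i = {0\<^sub>v (vdim V i)}) \<or> (\<forall>i\<in>{1..n}. W i = {0\<^sub>v (vdim V i)}))"

definition rigid_indecomposable :: "nat \<Rightarrow> 'k::field quiver_rep \<Rightarrow> bool" where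
  "rigid_indecomposable n V \<longleftrightarrow> is_rep n V \<and> indecomposable n V \<and> ext1_vanishes n V V"

definition supp :: "nat \<Rightarrow> 'k::field quiver_rep \<Rightarrow> nat set" where
  "supp n V = {i\<in>{1..n}. vdim V i \<noteq> 0}"

section \<open>Complete exceptional sequences\<close>

text \<open>
  A sequence \<open>(E\<^sub>1, \<dots>, E\<^sub>n)\<close> is a function on the indices \<open>{1..n}\<close>. Modules are not quotiented by
  isomorphism; everything below depends only on the isomorphism classes of its arguments.
\<close>

definition complete_exceptional :: "nat \<Rightarrow> (nat \<Rightarrow> 'k::field quiver_rep) \<Rightarrow> bool" where
  "complete_exceptional n E \<longleftrightarrow>
     (\<forall>i\<in>{1..n}. rigid_indecomposable n (E i)) \<and>
     (\<forall>i\<in>{1..n}. \<forall>j\<in>{1..n}. i < j \<longrightarrow>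
        hom_vanishes n (E j) (E i) \<and> ext1_vanishes n (E j) (E i))"

text \<open>The choice of the new module is unique up to isomorphism.\<close>

definition braid_seq ::
  "nat \<Rightarrow> nat \<Rightarrow> (nat \<Rightarrow> 'k::field quiver_rep) \<Rightarrow> (nat \<Rightarrow> 'k quiver_rep)" where
  "braid_seq n i E =
     E(i := (SOME X. complete_exceptional n (E(i := X, Suc i := E i))), Suc i := E i)"

section \<open>Rooted labeled forests\<close>

text \<open>
  A rooted forest on the vertices \<open>v\<^sub>1, \<dots>, v\<^sub>n\<close> is given by its edges oriented towards the chosen
  roots: \<open>(c, p) \<in> F\<close> means that \<open>v\<^sub>c\<close> is a child of \<open>v\<^sub>p\<close>. Such an orientation amounts to an
  acyclic relation in which every vertex has at most one parent; the roots are the vertices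
  without a parent, and each component then contains exactly one of them.
\<close>

type_synonym forest = "(nat \<times> nat) set"

definition rooted_forest :: "nat \<Rightarrow> forest \<Rightarrow> bool" where
  "rooted_forest n F \<longleftrightarrow> F \<subseteq> {1..n} \<times> {1..n} \<and> single_valued F \<and> acyclic F"

definition roots :: "nat \<Rightarrow> forest \<Rightarrow> nat set" where
  "roots n F = {1..n} - Domain F"

definition children :: "forest \<Rightarrow> nat \<Rightarrow> nat set" where
  "children F v = {c. (c, v) \<in> F}"

text \<open>
  The Hasse diagram of the supports. The supports in a complete exceptional sequence are
  pairwise distinct, so that strict inclusion is the strict part of the order.
\<close>

definition forest_of :: "nat \<Rightarrow> (nat \<Rightarrow> 'k::field quiver_rep) \<Rightarrow> forest" where
  "forest_of n E = {(i, j) \<in> {1..n} \<times> {1..n}. supp n (E i) \<subset> supp n (E j) \<and>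
     \<not> (\<exists>k\<in>{1..n}. supp n (E i) \<subset> supp n (E k) \<and> supp n (E k) \<subset> supp n (E j))}"

text \<open>The inverse of the bijection with forests, up to isomorphism of the modules.\<close>

definition seq_of_forest :: "nat \<Rightarrow> forest \<Rightarrow> (nat \<Rightarrow> 'k::field quiver_rep)" where
  "seq_of_forest n F = (SOME E. complete_exceptional n E \<and> forest_of n E = F)"

section \<open>The braid group action, duality and conjugation\<close>

definition braid_gen :: "'k::field itself \<Rightarrow> nat \<Rightarrow> nat \<Rightarrow> forest \<Rightarrow> forest" where
  "braid_gen K n i F = forest_of n (braid_seq n i (seq_of_forest n F :: nat \<Rightarrow> 'k quiver_rep))"

text \<open>
  A list \<open>[i\<^sub>1, \<dots>, i\<^sub>m]\<close> stands for the product of the generators with these indices, in this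
  order; the rightmost factor acts first.
\<close>

definition braid_act :: "'k::field itself \<Rightarrow> nat \<Rightarrow> nat list \<Rightarrow> forest \<Rightarrow> forest" where
  "braid_act K n w = foldr (braid_gen K n) w"

definition delta_word :: "nat \<Rightarrow> nat list" where
  "delta_word k = [1..<Suc k]"

definition garside_word :: "nat \<Rightarrow> nat list" where
  "garside_word n = concat (map delta_word (rev [1..<n]))"

definition garside :: "'k::field itself \<Rightarrow> nat \<Rightarrow> forest \<Rightarrow> forest" where
  "garside K n = braid_act K n (garside_word n)"

definition garside_inv :: "'k::field itself \<Rightarrow> nat \<Rightarrow> forest \<Rightarrow> forest" where
  "garside_inv K n = inv_into {F. rooted_forest n F} (garside K n)"

definition dual :: "nat \<Rightarrow> forest \<Rightarrow> forest" where
  "dual n F = {(n + 1 - c, n + 1 - p) | c p. (c, p) \<in> F}"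

definition conjugation :: "'k::field itself \<Rightarrow> nat \<Rightarrow> forest \<Rightarrow> forest" where
  "conjugation K n F = dual n (garside K n F)"

section \<open>Projective and injective vertices\<close>

definition smaller_children :: "forest \<Rightarrow> nat \<Rightarrow> nat set" where
  "smaller_children F v = {c \<in> children F v. c < v}"

definition larger_children :: "forest \<Rightarrow> nat \<Rightarrow> nat set" where
  "larger_children F v = {c \<in> children F v. c > v}"

text \<open>
  Both predicates hold for exactly one list, the increasing list of the labels of the projective
  (injective) vertices.
\<close>

definition projective_vertices :: "nat \<Rightarrow> forest \<Rightarrow> nat list \<Rightarrow> bool" where
  "projective_vertices n F js \<longleftrightarrow>
     js \<noteq> [] \<and> last js = Max (roots n F) \<and>
     (\<forall>i. Suc i < length js \<longrightarrow>
        smaller_children F (js ! Suc i) \<noteq> {} \<and> js ! i = Max (smaller_children F (js ! Suc i))) \<and>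
     smaller_children F (hd js) = {}"

definition injective_vertices :: "nat \<Rightarrow> forest \<Rightarrow> nat list \<Rightarrow> bool" where
  "injective_vertices n F ks \<longleftrightarrow>
     ks \<noteq> [] \<and> hd ks = Min (roots n F) \<and>
     (\<forall>i. Suc i < length ks \<longrightarrow>
        larger_children F (ks ! i) \<noteq> {} \<and> ks ! Suc i = Min (larger_children F (ks ! i))) \<and>
     larger_children F (last ks) = {}"

definition first_projective :: "nat \<Rightarrow> forest \<Rightarrow> nat \<Rightarrow> bool" where
  "first_projective n F v \<longleftrightarrow> (\<exists>js. projective_vertices n F js \<and> hd js = v)"

definition last_injective :: "nat \<Rightarrow> forest \<Rightarrow> nat \<Rightarrow> bool" where
  "last_injective n F v \<longleftrightarrow> (\<exists>ks. injective_vertices n F ks \<and> last ks = v)"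

end

theory Submission
  imports Defs
begin

text \<open>
  The indecomposable modules are the interval modules \<open>M[a, b]\<close>, written here as pairs
  \<open>(a, b + 1)\<close>, and \<open>exc A B\<close> says that \<open>(A, B)\<close> is an exceptional pair. In a complete
  exceptional sequence every support has exactly one point, its gap, that lies in no smaller
  support. Add a virtual root with label \<open>n + 1\<close>, support \<open>{0..n}\<close> and gap \<open>0\<close>. The vertices
  below a vertex \<open>v\<close> then occur from left to right as the children with larger label, the gap of
  \<open>v\<close>, and the children with smaller label, both groups in increasing order; this gives the
  bijection with forests.

  The edge dual to \<open>v\<close> joins the gap of \<open>v\<close> to the gap of its parent. Read backwards, the dual
  edges form a complete exceptional sequence, and so do the mixed sequences that occur after the
  factors of the Garside element. Since the first term of a complete exceptional sequence is
  determined by the other terms, these are the sequences produced by the braid action, so that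
  \<open>C = D\<Delta>\<close> replaces every edge by the reflection of its dual edge. The same uniqueness shows
  that \<open>C\<close> is an involution. Roots, projective and injective vertices are the edges at the outer
  face, at the last point and at the first point, and dual edges exchange faces and points.
\<close>

section \<open>Exceptional sequences of intervals\<close>

text \<open>The pair \<open>(a, b + 1)\<close> is an edge between two of the points 1 to n + 1, and
  the n edges of a complete exceptional sequence connect all these points
  (\<open>connected\<close>). This is the source of every uniqueness argument: a function on the
  points that is constant along all edges is constant.

  The main obstacle is that a generator of the braid group inserts a module which is merely chosen
  to exist, so intermediate results cannot be tracked by formula. The way out is the shape of the
  words: a product of the generators from 1 to k moves known terms to the right and leaves one
  unknown term, in first place, where uniqueness identifies it. The explicit rule
  \<open>mutate\<close> only shows that a choice is possible.

  The reason why dual edges fit into mixed sequences is that the dual edge of \<open>j\<close> is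
  exceptional towards every other edge \<open>T i\<close>, whether \<open>i\<close> is smaller or
  larger than \<open>j\<close>. Up to sign it is a member of the dual basis for the Euler form,
  which also explains why dualising twice leads back.\<close>

definition pts :: "nat \<times> nat \<Rightarrow> nat set" where
  "pts A = {fst A..<snd A}"

definition edge :: "nat \<Rightarrow> nat \<times> nat \<Rightarrow> bool" where
  "edge n A \<longleftrightarrow> 1 \<le> fst A \<and> fst A < snd A \<and> snd A \<le> Suc n"

text \<open>The Euler form of the modules of \<open>B\<close> and \<open>A\<close> is the value of
  the indicator function of \<open>pts A\<close> at \<open>fst B\<close> minus its value at
  \<open>snd B\<close>. Between interval modules Hom and Ext are never both nonzero, so its
  vanishing says that both vanish.\<close>

definition exc :: "nat \<times> nat \<Rightarrow> nat \<times> nat \<Rightarrow> bool" where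
  "exc A B \<longleftrightarrow> (fst B \<in> pts A \<longleftrightarrow> snd B \<in> pts A)"

definition ces :: "nat \<Rightarrow> (nat \<Rightarrow> nat \<times> nat) \<Rightarrow> bool" where
  "ces n T \<longleftrightarrow> (\<forall>i\<in>{1..n}. edge n (T i)) \<and>
     (\<forall>i\<in>{1..n}. \<forall>j\<in>{1..n}. i < j \<longrightarrow> exc (T i) (T j))"

definition hasse :: "nat \<Rightarrow> (nat \<Rightarrow> nat \<times> nat) \<Rightarrow> (nat \<times> nat) set" where
  "hasse n T = {(i, j) \<in> {1..n} \<times> {1..n}. pts (T i) \<subset> pts (T j) \<and>
     \<not> (\<exists>k\<in>{1..n}. pts (T i) \<subset> pts (T k) \<and> pts (T k) \<subset> pts (T j))}"

locale exc_seq =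
  fixes n :: nat and T :: "nat \<Rightarrow> nat \<times> nat"
  assumes ces: "ces n T"
begin

text \<open>The label \<open>Suc n\<close> is the virtual root.\<close>
definition lo :: "nat \<Rightarrow> nat" where "lo v = (if v = Suc n then 0 else fst (T v))"
definition hi :: "nat \<Rightarrow> nat" where "hi v = (if v = Suc n then Suc n else snd (T v))"

abbreviation I :: "nat \<Rightarrow> nat set" where "I v \<equiv> {lo v..<hi v}"
abbreviation L :: "nat set" where "L \<equiv> {1..Suc n}"

definition below :: "nat \<Rightarrow> nat \<Rightarrow> bool" where
  "below u v \<longleftrightarrow> u \<in> L \<and> v \<in> L \<and> u \<noteq> v \<and> lo v \<le> lo u \<and> hi u \<le> hi v"

definition child :: "nat \<Rightarrow> nat \<Rightarrow> bool" where
  "child u v \<longleftrightarrow> below u v \<and> \<not> (\<exists>k. below u k \<and> below k v)"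

lemma lo_top [simp]: "lo (Suc n) = 0" and hi_top [simp]: "hi (Suc n) = Suc n"
  by (simp_all add: lo_def hi_def)

lemma lo_hi: "v \<in> L \<Longrightarrow> lo v < hi v" "v \<in> L \<Longrightarrow> hi v \<le> Suc n"
  using ces by (auto simp: ces_def edge_def lo_def hi_def)

lemma lo_pos: "v \<in> L \<Longrightarrow> v \<noteq> Suc n \<Longrightarrow> 1 \<le> lo v"
  using ces by (auto simp: ces_def edge_def lo_def)

text \<open>The equality cases carry the information about labels. For \<open>i < j\<close>, a
  nested \<open>j\<close> may share the left end of \<open>i\<close> but not the right end, a nested
  \<open>i\<close> may share the right end of \<open>j\<close> but not the left end, and touching
  supports have labels increasing from left to right. The virtual root fits in as the largest label,
  since no other support starts at 0.\<close>

lemma relative_position: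
  assumes "i \<in> L" "j \<in> L" "i < j"
  shows "(lo i \<le> lo j \<and> hi j < hi i) \<or> (lo j < lo i \<and> hi i \<le> hi j) \<or> hi j < lo i \<or> hi i \<le> lo j"
proof (cases "j = Suc n")
  case True
  then show ?thesis using lo_hi[of i] lo_pos[of i] assms by auto
next
  case False
  then have "exc (T i) (T j)" using ces assms by (auto simp: ces_def)
  then have "lo i \<le> lo j \<and> lo j < hi i \<longleftrightarrow> lo i \<le> hi j \<and> hi j < hi i"
    using False assms by (auto simp: exc_def pts_def lo_def hi_def)
  then show ?thesis using lo_hi[of i] lo_hi[of j] assms by linarith
qed

lemma laminar:
  assumes "i \<in> L" "j \<in> L" "i \<noteq> j"
  shows "below i j \<or> below j i \<or> hi j \<le> lo i \<or> hi i \<le> lo j"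
  using relative_position[of i j] relative_position[of j i] assms
  by (auto simp: below_def neq_iff)

text \<open>Distinct labels never carry the same support, so nesting is strict in length. This
  length is the measure of the inductions below.\<close>

lemma below_size: "below u v \<Longrightarrow> hi u - lo u < hi v - lo v"
  using relative_position[of u v] relative_position[of v u] lo_hi[of u] lo_hi[of v]
  unfolding below_def neq_iff by linarith

lemma below_trans: assumes "below u v" "below v w" shows "below u w"
proof -
  have "u \<noteq> w" using below_size[OF assms(1)] below_size[OF assms(2)] by auto
  then show ?thesis using assms by (auto simp: below_def)
qed

lemma below_antisym: "below u v \<Longrightarrow> \<not> below v u"
  using below_trans[of u v u] by (auto simp: below_def)

lemma below_top: "v \<in> {1..n} \<Longrightarrow> below v (Suc n)"
  using lo_hi[of v] by (auto simp: below_def)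

lemma not_above_top: "\<not> below (Suc n) v"
  using lo_hi[of v] lo_pos[of v] by (auto simp: below_def)

lemma child_below: "child u v \<Longrightarrow> below u v"
  by (simp add: child_def)

lemma child_mem: "child u v \<Longrightarrow> u \<in> {1..n} \<and> v \<in> L"
proof -
  assume c: "child u v"
  then have "u \<noteq> Suc n" using not_above_top child_below by blast
  then show ?thesis using c by (auto simp: child_def below_def)
qed

lemma below_child: "below u v \<Longrightarrow> \<exists>w. child w v \<and> (u = w \<or> below u w)"
proof (induction "hi v - lo v - (hi u - lo u)" arbitrary: u rule: less_induct)
  case less
  show ?case
  proof (cases "child u v")
    case False
    then obtain k where k: "below u k" "below k v" using less.prems by (auto simp: child_def)
    have "hi v - lo v - (hi k - lo k) < hi v - lo v - (hi u - lo u)"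
      using below_size[OF k(1)] below_size[OF k(2)] by linarith
    then obtain w where "child w v" "k = w \<or> below k w" using less.hyps k(2) by blast
    then show ?thesis using k(1) below_trans by blast
  qed blast
qed

lemma child_above: "below u v \<Longrightarrow> \<exists>w. child u w \<and> (w = v \<or> below w v)"
proof (induction "hi v - lo v" arbitrary: v rule: less_induct)
  case less
  show ?case
  proof (cases "child u v")
    case False
    then obtain k where k: "below u k" "below k v" using less.prems by (auto simp: child_def)
    then show ?thesis using less.hyps[of k] below_size[OF k(2)] below_trans by blast
  qed blast
qed

lemma child_unique: assumes "child u v" "child u w" shows "v = w"
proof (rule ccontr)
  assume "v \<noteq> w"
  have b: "below u v" "below u w" using assms by (auto simp: child_def)
  then have "below v w \<or> below w v"
    using laminar[of v w] lo_hi[of u] \<open>v \<noteq> w\<close> unfolding below_def by linarith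
  then show False using b assms by (auto simp: child_def)
qed

section \<open>Label order of adjacent supports, and gaps\<close>

lemma siblings_disjoint:
  assumes "child u w" "child v w" "u \<noteq> v"
  shows "hi u \<le> lo v \<or> hi v \<le> lo u"
  using laminar[of u v] assms child_def below_def by metis

text \<open>The points between the two siblings are tiled by further children of \<open>w\<close>,
  each starting where the previous one ends, and labels increase wherever two supports
  touch.\<close>

lemma covered_chain:
  assumes "child u w" "child v w" "hi u \<le> lo v"
    and "\<And>z. hi u \<le> z \<Longrightarrow> z < lo v \<Longrightarrow> \<exists>k. below k w \<and> z \<in> I k"
  shows "u < v"
  using assms
proof (induction "lo v - hi u" arbitrary: u rule: less_induct)
  case less
  have mem: "u \<in> L" "v \<in> L" using less.prems by (auto simp: child_def below_def)
  have "u \<noteq> v" using less.prems(3) lo_hi[OF mem(1)] by auto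
  show ?case
  proof (cases "hi u = lo v")
    case True
    then show ?thesis using relative_position[of v u] lo_hi[OF mem(1)] lo_hi[OF mem(2)] mem \<open>u \<noteq> v\<close>
      by linarith
  next
    case False
    then have lt: "hi u < lo v" using less.prems by simp
    obtain k where k: "below k w" "hi u \<in> I k" using less.prems(4)[of "hi u"] lt by auto
    obtain x where x: "child x w" "k = x \<or> below k x" using below_child k(1) by blast
    have hx: "hi u \<in> I x" using x k(2) by (auto simp: below_def)
    have ne: "x \<noteq> u" "x \<noteq> v" using hx lt by auto
    \<comment> \<open>The child \<open>x\<close> covers the point \<open>hi u\<close> and is
      disjoint from \<open>u\<close>, so it starts exactly there.\<close>
    have xu: "hi u = lo x" using siblings_disjoint[OF x(1) less.prems(1)] ne hx lo_hi[OF mem(1)]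
        by auto
    have xm: "x \<in> L" using x(1) child_mem by force
    have xv: "hi x \<le> lo v" using siblings_disjoint[OF x(1) less.prems(2)] ne hx lt lo_hi[OF
        mem(2)] by auto
    have "u < x" using relative_position[of x u] lo_hi[OF mem(1)] lo_hi[OF xm] mem xm ne xu
        by linarith
    also have "x < v"
      by (rule less.hyps) (use xv x(1) less.prems lo_hi[OF xm] xu lt in auto)
    finally show ?thesis .
  qed
qed

lemma left_end_label: "below v w \<Longrightarrow> lo v = lo w \<Longrightarrow> w < v"
  using relative_position[of v w] lo_hi[of v] lo_hi[of w] unfolding below_def by linarith

lemma right_end_label: "below v w \<Longrightarrow> hi v = hi w \<Longrightarrow> v < w"
  using relative_position[of w v] lo_hi[of v] lo_hi[of w] unfolding below_def by linarith

lemma covered_child: "\<exists>k. below k w \<and> z \<in> I k \<Longrightarrow> \<exists>u. child u w \<and> z \<in> I u"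
proof -
  assume "\<exists>k. below k w \<and> z \<in> I k"
  then obtain k where k: "below k w" "z \<in> I k" by blast
  obtain u where "child u w" "k = u \<or> below k u" using below_child k(1) by blast
  then show ?thesis using k(2) by (intro exI[of _ u]) (auto simp: below_def)
qed

text \<open>The child that covers the first point of \<open>w\<close> shares the left end of
  \<open>w\<close>, so its label exceeds \<open>w\<close>; from there labels increase along the
  tiling up to \<open>v\<close>.\<close>

lemma covered_left:
  assumes v: "child v w" and cov: "\<And>z. lo w \<le> z \<Longrightarrow> z < lo v \<Longrightarrow> \<exists>k. below k w \<and> z \<in> I k"
  shows "w < v"
proof -
  have m: "v \<in> L" and b: "below v w" using v by (auto simp: child_def below_def)
  show ?thesis
  proof (cases "lo v = lo w")
    case True
    then show ?thesis using left_end_label b by blast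
  next
    case False
    then have lt: "lo w < lo v" using b by (simp add: below_def)
    then obtain u where u: "child u w" "lo w \<in> I u" using covered_child cov by blast
    have bu: "below u w" using u(1) by (simp add: child_def)
    have "u \<noteq> v" using u(2) lt by auto
    then have le: "hi u \<le> lo v"
      using siblings_disjoint[OF u(1) v] u(2) lt lo_hi[OF m] by auto
    have "u < v" by (rule covered_chain[OF u(1) v le]) (use cov u(2) in auto)
    moreover have "w < u" using left_end_label[OF bu] u(2) bu by (auto simp: below_def)
    ultimately show ?thesis by simp
  qed
qed

text \<open>Mirror image: the child that covers the last point \<open>hi w - 1\<close> shares the
  right end of \<open>w\<close> and has a smaller label than \<open>w\<close>, while labels increase
  from \<open>v\<close> up to it.\<close>

lemma covered_right:
  assumes v: "child v w" and cov: "\<And>z. hi v \<le> z \<Longrightarrow> z < hi w \<Longrightarrow> \<exists>k. below k w \<and> z \<in> I k"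
  shows "v < w"
proof -
  have m: "v \<in> L" and b: "below v w" using v by (auto simp: child_def below_def)
  show ?thesis
  proof (cases "hi v = hi w")
    case True
    then show ?thesis using right_end_label b by blast
  next
    case False
    then have lt: "hi v < hi w" using b by (simp add: below_def)
    then have "hi v \<le> hi w - 1" "hi w - 1 < hi w" by auto
    then obtain u where u: "child u w" "hi w - 1 \<in> I u" using covered_child cov by blast
    have bu: "below u w" using u(1) by (simp add: child_def)
    have um: "u \<in> L" using bu by (simp add: below_def)
    have hu: "hi u = hi w" using u(2) bu lt by (auto simp: below_def)
    then have "u \<noteq> v" using lt by auto
    then have le: "hi v \<le> lo u" using siblings_disjoint[OF u(1) v] hu lt b lo_hi[OF m] by auto
    have "v < u" by (rule covered_chain[OF v u(1) le]) (use cov lo_hi[OF um] hu in auto)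
    moreover have "u < w" using right_end_label[OF bu] hu by simp
    ultimately show ?thesis by simp
  qed
qed

text \<open>If \<open>w\<close> were covered entirely, any child \<open>v\<close> would satisfy both
  \<open>w < v\<close> and \<open>v < w\<close> by the two covering lemmas.\<close>

lemma ex_gap:
  assumes "w \<in> L"
  shows "\<exists>z\<in>I w. \<forall>u. below u w \<longrightarrow> z \<notin> I u"
proof (rule ccontr)
  assume "\<not> ?thesis"
  then have cov: "\<exists>u. below u w \<and> z \<in> I u" if "lo w \<le> z" "z < hi w" for z
    using that by (metis atLeastLessThan_iff)
  then obtain v where v: "child v w" using covered_child lo_hi(1)[OF assms] by blast
  have vm: "v \<in> L" "lo w \<le> lo v" "hi v \<le> hi w" using v by (auto simp: child_def below_def)
  have "w < v" by (rule covered_left[OF v]) (use cov vm lo_hi[OF vm(1)] in auto)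
  moreover have "v < w" by (rule covered_right[OF v]) (use cov vm lo_hi[OF vm(1)] in auto)
  ultimately show False by simp
qed

text \<open>The choice turns out to be unique: \<open>gap\<close> is injective on the n + 1 labels,
  hence takes all the values 0 to n, so every other point of \<open>I w\<close> is the gap of a
  vertex below \<open>w\<close>.\<close>

definition gap :: "nat \<Rightarrow> nat" where
  "gap w = (SOME z. z \<in> I w \<and> (\<forall>u. below u w \<longrightarrow> z \<notin> I u))"

lemma gap: assumes "w \<in> L" shows gap_mem: "gap w \<in> I w" and gap_below: "below u w \<Longrightarrow> gap w \<notin> I u"
proof -
  have "\<exists>z. z \<in> I w \<and> (\<forall>u. below u w \<longrightarrow> z \<notin> I u)" using ex_gap[OF assms] by blast
  from someI_ex[OF this] show "gap w \<in> I w" "below u w \<Longrightarrow> gap w \<notin> I u"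
    unfolding gap_def by blast+
qed

lemma gap_mem_iff:
  assumes "v \<in> L" "k \<in> L"
  shows "gap v \<in> I k \<longleftrightarrow> v = k \<or> below v k"
proof
  assume g: "gap v \<in> I k"
  show "v = k \<or> below v k"
    using laminar[OF assms] g gap_mem[OF assms(1)] gap_below[OF assms(1), of k] by fastforce
next
  assume "v = k \<or> below v k"
  then show "gap v \<in> I k" using gap_mem[OF assms(1)] by (auto simp: below_def)
qed

lemma inj_gap: "inj_on gap L"
  using gap_mem_iff gap_mem below_antisym by (metis inj_onI)

lemma gap_image: "gap ` L = {0..n}"
proof -
  have "gap ` L \<subseteq> {0..n}" using gap_mem lo_hi by fastforce
  moreover have "card (gap ` L) = card {0..n}" using inj_gap by (simp add: card_image)
  ultimately show ?thesis by (simp add: card_subset_eq)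
qed

lemma gap_surj: "z \<le> n \<Longrightarrow> \<exists>v\<in>L. gap v = z"
  using gap_image by (metis atLeast0AtMost atMost_iff imageE)

lemma gap_top [simp]: "gap (Suc n) = 0"
proof -
  obtain v where v: "v \<in> L" "gap v = 0" using gap_surj[of 0] by auto
  then have "v = Suc n" using gap_mem[of v] lo_pos[of v] by fastforce
  then show ?thesis using v by simp
qed

lemma interval_eq_gaps: "v \<in> L \<Longrightarrow> I v = gap ` {x. x = v \<or> below x v}"
proof -
  assume v: "v \<in> L"
  show ?thesis
  proof
    show "I v \<subseteq> gap ` {x. x = v \<or> below x v}"
    proof
      fix z assume z: "z \<in> I v"
      then have "z \<le> n" using lo_hi(2)[OF v] by auto
      then obtain x where "x \<in> L" "gap x = z" using gap_surj by blast
      then show "z \<in> gap ` {x. x = v \<or> below x v}" using z gap_mem_iff v by blast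
    qed
    show "gap ` {x. x = v \<or> below x v} \<subseteq> I v"
      using gap_mem_iff v by (auto simp: below_def)
  qed
qed

text \<open>All points of \<open>I w\<close> except the gap are covered by smaller supports. A child
  to the left of the gap therefore has everything to its left covered, which gives
  \<open>w < v\<close>, and a child to the right similarly gives \<open>v < w\<close>; the claims
  are the converses.\<close>

lemma child_side:
  assumes c: "child v w"
  shows "w < v \<Longrightarrow> hi v \<le> gap w" and "v < w \<Longrightarrow> gap w < lo v"
proof -
  have m: "v \<in> L" "w \<in> L" and b: "below v w" using c by (auto simp: child_def below_def)
  have ng: "gap w \<notin> I v" using gap_below[OF m(2)] b by blast
  have vw: "lo w \<le> lo v" "hi v \<le> hi w" "lo v < hi v" "hi w \<le> Suc n"
    using b lo_hi m by (auto simp: below_def)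
  have cov: "\<exists>k. below k w \<and> z \<in> I k" if z: "lo w \<le> z" "z < hi w" "z \<noteq> gap w" for z
  proof -
    obtain x where x: "x \<in> L" "gap x = z" using gap_surj[of z] z vw by auto
    then have "below x w" using z gap_mem_iff[OF x(1) m(2)] by auto
    then show ?thesis using x gap_mem by blast
  qed
  have l: "w < v" if "hi v \<le> gap w" by (rule covered_left[OF c]) (use cov that vw in auto)
  have r: "v < w" if "gap w < lo v" by (rule covered_right[OF c]) (use cov that vw in auto)
  show "w < v \<Longrightarrow> hi v \<le> gap w" using r ng by fastforce
  show "v < w \<Longrightarrow> gap w < lo v" using l ng by fastforce
qed

text \<open>By \<open>side\<close> both children lie on the same side of the gap of
  \<open>w\<close>, so all points between them are covered. In the wrong order
  \<open>covered_chain\<close> would give \<open>v < u\<close>.\<close>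

lemma sibling_order:
  assumes u: "child u w" and v: "child v w" and "u < v" and side: "w < u \<or> v < w"
  shows "hi u \<le> lo v"
proof (rule ccontr)
  assume "\<not> hi u \<le> lo v"
  then have vu: "hi v \<le> lo u" using siblings_disjoint[OF u v] \<open>u < v\<close> by auto
  have m: "v \<in> L" "w \<in> L" "u \<in> L" and b: "below v w" "below u w"
    using u v by (auto simp: child_def below_def)
  have "\<exists>k. below k w \<and> z \<in> I k" if z: "hi v \<le> z" "z < lo u" for z
  proof -
    have zw: "z \<in> I w" using z b lo_hi[OF m(1)] lo_hi[OF m(3)] by (auto simp: below_def)
    have "z \<noteq> gap w"
      using side child_side[OF u] child_side[OF v] z \<open>u < v\<close> lo_hi[OF m(1)] lo_hi[OF m(3)] by auto
    moreover obtain x where "x \<in> L" "gap x = z" using gap_surj[of z] zw lo_hi(2)[OF m(2)] by auto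
    ultimately show ?thesis using gap_mem_iff gap_mem zw m by blast
  qed
  then have "v < u" using covered_chain[OF v u vu] by blast
  then show False using \<open>u < v\<close> by simp
qed

end

section \<open>Dual edges and mutation\<close>

lemma telescope_eq:
  fixes e :: "nat \<Rightarrow> 'a"
  assumes "a \<le> b" "\<And>z. a \<le> z \<Longrightarrow> z < b \<Longrightarrow> e z = e (Suc z)"
  shows "e a = e b"
  using assms by (induction rule: dec_induct) auto

lemma exc_transfer: "exc U A \<longleftrightarrow> (of_bool (fst A \<in> pts U) :: int) = of_bool (snd A \<in> pts U)"
  by (auto simp: exc_def)

context exc_seq begin

text \<open>Induction on the length of the support: each point \<open>z\<close> of
  \<open>I v\<close> other than its gap is the gap of a smaller support, so the step from
  \<open>z\<close> to \<open>Suc z\<close> is known. The edge \<open>T v\<close> then yields the one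
  missing step, at the gap of \<open>v\<close>.\<close>

lemma connected:
  fixes e :: "nat \<Rightarrow> 'a"
  assumes e: "\<And>j. j \<in> {1..n} \<Longrightarrow> e (fst (T j)) = e (snd (T j))"
    and z: "z \<in> {1..Suc n}"
  shows "e z = e (Suc n)"
proof -
  have step: "e (gap v) = e (Suc (gap v))" if "v \<in> {1..n}" for v
    using that
  proof (induction "hi v - lo v" arbitrary: v rule: less_induct)
    case less
    have vL: "v \<in> L" using less.prems by auto
    have eq: "e z = e (Suc z)" if z: "z \<in> I v" "z \<noteq> gap v" for z
    proof -
      obtain x where x: "x \<in> L" "gap x = z" using gap_surj[of z] lo_hi(2)[OF vL] z by auto
      then have b: "below x v" using gap_mem_iff z vL by blast
      moreover have "x \<noteq> Suc n" using b not_above_top by blast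
      ultimately show ?thesis using less.hyps below_size x by auto
    qed
    have gv: "gap v \<in> I v" using gap_mem vL by blast
    have "e (lo v) = e (gap v)" by (rule telescope_eq) (use gv eq in auto)
    moreover have "e (Suc (gap v)) = e (hi v)" by (rule telescope_eq) (use gv eq in auto)
    moreover have "e (lo v) = e (hi v)" using e less.prems by (auto simp: lo_def hi_def)
    ultimately show ?case by simp
  qed
  have "e y = e (Suc y)" if y: "1 \<le> y" "y \<le> n" for y
  proof -
    obtain x where x: "x \<in> L" "gap x = y" using gap_surj y by blast
    then have "x \<noteq> Suc n" using y by auto
    then show ?thesis using step x by auto
  qed
  then show ?thesis using telescope_eq[of z "Suc n" e] z by auto
qed

text \<open>Both indicator functions are constant along all edges but the \<open>k\<close>-th, and such functions
  that vanish at \<open>Suc n\<close> form a one-dimensional space.\<close>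
lemma edge_determined:
  assumes k: "k \<in> {1..n}" and X: "edge n X" and Y: "edge n Y"
    and excX: "\<And>j. j \<in> {1..n} \<Longrightarrow> j \<noteq> k \<Longrightarrow> exc X (T j)"
    and excY: "\<And>j. j \<in> {1..n} \<Longrightarrow> j \<noteq> k \<Longrightarrow> exc Y (T j)"
  shows "X = Y"
proof -
  let ?f = "\<lambda>A z. of_bool (z \<in> pts A) :: int"
  let ?d = "\<lambda>A. ?f A (fst (T k)) - ?f A (snd (T k))"
  have top: "?f A (Suc n) = 0" if "edge n A" for A using that by (auto simp: edge_def pts_def)
  \<comment> \<open>Otherwise the indicator would be constant on all points, hence 0 as at
    \<open>Suc n\<close>, although it is 1 at \<open>fst A\<close>.\<close>
  have nz: "?d A \<noteq> 0" if A: "edge n A" "\<And>j. j \<in> {1..n} \<Longrightarrow> j \<noteq> k \<Longrightarrow> exc A (T j)" for A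
  proof
    assume "?d A = 0"
    then have "?f A (fst (T j)) = ?f A (snd (T j))" if "j \<in> {1..n}" for j
      using A(2)[OF that] by (cases "j = k") (auto simp: exc_transfer)
    then have "?f A (fst A) = ?f A (Suc n)" by (rule connected) (use A(1) in \<open>auto simp: edge_def\<close>)
    then show False using A(1) top[OF A(1)] by (auto simp: edge_def pts_def)
  qed
  have "?d X = 1 \<or> ?d X = -1" "?d Y = 1 \<or> ?d Y = -1"
    using nz[OF X excX] nz[OF Y excY] by auto
  \<comment> \<open>Both differences are 1 or -1, so a sign makes the two indicators agree along the
    edge \<open>k\<close> as well. Numbers 0 and 1 that agree up to a sign are equal.\<close>
  then obtain s :: int where s: "?d X = s * ?d Y" "s = 1 \<or> s = -1" by fastforce
  let ?e = "\<lambda>z. ?f X z - s * ?f Y z"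
  have ek: "?e (fst (T k)) = ?e (snd (T k))" using s(1) by (simp add: algebra_simps)
  have "?e (fst (T j)) = ?e (snd (T j))" if "j \<in> {1..n}" for j
    using excX[OF that] excY[OF that] ek by (cases "j = k") (auto simp: exc_transfer)
  then have e0: "?e z = 0" if "z \<in> {1..Suc n}" for z
    using connected[of ?e z] that top[OF X] top[OF Y] by simp
  have pe: "z \<in> pts X \<longleftrightarrow> z \<in> pts Y" if "z \<in> {1..Suc n}" for z
    using e0[OF that] s(2) by (cases "z \<in> pts X"; cases "z \<in> pts Y") auto
  have "pts A \<subseteq> {1..Suc n}" if "edge n A" for A
    using that by (auto simp: edge_def pts_def)
  then have "pts X = pts Y" using pe X Y by blast
  then show ?thesis using X Y by (simp add: edge_def pts_def atLeastLessThan_eq_iff prod_eq_iff)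
qed

section \<open>Dual edges\<close>

definition par :: "nat \<Rightarrow> nat" where "par v = (THE w. child v w)"

lemma par: "v \<in> {1..n} \<Longrightarrow> child v (par v)"
proof -
  assume "v \<in> {1..n}"
  then obtain w where "child v w" using child_above below_top by blast
  then show ?thesis unfolding par_def using child_unique by (metis theI)
qed

lemma par_eq: "child v w \<Longrightarrow> par v = w"
  using child_unique par child_mem by blast

lemma below_par: "below v k \<Longrightarrow> par v = k \<or> below (par v) k"
  using child_above par_eq by metis

lemma par_mem: "v \<in> {1..n} \<Longrightarrow> par v \<in> L"
  using par child_mem by blast

definition low :: "nat \<Rightarrow> nat" where "low v = min (gap v) (gap (par v))"
definition up :: "nat \<Rightarrow> nat" where "up v = max (gap v) (gap (par v))"
text \<open>Gaps are numbered from 0 to n, ends of edges from 1 to n + 1. With the shift, an end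
  \<open>e\<close> lies in \<open>pts (dual_edge v)\<close> iff \<open>low v < e \<le> up v\<close>,
  that is, iff it separates the two gaps.\<close>

definition dual_edge :: "nat \<Rightarrow> nat \<times> nat" where "dual_edge v = (Suc (low v), Suc (up v))"

lemma gap_le: "v \<in> L \<Longrightarrow> gap v \<le> n"
  using gap_image by fastforce

lemma low_less_up: assumes "v \<in> {1..n}" shows "low v < up v"
proof -
  have "v \<noteq> par v" using par[OF assms] by (auto simp: child_def below_def)
  then have "gap v \<noteq> gap (par v)" using inj_gap assms par_mem[OF assms] by (auto simp: inj_on_def)
  then show ?thesis by (auto simp: low_def up_def)
qed

lemma dual_edge: assumes "v \<in> {1..n}" shows "edge n (dual_edge v)"
  using low_less_up[OF assms] gap_le[of v] gap_le[OF par_mem[OF assms]] assms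
  by (auto simp: edge_def dual_edge_def up_def)

text \<open>Only the support of \<open>v\<close> itself can separate the gap of \<open>v\<close>
  from that of its parent: a vertex other than \<open>v\<close> is above \<open>v\<close> iff it is
  \<open>par v\<close> or above \<open>par v\<close>.\<close>

lemma gap_par_mem:
  assumes "v \<in> {1..n}" "k \<in> L" "k \<noteq> v"
  shows "gap v \<in> I k \<longleftrightarrow> gap (par v) \<in> I k"
proof -
  have v: "v \<in> L" using assms(1) by auto
  have b: "below v (par v)" using par[OF assms(1)] by (simp add: child_def)
  have "below v k \<longleftrightarrow> par v = k \<or> below (par v) k" using below_par b below_trans by blast
  then show ?thesis
    using gap_mem_iff[OF v assms(2)] gap_mem_iff[OF par_mem[OF assms(1)] assms(2)] assms(3) by simp
qed

text \<open>No order between \<open>i\<close> and \<open>j\<close> is assumed, so this serves both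
  for mixing dual edges with original terms and for characterising a dual edge through
  \<open>edge_determined\<close>.\<close>

lemma exc_dual_edge:
  assumes j: "j \<in> {1..n}" and i: "i \<in> {1..n}" and ne: "i \<noteq> j"
  shows "exc (dual_edge j) (T i)"
proof -
  have "gap j \<in> I i \<longleftrightarrow> gap (par j) \<in> I i" by (rule gap_par_mem) (use i j ne in auto)
  then have "low j \<in> I i \<longleftrightarrow> up j \<in> I i" by (auto simp: low_def up_def min_def max_def)
  moreover have "lo i < hi i" using lo_hi i by auto
  moreover have "lo i = fst (T i)" "hi i = snd (T i)" using i by (auto simp: lo_def hi_def)
  \<comment> \<open>Two gaps lie both inside or both outside \<open>I i\<close> iff none or both of
    the ends of \<open>T i\<close> separate them.\<close>
  ultimately show ?thesis using low_less_up[OF j]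
    unfolding exc_def pts_def dual_edge_def fst_conv snd_conv atLeastLessThan_iff by presburger
qed

text \<open>The two gaps of the dual edge of \<open>i\<close> have to lie both inside or both
  outside the half-open range \<open>?in\<close> of the dual edge of \<open>j\<close>. Without a
  common gap, \<open>same\<close> and \<open>out\<close> decide this by supports that hold two of
  the gaps and miss others. If the edges share a gap, the label order decides through
  \<open>child_side\<close> and \<open>sibling_order\<close>.\<close>

lemma exc_dual_edges:
  assumes i: "i \<in> {1..n}" and j: "j \<in> {1..n}" and ij: "i < j"
  shows "exc (dual_edge j) (dual_edge i)"
proof -
  let ?in = "\<lambda>z. low j \<le> z \<and> z < up j"
  have iL: "i \<in> L" and jL: "j \<in> L" using i j by auto
  let ?w = "par i" and ?u = "par j"
  have ci: "child i ?w" and cj: "child j ?u" using par i j by auto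
  have wL: "?w \<in> L" and uL: "?u \<in> L" using par_mem i j by auto
  have same: "?in x \<longleftrightarrow> ?in y"
    if "k \<in> L" "x \<in> I k" "y \<in> I k" "gap j \<notin> I k" "gap ?u \<notin> I k" for x y k
    using that by (auto simp: low_def up_def)
  have out: "\<not> ?in x" if "k \<in> L" "x \<notin> I k" "gap j \<in> I k" "gap ?u \<in> I k" for x k
    using that by (auto simp: low_def up_def)
  have gi: "gap i \<in> I i" "gap j \<in> I j" "gap ?w \<in> I ?w" "gap ?u \<in> I ?u"
    using gap_mem iL jL wL uL by auto
  have nin: "gap ?w \<notin> I i" "gap ?u \<notin> I j" using gap_below wL uL ci cj by (auto simp: child_def)
  have ju: "gap j \<in> I i \<longleftrightarrow> gap ?u \<in> I i" using gap_par_mem[of j i] i j ij by auto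
  have iw: "gap i \<in> I j \<longleftrightarrow> gap ?w \<in> I j" using gap_par_mem[of i j] i j ij by auto
  have "?in (gap i) \<longleftrightarrow> ?in (gap ?w)"
  proof (cases "gap j \<in> I i")
    case True
    have w_out: "\<not> ?in (gap ?w)" using out[OF iL nin(1)] True ju by blast
    have "\<not> ?in (gap i)"
    proof (cases "?u = i")
      case True
      \<comment> \<open>The common gap, that of \<open>i\<close>, lies to the right of the gap of
        \<open>j\<close>. It is thus the upper end of the range, which is excluded.\<close>
      then show ?thesis using child_side(2)[of j i] child_side(1)[of j i] cj ij gi(2)
        by (auto simp: low_def up_def)
    next
      case False
      have bu: "below ?u i" using ju True gap_mem_iff[OF uL iL] False by blast
      have "gap i \<notin> I ?u" using gap_below[OF iL bu] .
      moreover have "gap j \<in> I ?u" using gap_mem_iff[OF jL uL] cj by (auto simp: child_def)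
      ultimately show ?thesis using out[OF uL] gi(4) by blast
    qed
    then show ?thesis using w_out by blast
  next
    case False
    show ?thesis
    proof (cases "gap i \<in> I j")
      case True
      show ?thesis
      proof (cases "?w = j")
        case True
        \<comment> \<open>Here the common gap is that of \<open>j\<close>. Both gaps are in the
          range if the gap of \<open>?u\<close> is to the right of \<open>I j\<close>, and neither
          is if it is to the left.\<close>
        have "gap j < gap i" using child_side(2)[of i j] ci ij True gi(1) by auto
        moreover have "gap ?u < lo j \<or> hi j \<le> gap ?u" using nin(2) by auto
        ultimately show ?thesis using True gi(2) \<open>gap i \<in> I j\<close>
          by (auto simp: low_def up_def)
      next
        case False
        have bw: "below ?w j" using iw True gap_mem_iff[OF wL jL] False by blast
        have 1: "gap j \<notin> I ?w" using gap_below[OF jL bw] .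
        have 2: "gap ?u \<notin> I ?w" using bw nin(2) by (auto simp: below_def)
        have 3: "gap i \<in> I ?w" using gap_mem_iff[OF iL wL] ci by (auto simp: child_def)
        show ?thesis by (rule same[OF wL 3 gi(3) 1 2])
      qed
    next
      case nij: False
      show ?thesis
      proof (cases "?w = ?u")
        case True
        \<comment> \<open>For siblings both edges end at the gap of the common parent, and the
          labels give the left-to-right order.\<close>
        have cj': "child j ?w" using cj True by simp
        have g: "gap ?u = gap ?w" using True by simp
        have gs: "gap j \<in> I j" "gap i \<in> I i" by fact+
        show ?thesis
        proof (cases "?w < j")
          case True
          have "hi j \<le> gap ?w" using child_side(1)[OF cj' True] .
          moreover have "gap i < gap j \<or> gap ?w < gap i"
          proof (cases "?w < i")
            case True
            then have "hi i \<le> lo j" using sibling_order[OF ci cj' ij] by auto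
            then show ?thesis using gs by auto
          next
            case False
            then have "i < ?w" using ci by (auto simp: child_def below_def)
            then show ?thesis using child_side(2)[OF ci] gs by auto
          qed
          ultimately show ?thesis using gs g by (auto simp: low_def up_def)
        next
          case False
          then have jw: "j < ?w" using cj' by (auto simp: child_def below_def)
          then have "gap ?w < lo j" using child_side(2)[OF cj'] by blast
          moreover have "hi i \<le> lo j" using sibling_order[OF ci cj' ij] jw by auto
          moreover have "gap ?w < lo i" using child_side(2)[OF ci] jw ij by auto
          ultimately show ?thesis using gs g by (auto simp: low_def up_def)
        qed
      next
        case ne: False
        show ?thesis
        proof (cases "below ?u ?w")
          case True
          have 1: "gap ?w \<notin> I ?u" using gap_below[OF wL True] .
          have "?u \<noteq> i" using False ju gi by auto
          then have 2: "gap i \<notin> I ?u" using gap_par_mem[of i ?u] i uL 1 by auto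
          have 3: "gap j \<in> I ?u" using gap_mem_iff[OF jL uL] cj by (auto simp: child_def)
          show ?thesis using out[OF uL 1 3 gi(4)] out[OF uL 2 3 gi(4)] by blast
        next
          case nb: False
          have 1: "gap ?u \<notin> I ?w" using gap_mem_iff[OF uL wL] nb ne by auto
          have "?w \<noteq> j" using nij iw gi by auto
          then have 2: "gap j \<notin> I ?w" using gap_par_mem[of j ?w] j wL 1 by auto
          have 3: "gap i \<in> I ?w" using gap_mem_iff[OF iL wL] ci by (auto simp: child_def)
          show ?thesis by (rule same[OF wL 3 gi(3) 2 1])
        qed
      qed
    qed
  qed
  then show ?thesis
    unfolding exc_def pts_def dual_edge_def fst_conv snd_conv atLeastLessThan_iff
      low_def[of i] up_def[of i] min_def max_def
    by (simp only: Suc_le_mono Suc_less_eq split: if_split) blast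
qed

end

text \<open>The conjugate of the transposition \<open>B\<close> by \<open>A\<close>; the case \<open>snd B = fst A\<close> does not occur for
  exceptional pairs.\<close>
definition mutate :: "nat \<times> nat \<Rightarrow> nat \<times> nat \<Rightarrow> nat \<times> nat" where
  "mutate A B =
     (if fst B = fst A then (snd B, snd A) else if fst B = snd A then (fst A, snd B)
      else if snd B = snd A then (fst B, fst A) else B)"

lemma mutate_cases:
  assumes "edge n A" "edge n B" "exc A B"
  obtains "fst B = fst A" "snd B < snd A" "mutate A B = (snd B, snd A)"
    | "fst B = snd A" "mutate A B = (fst A, snd B)"
    | "snd B = snd A" "fst B < fst A" "mutate A B = (fst B, fst A)"
    | "fst B \<noteq> fst A" "fst B \<noteq> snd A" "snd B \<noteq> fst A" "snd B \<noteq> snd A" "mutate A B = B"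
proof -
  have ord: "fst A < snd A" "fst B < snd B"
    and eq: "fst A \<le> fst B \<and> fst B < snd A \<longleftrightarrow> fst A \<le> snd B \<and> snd B < snd A"
    using assms by (auto simp: edge_def exc_def pts_def)
  consider "fst B = fst A" | "fst B = snd A" | "snd B = snd A" "fst B \<noteq> fst A"
    | "fst B \<noteq> fst A" "fst B \<noteq> snd A" "snd B \<noteq> snd A"
    by blast
  then show ?thesis
  proof cases
    case 1
    then show ?thesis using that(1) ord eq by (simp add: mutate_def)
  next
    case 2
    then show ?thesis using that(2) ord by (simp add: mutate_def)
  next
    case 3
    then have "fst B < fst A" using ord eq by linarith
    then show ?thesis using that(3) 3 ord by (simp add: mutate_def)
  next
    case 4
    then have "snd B \<noteq> fst A" using ord eq by linarith
    then show ?thesis using that(4) 4 by (simp add: mutate_def)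
  qed
qed

lemma edge_mutate:
  assumes "edge n A" "edge n B" "exc A B" shows "edge n (mutate A B)"
  using assms by (rule mutate_cases) (use assms in \<open>simp_all add: edge_def\<close>)

text \<open>Membership in \<open>pts U\<close> is constant along \<open>A\<close> and along
  \<open>B\<close>, and the ends of the new edge are linked through these two edges.\<close>

lemma exc_mutate_right:
  assumes "exc U A" "exc U B"
  shows "exc U (mutate A B)"
proof -
  obtain a a' b b' where AB: "A = (a, a')" "B = (b, b')" by (metis surj_pair)
  have "a \<in> pts U \<longleftrightarrow> a' \<in> pts U" "b \<in> pts U \<longleftrightarrow> b' \<in> pts U"
    using assms unfolding exc_def AB fst_conv snd_conv by blast+
  then show ?thesis
    unfolding AB mutate_def exc_def fst_conv snd_conv
    by (cases "b = a"; cases "b = a'"; cases "b' = a'"; hypsubst?)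
      (simp_all only: simp_thms if_True if_False fst_conv snd_conv)
qed

lemma exc_mutate_self:
  assumes "edge n A" "edge n B" "exc A B" shows "exc (mutate A B) A"
proof -
  have ord: "fst A < snd A" "fst B < snd B" using assms by (simp_all add: edge_def)
  show ?thesis using assms
  proof (rule mutate_cases)
    assume "fst B \<noteq> fst A" "fst B \<noteq> snd A" "snd B \<noteq> fst A" "snd B \<noteq> snd A"
    moreover have "fst A \<le> fst B \<and> fst B < snd A \<longleftrightarrow> fst A \<le> snd B \<and> snd B < snd A"
      using assms(3) by (simp add: exc_def pts_def)
    ultimately have "fst A < fst B \<and> snd B < snd A \<or> snd A < fst B \<or> snd B < fst A
        \<or> fst B < fst A \<and> snd A < snd B"
      using ord by linarith
    moreover assume "mutate A B = B"
    ultimately show ?thesis using ord by (elim disjE) (simp_all add: exc_def pts_def)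
  qed (use ord in \<open>simp_all add: exc_def pts_def\<close>)
qed

text \<open>When \<open>A\<close> and \<open>B\<close> share an end, the new support is a difference
  or a disjoint union of theirs, so its indicator is a linear combination of the two
  indicators.\<close>

lemma exc_mutate_left:
  assumes A: "edge n A" "edge n B" and AB: "exc A B" and u: "exc A U" "exc B U"
  shows "exc (mutate A B) U"
  using A AB
proof (rule mutate_cases)
  assume "fst B = fst A" "snd B < snd A" "mutate A B = (snd B, snd A)"
  then have "pts (mutate A B) = pts A - pts B" using A by (auto simp: pts_def edge_def)
  then show ?thesis using u by (auto simp: exc_def)
next
  assume "fst B = snd A" "mutate A B = (fst A, snd B)"
  then have "pts (mutate A B) = pts A \<union> pts B" using A by (auto simp: pts_def edge_def)
  then show ?thesis using u by (auto simp: exc_def)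
next
  assume "snd B = snd A" "fst B < fst A" "mutate A B = (fst B, fst A)"
  then have "pts (mutate A B) = pts B - pts A" using A by (auto simp: pts_def edge_def)
  then show ?thesis using u by (auto simp: exc_def)
next
  assume "mutate A B = B"
  then show ?thesis using u by simp
qed

text \<open>This guarantees that the choice made in \<open>braid_seq\<close> has a
  candidate.\<close>

lemma ces_mutate:
  assumes T: "ces n T" and i: "1 \<le> i" "i < n"
  shows "ces n (T(i := mutate (T i) (T (Suc i)), Suc i := T i))" (is "ces n ?T")
proof -
  let ?A = "T i" and ?B = "T (Suc i)"
  let ?X = "mutate ?A ?B"
  have iD: "i \<in> {1..n}" "Suc i \<in> {1..n}" using i by auto
  have e: "edge n (T j)" if "j \<in> {1..n}" for j using T that by (simp add: ces_def)
  have x: "exc (T j) (T k)" if "j \<in> {1..n}" "k \<in> {1..n}" "j < k" for j k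
    using T that by (simp add: ces_def)
  have AB: "edge n ?A" "edge n ?B" "exc ?A ?B" using e x iD by auto
  have v: "?T i = ?X" "?T (Suc i) = ?A" "\<And>j. j \<noteq> i \<Longrightarrow> j \<noteq> Suc i \<Longrightarrow> ?T j = T j"
    by simp_all
  have "exc (?T j) (?T k)" if jk: "j \<in> {1..n}" "k \<in> {1..n}" "j < k" for j k
  proof -
    have jl: "exc (T j) ?A" if "j < i" using x jk(1) iD(1) that by blast
    have jl': "exc (T j) ?B" if "j < i" using x jk(1) iD(2) that by simp
    have kl: "exc ?A (T k)" if "Suc i < k" using x iD(1) jk(2) that by simp
    have kl': "exc ?B (T k)" if "Suc i < k" using x iD(2) jk(2) that by simp
    consider "j \<noteq> i" "j \<noteq> Suc i" "k \<noteq> i" "k \<noteq> Suc i" | "j < i" "k = i" | "j < i" "k = Suc i"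
      | "j = i" "k = Suc i" | "j = i" "Suc i < k" | "j = Suc i" "Suc i < k"
      using jk(3) by linarith
    then show ?thesis
    proof cases
      case 1
      then show ?thesis using x[OF jk] by simp
    next
      case 2
      then have "?T j = T j" by simp
      then show ?thesis using 2 v(1) exc_mutate_right[OF jl jl'] by simp
    next
      case 3
      then show ?thesis using v jl by simp
    next
      case 4
      then show ?thesis using v exc_mutate_self[OF AB] by simp
    next
      case 5
      then have "?T k = T k" by simp
      then show ?thesis using 5 v(1) exc_mutate_left[OF AB kl kl'] by simp
    next
      case 6
      then show ?thesis using v kl by simp
    qed
  qed
  moreover have "edge n (?T j)" if "j \<in> {1..n}" for j
    using e[OF that] AB edge_mutate[OF AB] by simp
  ultimately show ?thesis unfolding ces_def by blast
qed

section \<open>The bijection with rooted forests\<close>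

text \<open>For children \<open>u\<close>, \<open>v\<close> of \<open>w\<close>, \<open>before w u v\<close> says that \<open>u\<close> is drawn to the left of \<open>v\<close>;
  the vertices whose gaps are to the left of the support of \<open>v\<close> are those in \<open>preceding C v\<close>.\<close>
definition before :: "nat \<Rightarrow> nat \<Rightarrow> nat \<Rightarrow> bool" where
  "before w u v \<longleftrightarrow> u < v \<and> (w < u \<or> v < w) \<or> w < u \<and> v < w"

definition desc :: "forest \<Rightarrow> nat \<Rightarrow> nat set" where
  "desc C v = {x. (x, v) \<in> C\<^sup>*}"

text \<open>The gap of \<open>w\<close> itself lies to the left of exactly the children with smaller
  label, hence the condition \<open>v < w\<close>.\<close>

definition preceding_in :: "forest \<Rightarrow> nat \<Rightarrow> nat \<Rightarrow> nat set" where
  "preceding_in C w v = {x. x = w \<and> v < w \<or> (\<exists>u. x \<in> desc C u \<and> (u, w) \<in> C \<and> before w u v)}"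

definition preceding :: "forest \<Rightarrow> nat \<Rightarrow> nat set" where
  "preceding C v = {x. \<exists>v' w. (v, v') \<in> C\<^sup>* \<and> (v', w) \<in> C \<and> x \<in> preceding_in C w v'}"

text \<open>As \<open>Suc n\<close> exceeds all labels, the roots become children with smaller label
  and stand to the right of the gap 0.\<close>

definition rooted_tree :: "nat \<Rightarrow> forest \<Rightarrow> forest" where
  "rooted_tree n F = F \<union> (\<lambda>r. (r, Suc n)) ` roots n F"

lemma before_total: "u \<noteq> v \<Longrightarrow> u \<noteq> w \<Longrightarrow> v \<noteq> w \<Longrightarrow> before w u v \<or> before w v u"
  by (auto simp: before_def)

lemma before_trans: "before w x u \<Longrightarrow> before w u v \<Longrightarrow> before w x v"
  by (auto simp: before_def)

lemma before_irrefl: "\<not> before w u u"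
  by (auto simp: before_def)

lemma preceding_step:
  assumes sv: "single_valued C" and c: "(v, w) \<in> C"
  shows "preceding C v = preceding_in C w v \<union> preceding C w"
proof (intro equalityI subsetI)
  fix x assume "x \<in> preceding C v"
  then obtain v' w' where p: "(v, v') \<in> C\<^sup>*" "(v', w') \<in> C" "x \<in> preceding_in C w' v'"
    unfolding preceding_def by blast
  from p(1) show "x \<in> preceding_in C w v \<union> preceding C w"
  proof (cases rule: converse_rtranclE)
    case base
    then show ?thesis using p single_valuedD[OF sv c, of w'] by auto
  next
    case (step y)
    then have "y = w" using single_valuedD[OF sv c] by blast
    then have "x \<in> preceding C w" using step p unfolding preceding_def by blast
    then show ?thesis by blast
  qed
next
  fix x assume "x \<in> preceding_in C w v \<union> preceding C w"
  then show "x \<in> preceding C v"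
  proof
    assume "x \<in> preceding_in C w v"
    then show ?thesis using c unfolding preceding_def by blast
  next
    assume "x \<in> preceding C w"
    then obtain v' w' where "(w, v') \<in> C\<^sup>*" "(v', w') \<in> C" "x \<in> preceding_in C w' v'"
      unfolding preceding_def by blast
    moreover have "(v, v') \<in> C\<^sup>*" using c calculation(1) by (rule converse_rtrancl_into_rtrancl)
    ultimately show ?thesis unfolding preceding_def by blast
  qed
qed

section \<open>Recovering a sequence from its forest\<close>

context exc_seq begin

definition child_rel :: forest where "child_rel = {(u, v). child u v}"

lemma child_rel_iff [simp]: "(u, v) \<in> child_rel \<longleftrightarrow> child u v"
  by (simp add: child_rel_def)

lemma child_trancl: "(u, v) \<in> child_rel\<^sup>+ \<longleftrightarrow> below u v"
proof
  assume "(u, v) \<in> child_rel\<^sup>+"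
  then show "below u v"
    by induction (auto simp: child_def intro: below_trans)
next
  show "below u v \<Longrightarrow> (u, v) \<in> child_rel\<^sup>+"
  proof (induction "hi v - lo v" arbitrary: v rule: less_induct)
    case less
    obtain w where w: "child w v" "u = w \<or> below u w" using below_child less.prems by blast
    then show ?case
      using less.hyps[of w] below_size[of w v] by (auto simp: child_def intro: trancl_into_trancl)
  qed
qed

lemma desc_child_rel: "desc child_rel v = {x. x = v \<or> below x v}"
  by (auto simp: desc_def rtrancl_eq_or_trancl child_trancl)

lemma single_valued_child_rel: "single_valued child_rel"
  using child_unique by (auto simp: single_valued_def child_rel_def)

text \<open>The map \<open>gap\<close> is a bijection from the vertices at or below \<open>v\<close>
  onto the points of the support of \<open>v\<close>.\<close>

lemma card_desc: "v \<in> L \<Longrightarrow> card (desc child_rel v) = hi v - lo v"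
proof -
  assume v: "v \<in> L"
  have "{x. x = v \<or> below x v} \<subseteq> L" using v by (auto simp: below_def)
  then have "card (gap ` {x. x = v \<or> below x v}) = card {x. x = v \<or> below x v}"
    using inj_gap by (intro card_image) (rule inj_on_subset)
  then have "card {x. x = v \<or> below x v} = card (I v)" using interval_eq_gaps[OF v] by simp
  then show ?thesis by (simp add: desc_child_rel)
qed

lemma before_left:
  assumes "child u w" "child v w" "before w u v"
  shows "hi u \<le> lo v"
  using assms sibling_order[OF assms(1,2)] child_side[OF assms(1)] child_side[OF assms(2)]
  by (auto simp: before_def)

text \<open>The points of \<open>I w\<close> to the left of \<open>v\<close> are those of the
  children drawn before \<open>v\<close>, together with the gap of \<open>w\<close> in case
  \<open>v < w\<close>.\<close>

lemma preceding_in_child_rel: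
  assumes c: "child v w"
  shows "preceding_in child_rel w v = {x \<in> L. lo w \<le> gap x \<and> gap x < lo v}"
proof -
  have m: "v \<in> L" "w \<in> L" "below v w" using c by (auto simp: child_def below_def)
  have ne: "v \<noteq> w" using m by (auto simp: below_def)
  show ?thesis
  proof (intro equalityI subsetI)
    fix x assume "x \<in> preceding_in child_rel w v"
    then have "x = w \<and> v < w \<or> (\<exists>u. (x = u \<or> below x u) \<and> child u w \<and> before w u v)"
      by (simp add: preceding_in_def desc_child_rel)
    then consider "x = w" "v < w"
      | u where "x = u \<or> below x u" "child u w" "before w u v" by blast
    then show "x \<in> {x \<in> L. lo w \<le> gap x \<and> gap x < lo v}"
    proof cases
      case 1
      then show ?thesis using gap_mem[OF m(2)] child_side(2)[OF c] m by auto
    next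
      case 2
      have uL: "u \<in> L" and uw: "below u w" using 2 by (auto simp: child_def below_def)
      have xL: "x \<in> L" using 2(1) uL by (auto simp: below_def)
      have "gap x \<in> I u" using gap_mem_iff[OF xL uL] 2(1) by blast
      then show ?thesis using before_left[OF 2(2) c 2(3)] uw xL by (auto simp: below_def)
    qed
  next
    fix x assume x: "x \<in> {x \<in> L. lo w \<le> gap x \<and> gap x < lo v}"
    then have "gap x \<in> I w" using m lo_hi[OF m(1)] by (auto simp: below_def)
    then consider "x = w" | "below x w" using gap_mem_iff m(2) x by blast
    then show "x \<in> preceding_in child_rel w v"
    proof cases
      case 1
      then have "v < w" using child_side(1)[OF c] x ne lo_hi[OF m(1)] by (cases "w < v") auto
      then show ?thesis using 1 by (auto simp: preceding_in_def)
    next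
      case 2
      then obtain u where u: "child u w" "x = u \<or> below x u" using below_child by blast
      have uL: "u \<in> L" "u \<noteq> w" using u by (auto simp: child_def below_def)
      have gu: "gap x \<in> I u" using gap_mem_iff[of x u] u uL x by blast
      then have "u \<noteq> v" using x by auto
      moreover have "\<not> before w v u" using before_left[OF c u(1)] gu x lo_hi[OF m(1)] by auto
      ultimately have "before w u v" using before_total[of u v w] uL ne by blast
      then show ?thesis using u by (auto simp: preceding_in_def desc_child_rel)
    qed
  qed
qed

text \<open>Climbing from \<open>v\<close> to the virtual root, each step adds the points between
  the left end of the parent and that of the child; the virtual root starts at 0.\<close>

lemma preceding_child_rel: "v \<in> L \<Longrightarrow> preceding child_rel v = {x \<in> L. gap x < lo v}"
proof (induction "Suc n - (hi v - lo v)" arbitrary: v rule: less_induct)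
  case less
  show ?case
  proof (cases "v = Suc n")
    case True
    have "v' = v" if "(v, v') \<in> child_rel\<^sup>*" for v'
      using rtranclD[OF that] not_above_top[of v'] unfolding child_trancl True by blast
    moreover have "\<not> child v w" for w using child_mem[of v w] True by auto
    ultimately have "preceding child_rel v = {}" unfolding preceding_def child_rel_iff by blast
    then show ?thesis using True by simp
  next
    case False
    then have c: "child v (par v)" using par less.prems by auto
    let ?w = "par v"
    have w: "?w \<in> L" "below v ?w" using c by (auto simp: child_def below_def)
    have "Suc n - (hi ?w - lo ?w) < Suc n - (hi v - lo v)"
      using below_size[OF w(2)] lo_hi(2)[OF w(1)] by linarith
    then have IH: "preceding child_rel ?w = {x \<in> L. gap x < lo ?w}" using less.hyps w by blast
    have "preceding child_rel v = preceding_in child_rel ?w v \<union> preceding child_rel ?w"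
      using preceding_step[OF single_valued_child_rel] c by (auto simp: child_rel_def)
    also have "\<dots> = {x \<in> L. gap x < lo v}"
      unfolding IH preceding_in_child_rel[OF c] using w(2) by (auto simp: below_def)
    finally show ?thesis .
  qed
qed

text \<open>Together with \<open>card_desc\<close> this expresses both ends of a support by the tree
  alone. The virtual root, with gap 0, is counted for every other vertex, in accordance with left
  ends being at least 1.\<close>

lemma card_preceding: "v \<in> L \<Longrightarrow> card (preceding child_rel v) = lo v"
proof -
  assume v: "v \<in> L"
  have lv: "lo v \<le> n" using lo_hi[OF v] by linarith
  have "gap ` {x \<in> L. gap x < lo v} = {..<lo v}"
  proof
    show "{..<lo v} \<subseteq> gap ` {x \<in> L. gap x < lo v}"
    proof
      fix z assume z: "z \<in> {..<lo v}"
      then obtain x where "x \<in> L" "gap x = z" using gap_surj[of z] lv by auto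
      then show "z \<in> gap ` {x \<in> L. gap x < lo v}" using z by blast
    qed
  qed auto
  moreover have "card (gap ` {x \<in> L. gap x < lo v}) = card {x \<in> L. gap x < lo v}"
    using inj_gap by (intro card_image) (auto intro: inj_on_subset)
  ultimately show ?thesis using preceding_child_rel[OF v] by simp
qed

lemma pts_T: "i \<in> {1..n} \<Longrightarrow> pts (T i) = I i"
  by (auto simp: pts_def lo_def hi_def)

lemma pts_psubset_iff:
  assumes "i \<in> {1..n}" "j \<in> {1..n}"
  shows "pts (T i) \<subset> pts (T j) \<longleftrightarrow> below i j"
proof -
  have m: "i \<in> L" "j \<in> L" using assms by auto
  show ?thesis
    unfolding pts_T[OF assms(1)] pts_T[OF assms(2)]
  proof
    assume "I i \<subset> I j"
    then show "below i j"
      using m lo_hi(1)[OF m(1)] lo_hi(1)[OF m(2)]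
      by (auto simp: below_def psubset_eq atLeastLessThan_subset_iff)
  next
    assume b: "below i j"
    then have "I i \<noteq> I j"
      using below_size[OF b] lo_hi(1)[OF m(1)] lo_hi(1)[OF m(2)]
      by (auto simp: atLeastLessThan_eq_iff)
    moreover have "I i \<subseteq> I j" using b by (auto simp: below_def)
    ultimately show "I i \<subset> I j" by blast
  qed
qed

lemma hasse_iff: "(i, j) \<in> hasse n T \<longleftrightarrow> j \<noteq> Suc n \<and> child i j"
proof (cases "i \<in> {1..n} \<and> j \<in> {1..n}")
  case True
  have mem: "k \<in> {1..n}" if "below k j" for k
  proof -
    have "k \<noteq> Suc n" using that not_above_top by blast
    then show ?thesis using that by (auto simp: below_def)
  qed
  have "(\<exists>k\<in>{1..n}. pts (T i) \<subset> pts (T k) \<and> pts (T k) \<subset> pts (T j)) \<longleftrightarrow>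
      (\<exists>k\<in>{1..n}. below i k \<and> below k j)"
    using True by (intro bex_cong) (simp_all only: pts_psubset_iff)
  also have "\<dots> \<longleftrightarrow> (\<exists>k. below i k \<and> below k j)" using mem by blast
  finally have between: "(\<exists>k\<in>{1..n}. pts (T i) \<subset> pts (T k) \<and> pts (T k) \<subset> pts (T j)) \<longleftrightarrow>
      (\<exists>k. below i k \<and> below k j)" .
  have "(i, j) \<in> hasse n T \<longleftrightarrow> pts (T i) \<subset> pts (T j) \<and>
      \<not> (\<exists>k\<in>{1..n}. pts (T i) \<subset> pts (T k) \<and> pts (T k) \<subset> pts (T j))"
    using True by (simp add: hasse_def)
  then have "(i, j) \<in> hasse n T \<longleftrightarrow> child i j"
    using True unfolding between by (simp only: pts_psubset_iff child_def)
  then show ?thesis using True by auto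
next
  case False
  then show ?thesis using child_mem[of i j] by (auto simp: hasse_def)
qed

lemma roots_hasse: "roots n (hasse n T) = {i. child i (Suc n)}"
proof (intro equalityI subsetI)
  fix i assume "i \<in> roots n (hasse n T)"
  then have i: "i \<in> {1..n}" "\<And>j. (i, j) \<notin> hasse n T" by (auto simp: roots_def)
  then show "i \<in> {i. child i (Suc n)}" using par[OF i(1)] hasse_iff by (metis mem_Collect_eq)
next
  fix i assume "i \<in> {i. child i (Suc n)}"
  then have c: "child i (Suc n)" by simp
  then have "(i, j) \<notin> hasse n T" for j using hasse_iff child_unique by blast
  then show "i \<in> roots n (hasse n T)" using child_mem[OF c] by (auto simp: roots_def)
qed

lemma children_hasse: "j \<noteq> Suc n \<Longrightarrow> children (hasse n T) j = {i. child i j}"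
  by (auto simp: children_def hasse_iff)

lemma rooted_tree_hasse: "rooted_tree n (hasse n T) = child_rel"
  unfolding rooted_tree_def roots_hasse by (auto simp: hasse_iff)

lemma rooted_forest_hasse: "rooted_forest n (hasse n T)"
proof -
  have sub: "hasse n T \<subseteq> child_rel" by (auto simp: hasse_iff)
  have "acyclic child_rel" using child_trancl by (auto simp: acyclic_def below_def)
  then show ?thesis using sub single_valued_child_rel
    by (auto simp: rooted_forest_def hasse_def intro: acyclic_subset single_valued_subset)
qed

end

text \<open>Left end and length of each support are numbers of vertices in the tree with virtual
  root, which the forest determines.\<close>

lemma hasse_determines_sequence:
  assumes "ces n T" "ces n T'" "hasse n T = hasse n T'" "i \<in> {1..n}"
  shows "T i = T' i"
proof -
  interpret A: exc_seq n T by unfold_locales fact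
  interpret B: exc_seq n T' by unfold_locales fact
  have rel: "A.child_rel = B.child_rel"
    using assms(3) A.rooted_tree_hasse B.rooted_tree_hasse by simp
  have i: "i \<in> {1..Suc n}" using assms(4) by auto
  have "A.lo i = B.lo i" using A.card_preceding[OF i] B.card_preceding[OF i] rel by simp
  moreover have "A.hi i - A.lo i = B.hi i - B.lo i"
    using A.card_desc[OF i] B.card_desc[OF i] rel by simp
  ultimately have "A.lo i = B.lo i" "A.hi i = B.hi i" using A.lo_hi[OF i] B.lo_hi[OF i] by linarith+
  then show ?thesis using assms(4) by (simp add: A.lo_def B.lo_def A.hi_def B.hi_def prod_eq_iff)
qed

section \<open>From a rooted forest to a sequence\<close>

lemma pts_subset_iff: "edge n A \<Longrightarrow> pts A \<subseteq> pts B \<longleftrightarrow> fst B \<le> fst A \<and> snd A \<le> snd B"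
  by (auto simp: pts_def edge_def atLeastLessThan_subset_iff)

locale forest_tree =
  fixes n :: nat and F :: forest
  assumes forest: "rooted_forest n F"
begin

abbreviation C :: forest where "C \<equiv> rooted_tree n F"

lemma C_dom: "(u, v) \<in> C \<Longrightarrow> u \<in> {1..n} \<and> v \<in> {1..Suc n}"
  using forest by (auto simp: rooted_tree_def rooted_forest_def roots_def)

lemma sv: "single_valued C"
  using forest by (auto simp: rooted_tree_def rooted_forest_def roots_def single_valued_def)

lemma acyclic_C: "acyclic C"
proof -
  have "(x, y) \<in> F\<^sup>+ \<or> y = Suc n" if "(x, y) \<in> C\<^sup>+" for x y
    using that
  proof induction
    case (base y)
    then show ?case by (auto simp: rooted_tree_def)
  next
    case (step y z)
    have "y \<noteq> Suc n" using C_dom[OF step(2)] by auto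
    then show ?case using step by (auto simp: rooted_tree_def intro: trancl_into_trancl)
  qed
  moreover have "(Suc n, y) \<notin> C\<^sup>+" for y using C_dom[of "Suc n"] by (auto dest!: tranclD)
  ultimately show ?thesis using forest unfolding rooted_forest_def acyclic_def by metis
qed

lemma no_cycle: "(x, y) \<in> C \<Longrightarrow> (y, x) \<in> C\<^sup>* \<Longrightarrow> False"
  using acyclic_C unfolding acyclic_def by (meson rtrancl_into_trancl2)

lemma ex_parent: "v \<in> {1..n} \<Longrightarrow> \<exists>w. (v, w) \<in> C"
  unfolding rooted_tree_def roots_def by blast

lemma to_top: assumes "v \<in> {1..n}" shows "(v, Suc n) \<in> C\<^sup>+"
proof -
  have fin: "finite C" by (rule finite_subset[of _ "{1..n} \<times> {1..Suc n}"]) (use C_dom in auto)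
  have "wf (C\<inverse>)" using fin acyclic_C by (rule finite_acyclic_wf_converse)
  then show ?thesis using assms
  proof (induction v rule: wf_induct_rule)
    case (less v)
    obtain w where w: "(v, w) \<in> C" using ex_parent less.prems by blast
    show ?case
    proof (cases "w = Suc n")
      case False
      then have "w \<in> {1..n}" using C_dom[OF w] by auto
      then show ?thesis using less.IH[of w] w by (auto intro: trancl_into_trancl2)
    qed (use w in auto)
  qed
qed

lemma comparable: "(x, y) \<in> C\<^sup>* \<Longrightarrow> (x, z) \<in> C\<^sup>* \<Longrightarrow> (y, z) \<in> C\<^sup>* \<or> (z, y) \<in> C\<^sup>*"
  by (rule single_valued_confluent[OF sv])

lemma siblings_desc_disjoint:
  assumes "(u, w) \<in> C" "(v, w) \<in> C" "u \<noteq> v"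
  shows "desc C u \<inter> desc C v = {}"
proof -
  have nr: False if uv: "(a, b) \<in> C\<^sup>*" "(a, w) \<in> C" "(b, w) \<in> C" "a \<noteq> b" for a b
    using uv(1)
  proof (cases rule: converse_rtranclE)
    case (step y)
    then have "y = w" using single_valuedD[OF sv] uv by blast
    then show False using step no_cycle[OF uv(3)] by blast
  qed (use uv in simp)
  show ?thesis
  proof (rule ccontr)
    assume "desc C u \<inter> desc C v \<noteq> {}"
    then obtain x where "(x, u) \<in> C\<^sup>*" "(x, v) \<in> C\<^sup>*" by (auto simp: desc_def)
    then show False using comparable nr assms by metis
  qed
qed

lemma desc_mono: "(v, w) \<in> C\<^sup>* \<Longrightarrow> desc C v \<subseteq> desc C w"
  by (auto simp: desc_def)

lemma desc_self: "v \<in> desc C v"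
  by (simp add: desc_def)

lemma desc_dom: "v \<in> {1..Suc n} \<Longrightarrow> desc C v \<subseteq> {1..Suc n}"
proof
  fix x assume v: "v \<in> {1..Suc n}" and "x \<in> desc C v"
  then have "(x, v) \<in> C\<^sup>*" by (simp add: desc_def)
  then show "x \<in> {1..Suc n}" by (cases rule: converse_rtranclE) (use v C_dom in force)+
qed

lemma preceding_in_subset: "preceding_in C w v \<subseteq> desc C w"
proof
  fix x assume "x \<in> preceding_in C w v"
  then consider "x = w" | u where "x \<in> desc C u" "(u, w) \<in> C" by (auto simp: preceding_in_def)
  then show "x \<in> desc C w"
  proof cases
    case 2
    then show ?thesis using desc_mono[of u w] by auto
  qed (simp add: desc_self)
qed

lemma preceding_in_disjoint: assumes "(v, w) \<in> C" shows "preceding_in C w v \<inter> desc C v = {}"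
proof -
  have "x \<notin> desc C v" if "x \<in> preceding_in C w v" for x
  proof -
    from that consider "x = w" | u where "x \<in> desc C u" "(u, w) \<in> C" "before w u v"
      by (auto simp: preceding_in_def)
    then show ?thesis
    proof cases
      case 1
      then show ?thesis using no_cycle[OF assms] by (auto simp: desc_def)
    next
      case 2
      then have "u \<noteq> v" using before_irrefl by blast
      then show ?thesis using siblings_desc_disjoint[OF 2(2) assms] 2(1) by blast
    qed
  qed
  then show ?thesis by blast
qed

lemma preceding_disjoint: "preceding C v \<inter> desc C v = {}"
proof -
  have "x \<notin> desc C v" if "x \<in> preceding C v" for x
  proof -
    from that obtain v' w where p: "(v, v') \<in> C\<^sup>*" "(v', w) \<in> C" "x \<in> preceding_in C w v'"
      unfolding preceding_def by blast
    then show ?thesis using preceding_in_disjoint[OF p(2)] desc_mono[OF p(1)] by blast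
  qed
  then show ?thesis by blast
qed

lemma preceding_dom: "preceding C v \<subseteq> {1..Suc n}"
proof
  fix x assume "x \<in> preceding C v"
  then obtain v' w where p: "(v', w) \<in> C" "x \<in> preceding_in C w v'"
    unfolding preceding_def by blast
  then show "x \<in> {1..Suc n}" using preceding_in_subset desc_dom[of w] C_dom[OF p(1)] by blast
qed

text \<open>By \<open>card_preceding\<close> and \<open>card_desc\<close>, these counts are the only
  possible ends for a sequence with this forest.\<close>

definition pos :: "nat \<Rightarrow> nat" where "pos v = card (preceding C v)"
definition ending :: "nat \<Rightarrow> nat" where "ending v = card (preceding C v \<union> desc C v)"

lemma fin_preceding: "finite (preceding C v)"
  using preceding_dom finite_subset by blast

lemma fin_desc: "v \<in> {1..Suc n} \<Longrightarrow> finite (desc C v)"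
  using desc_dom finite_subset by blast

lemma pos_less_ending: assumes "v \<in> {1..Suc n}" shows "pos v < ending v"
  unfolding pos_def ending_def
  by (rule psubset_card_mono) (use fin_preceding fin_desc[OF assms] preceding_disjoint desc_self
      in blast)+

text \<open>If the left ends agree, \<open>w\<close> does not precede \<open>v\<close>, so
  \<open>v < w\<close> fails. If the right ends agree, \<open>w\<close> must be among the vertices
  preceding \<open>v\<close>, which forces \<open>v < w\<close>. These are the equality cases of
  \<open>relative_position\<close>.\<close>

lemma child_position:
  assumes c: "(v, w) \<in> C"
  shows "pos w \<le> pos v" "ending v \<le> ending w"
    "pos v = pos w \<Longrightarrow> w < v" "ending v = ending w \<Longrightarrow> v < w"
proof -
  have p: "preceding C v = preceding_in C w v \<union> preceding C w" by (rule preceding_step[OF sv c])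
  have wL: "w \<in> {1..Suc n}" using C_dom[OF c] by blast
  have vw: "v \<noteq> w" using no_cycle[OF c] by blast
  have sub: "preceding C v \<union> desc C v \<subseteq> preceding C w \<union> desc C w"
    using p preceding_in_subset desc_mono[of v w] c by blast
  show "pos w \<le> pos v" unfolding pos_def by (rule card_mono) (use p fin_preceding in blast)+
  show "ending v \<le> ending w" unfolding ending_def
    by (rule card_mono) (use sub fin_preceding fin_desc[OF wL] in auto)
  show "w < v" if "pos v = pos w"
  proof -
    have "preceding C w \<subseteq> preceding C v" using p by blast
    then have "preceding C w = preceding C v"
      by (rule card_subset_eq[OF fin_preceding]) (use that in \<open>simp add: pos_def\<close>)
    moreover have "w \<notin> preceding C w" using preceding_disjoint[of w] desc_self by blast
    ultimately have "\<not> v < w" using p by (auto simp: preceding_in_def)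
    then show ?thesis using vw by simp
  qed
  show "v < w" if "ending v = ending w"
  proof -
    have "preceding C v \<union> desc C v = preceding C w \<union> desc C w"
      by (rule card_subset_eq) (use sub fin_preceding fin_desc[OF wL] that in \<open>auto simp:
          ending_def\<close>)
    then have "w \<in> preceding C v \<union> desc C v" using desc_self by blast
    moreover have "w \<notin> preceding C w" using preceding_disjoint[of w] desc_self by blast
    moreover have "w \<notin> desc C v" using no_cycle[OF c] by (auto simp: desc_def)
    ultimately have "w \<in> preceding_in C w v" using p by blast
    moreover have "w \<notin> desc C u" if "(u, w) \<in> C" for u using no_cycle[OF that]
        by (auto simp: desc_def)
    ultimately show ?thesis by (auto simp: preceding_in_def)
  qed
qed

lemma desc_position:
  assumes "(v, w) \<in> C\<^sup>+"
  shows "pos w \<le> pos v \<and> ending v \<le> ending w \<and> (pos v = pos w \<longrightarrow> w < v) \<and> (ending v = ending w \<longrightarrow>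
      v < w)"
  using assms
proof induction
  case (base y)
  then show ?case using child_position by blast
next
  case (step y z)
  have "pos z \<le> pos y" "ending y \<le> ending z" "pos y = pos z \<Longrightarrow> z < y" "ending y = ending z \<Longrightarrow> y < z"
    using child_position[OF step(2)] by auto
  then show ?case using step.IH by auto
qed

text \<open>Touching siblings with decreasing labels would satisfy \<open>v < w\<close> and
  \<open>w < u\<close>; but then \<open>w\<close> precedes \<open>v\<close> and not
  \<open>u\<close>, so its gap keeps them apart.\<close>

lemma sibling_position:
  assumes u: "(u, w) \<in> C" and v: "(v, w) \<in> C" and b: "before w u v"
  shows "ending u \<le> pos v" "ending u = pos v \<Longrightarrow> u < v"
proof -
  have pu: "preceding C u = preceding_in C w u \<union> preceding C w" by (rule preceding_step[OF sv u])
  have pv: "preceding C v = preceding_in C w v \<union> preceding C w" by (rule preceding_step[OF sv v])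
  have "preceding_in C w u \<subseteq> preceding_in C w v"
    using b before_trans[of w _ u v] by (auto simp: preceding_in_def before_def)
  moreover have "desc C u \<subseteq> preceding_in C w v" using u b by (auto simp: preceding_in_def)
  ultimately have sub: "preceding C u \<union> desc C u \<subseteq> preceding C v" using pu pv by blast
  show "ending u \<le> pos v" unfolding ending_def pos_def
    by (rule card_mono) (use sub fin_preceding in auto)
  show "u < v" if "ending u = pos v"
  proof (rule ccontr)
    assume "\<not> u < v"
    then have vw: "v < w" "w < u" using b by (auto simp: before_def)
    have "preceding C u \<union> desc C u = preceding C v"
      by (rule card_subset_eq) (use sub fin_preceding that in \<open>auto simp: ending_def pos_def\<close>)
    moreover have "w \<in> preceding C v" using vw pv by (auto simp: preceding_in_def)
    ultimately have "w \<in> preceding C u \<union> desc C u" by simp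
    moreover have "w \<notin> preceding C w" using preceding_disjoint[of w] desc_self by blast
    moreover have nd: "w \<notin> desc C x" if "(x, w) \<in> C" for x using no_cycle[OF that]
        by (auto simp: desc_def)
    moreover have "w \<notin> preceding_in C w u" using vw nd by (auto simp: preceding_in_def)
    ultimately show False using pu u by blast
  qed
qed

text \<open>The witness \<open>w\<close> is the lowest common ancestor, and \<open>u\<close>,
  \<open>v\<close> are its children on the paths to \<open>i\<close> and \<open>j\<close>.\<close>

lemma ex_meet:
  assumes i: "i \<in> {1..Suc n}" and j: "j \<in> {1..n}" and ij: "(i, j) \<notin> C\<^sup>*" and ji: "(j, i) \<notin> C\<^sup>*"
  shows "\<exists>u v w. (u, w) \<in> C \<and> (v, w) \<in> C \<and> u \<noteq> v \<and> (i, u) \<in> C\<^sup>* \<and> (j, v) \<in> C\<^sup>*"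
proof -
  have "i \<noteq> Suc n" using ji trancl_into_rtrancl[OF to_top[OF j]] by auto
  then have "(i, Suc n) \<in> C\<^sup>*" using to_top[of i] i by auto
  moreover have "(j, Suc n) \<in> C\<^sup>*" using to_top[of j] j by auto
  ultimately show ?thesis using ij ji
  proof (induction i rule: converse_rtrancl_induct)
    case base
    then show ?case by blast
  next
    case (step y z)
    show ?case
    proof (cases "(j, z) \<in> C\<^sup>*")
      case True
      have "j \<noteq> z" using step.prems step.hyps by auto
      then have "(j, z) \<in> C\<^sup>+" using True by (auto simp: rtrancl_eq_or_trancl)
      then obtain v where v: "(j, v) \<in> C\<^sup>*" "(v, z) \<in> C" by (auto dest: tranclD2)
      show ?thesis
      proof (cases "v = y")
        case True
        then have "(j, y) \<in> C\<^sup>*" using v by simp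
        then show ?thesis using step.prems by blast
      next
        case False
        then show ?thesis using v step.hyps(1) by blast
      qed
    next
      case False
      have "(z, j) \<notin> C\<^sup>*" using step.prems step.hyps(1) by (meson converse_rtrancl_into_rtrancl)
      then obtain u v w where "(u, w) \<in> C" "(v, w) \<in> C" "u \<noteq> v" "(z, u) \<in> C\<^sup>*" "(j, v) \<in> C\<^sup>*"
        using step.IH step.prems False by blast
      then show ?thesis using step.hyps(1) by (meson converse_rtrancl_into_rtrancl)
    qed
  qed
qed

text \<open>Incomparable vertices inherit their position from the two siblings where their paths
  meet, including the label order in the case of touching ends.\<close>

lemma relative_position_tree:
  assumes i: "i \<in> {1..n}" and j: "j \<in> {1..n}" and "i \<noteq> j"
  shows "(i, j) \<in> C\<^sup>+ \<and> pos j \<le> pos i \<and> ending i \<le> ending j \<and> (pos i = pos j \<longrightarrow> j < i) \<and> (ending i =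
      ending j \<longrightarrow> i < j)
    \<or> (j, i) \<in> C\<^sup>+ \<and> pos i \<le> pos j \<and> ending j \<le> ending i \<and> (pos j = pos i \<longrightarrow> i < j) \<and> (ending j =
        ending i \<longrightarrow> j < i)
    \<or> ending i \<le> pos j \<and> (ending i = pos j \<longrightarrow> i < j)
    \<or> ending j \<le> pos i \<and> (ending j = pos i \<longrightarrow> j < i)"
proof -
  have up: "pos u \<le> pos i \<and> ending i \<le> ending u \<and> (pos i = pos u \<longrightarrow> u \<le> i) \<and> (ending i = ending u \<longrightarrow>
      i \<le> u)"
    if "(i, u) \<in> C\<^sup>*" for i u
    using rtranclD[OF that] desc_position[of i u] by fastforce
  have side: "ending i \<le> pos j \<and> (ending i = pos j \<longrightarrow> i < j)"
    if "(i, u) \<in> C\<^sup>*" "(j, v) \<in> C\<^sup>*" "ending u \<le> pos v" "ending u = pos v \<Longrightarrow> u < v" for i j u v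
    using up[OF that(1)] up[OF that(2)] that(3,4) by fastforce
  consider "(i, j) \<in> C\<^sup>*" | "(j, i) \<in> C\<^sup>*" | "(i, j) \<notin> C\<^sup>*" "(j, i) \<notin> C\<^sup>*" by blast
  then show ?thesis
  proof cases
    case 1
    then have "(i, j) \<in> C\<^sup>+" using \<open>i \<noteq> j\<close> by (simp add: rtrancl_eq_or_trancl)
    then show ?thesis using desc_position[of i j] by blast
  next
    case 2
    then have "(j, i) \<in> C\<^sup>+" using \<open>i \<noteq> j\<close> by (simp add: rtrancl_eq_or_trancl)
    then show ?thesis using desc_position[of j i] by blast
  next
    case 3
    then obtain u v w where m: "(u, w) \<in> C" "(v, w) \<in> C" "u \<noteq> v" "(i, u) \<in> C\<^sup>*" "(j, v) \<in> C\<^sup>*"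
      using ex_meet[of i j] i j by auto
    have "u \<noteq> w" "v \<noteq> w" using no_cycle m(1,2) by blast+
    then consider "before w u v" | "before w v u" using before_total m(3) by blast
    then show ?thesis
    proof cases
      case 1
      then show ?thesis using side[OF m(4,5) sibling_position[OF m(1,2)]] by blast
    next
      case 2
      then show ?thesis using side[OF m(5,4) sibling_position[OF m(2,1)]] by blast
    qed
  qed
qed

definition tree_seq :: "nat \<Rightarrow> nat \<times> nat" where "tree_seq v = (pos v, ending v)"

lemma edge_tree_seq: assumes v: "v \<in> {1..n}" shows "edge n (tree_seq v)"
proof -
  obtain r where r: "(v, r) \<in> C\<^sup>*" "(r, Suc n) \<in> C" using to_top[OF v] by (auto dest: tranclD2)
  \<comment> \<open>The path upwards ends with a child of the virtual root. Its label is smaller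
    than \<open>Suc n\<close>, so the virtual root precedes \<open>v\<close> and the left end is at
    least 1.\<close>
  then have "Suc n \<in> preceding_in C (Suc n) r" using C_dom[OF r(2)] by (auto simp: preceding_in_def)
  then have "preceding C v \<noteq> {}" using r unfolding preceding_def by blast
  then have "0 < pos v" using fin_preceding by (simp add: pos_def card_gt_0_iff)
  moreover have "ending v \<le> card {1..Suc n}" unfolding ending_def
    by (rule card_mono) (use preceding_dom desc_dom[of v] v in auto)
  ultimately show ?thesis using pos_less_ending[of v] v by (simp add: edge_def tree_seq_def)
qed

lemma ces_tree_seq: "ces n tree_seq"
proof -
  have "exc (tree_seq i) (tree_seq j)" if ij: "i \<in> {1..n}" "j \<in> {1..n}" "i < j" for i j
  proof -
    have "pos i < ending i" "pos j < ending j" using pos_less_ending ij by auto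
    then have "pos i \<le> pos j \<and> ending j < ending i \<or> pos j < pos i \<and> ending i \<le> ending j
        \<or> ending i \<le> pos j \<or> ending j < pos i"
      using relative_position_tree[OF ij(1,2)] ij(3) by linarith
    then show ?thesis using \<open>pos i < ending i\<close> \<open>pos j < ending j\<close>
      unfolding exc_def pts_def tree_seq_def by (elim disjE) simp_all
  qed
  then show ?thesis using edge_tree_seq by (simp add: ces_def)
qed

lemma psubset_tree_seq_iff:
  assumes i: "i \<in> {1..n}" and j: "j \<in> {1..n}"
  shows "pts (tree_seq i) \<subset> pts (tree_seq j) \<longleftrightarrow> (i, j) \<in> C\<^sup>+"
proof (cases "i = j")
  case True
  then show ?thesis using acyclic_C by (auto simp: acyclic_def)
next
  case False
  have p: "pos i < ending i" "pos j < ending j" using pos_less_ending i j by auto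
  have "pts (tree_seq i) \<subset> pts (tree_seq j) \<longleftrightarrow>
      (pos j \<le> pos i \<and> ending i \<le> ending j) \<and> \<not> (pos i \<le> pos j \<and> ending j \<le> ending i)"
    by (simp only: less_le_not_le pts_subset_iff[OF edge_tree_seq[OF i]]
        pts_subset_iff[OF edge_tree_seq[OF j]]) (simp add: tree_seq_def)
  also have "\<dots> \<longleftrightarrow> (i, j) \<in> C\<^sup>+"
  proof
    assume "(i, j) \<in> C\<^sup>+"
    then show "(pos j \<le> pos i \<and> ending i \<le> ending j) \<and> \<not> (pos i \<le> pos j \<and> ending j \<le> ending i)"
      using desc_position[of i j] by (metis le_antisym less_asym')
  next
    assume "(pos j \<le> pos i \<and> ending i \<le> ending j) \<and> \<not> (pos i \<le> pos j \<and> ending j \<le> ending i)"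
    then have "\<not> ending i \<le> pos j" "\<not> ending j \<le> pos i" "\<not> (pos i \<le> pos j \<and> ending j \<le> ending i)"
      using p by auto
    then show "(i, j) \<in> C\<^sup>+" using relative_position_tree[OF i j False] by blast
  qed
  finally show ?thesis .
qed

text \<open>Inclusion of the intervals is the transitive closure of the tree relation. Since parents
  are unique and there are no cycles, its covering pairs are the tree edges again.\<close>

lemma hasse_tree_seq: "hasse n tree_seq = F"
proof -
  interpret S: exc_seq n tree_seq by unfold_locales (rule ces_tree_seq)
  have b: "S.below i j \<longleftrightarrow> (i, j) \<in> C\<^sup>+" if "i \<in> {1..n}" "j \<in> {1..n}" for i j
    using S.pts_psubset_iff[OF that] psubset_tree_seq_iff[OF that] by simp
  have FC: "(i, j) \<in> F \<longleftrightarrow> (i, j) \<in> C" if "j \<in> {1..n}" for i j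
    using that by (auto simp: rooted_tree_def)
  have mem: "k \<in> {1..n}" if "S.below k j" "j \<in> {1..n}" for k j
    using that S.not_above_top[of j] by (cases "k = Suc n") (auto simp: S.below_def)
  have "(i, j) \<in> hasse n tree_seq \<longleftrightarrow> (i, j) \<in> F" if ij: "i \<in> {1..n}" "j \<in> {1..n}" for i j
  proof -
    have "(i, j) \<in> hasse n tree_seq \<longleftrightarrow> S.child i j" using S.hasse_iff ij by auto
    also have "\<dots> \<longleftrightarrow> (i, j) \<in> C"
    proof
      assume c: "S.child i j"
      then have "(i, j) \<in> C\<^sup>+" using b[OF ij] by (simp add: S.child_def)
      then obtain k where k: "(i, k) \<in> C" "(k, j) \<in> C\<^sup>*" by (meson tranclD)
      show "(i, j) \<in> C"
      proof (cases "k = j")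
        case False
        then have kj: "(k, j) \<in> C\<^sup>+" using k(2) by (simp add: rtrancl_eq_or_trancl)
        then have km: "k \<in> {1..n}" using C_dom by (meson tranclD)
        then show ?thesis using c k(1) kj b[OF ij(1) km] b[OF km ij(2)] by (auto simp: S.child_def)
      qed (use k in simp)
    next
      assume c: "(i, j) \<in> C"
      have "False" if k: "S.below i k" "S.below k j" for k
      proof -
        have km: "k \<in> {1..n}" using mem[OF k(2) ij(2)] .
        then have "(i, k) \<in> C\<^sup>+" "(k, j) \<in> C\<^sup>+" using b[OF ij(1) km] b[OF km ij(2)] k by auto
        then obtain y where "(i, y) \<in> C" "(y, k) \<in> C\<^sup>*" by (meson tranclD)
        moreover have "y = j" using single_valuedD[OF sv c] calculation(1) by blast
        ultimately show False using \<open>(k, j) \<in> C\<^sup>+\<close> acyclic_C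
            by (meson acyclic_def rtrancl_trancl_trancl)
      qed
      then show "S.child i j" using b[OF ij] c by (auto simp: S.child_def)
    qed
    finally show ?thesis using FC ij by simp
  qed
  moreover have "hasse n tree_seq \<subseteq> {1..n} \<times> {1..n}" "F \<subseteq> {1..n} \<times> {1..n}"
    using forest by (auto simp: hasse_def rooted_forest_def)
  ultimately show ?thesis by (intro equalityI subrelI) blast+
qed

end

theorem rooted_forest_iff_hasse: "rooted_forest n F \<longleftrightarrow> (\<exists>T. ces n T \<and> hasse n T = F)"
proof
  assume "rooted_forest n F"
  then interpret forest_tree n F by unfold_locales
  show "\<exists>T. ces n T \<and> hasse n T = F" using ces_tree_seq hasse_tree_seq by blast
next
  assume "\<exists>T. ces n T \<and> hasse n T = F"
  then show "rooted_forest n F" using exc_seq.rooted_forest_hasse exc_seq.intro by blast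
qed

section \<open>Conjugation of sequences\<close>

text \<open>The points are flipped by x -> n + 2 - x. On modules this is the duality followed by
  renumbering vertex i as n + 1 - i.\<close>

definition reflect :: "nat \<Rightarrow> nat \<times> nat \<Rightarrow> nat \<times> nat" where
  "reflect n A = (Suc (Suc n) - snd A, Suc (Suc n) - fst A)"

definition rev_seq :: "nat \<Rightarrow> (nat \<Rightarrow> nat \<times> nat) \<Rightarrow> nat \<Rightarrow> nat \<times> nat" where
  "rev_seq n T i = reflect n (T (Suc n - i))"

text \<open>The sequence after the factors \<open>\<delta>\<^sub>k\<^sub>-\<^sub>1 \<dots> \<delta>\<^sub>1\<close> have acted.\<close>
definition garside_stage :: "nat \<Rightarrow> (nat \<Rightarrow> nat \<times> nat) \<Rightarrow> nat \<Rightarrow> nat \<Rightarrow> nat \<times> nat" where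
  "garside_stage n T k i = (if i \<le> k then exc_seq.dual_edge n T (Suc k - i) else T i)"

definition conj_seq :: "nat \<Rightarrow> (nat \<Rightarrow> nat \<times> nat) \<Rightarrow> nat \<Rightarrow> nat \<times> nat" where
  "conj_seq n T i = reflect n (exc_seq.dual_edge n T i)"

text \<open>The first excluded pattern is that of a nonzero homomorphism from the module of
  \<open>B\<close> to that of \<open>A\<close>, the second that of a nonsplit extension.\<close>

lemma exc_iff:
  assumes "edge n A" "edge n B"
  shows "exc A B \<longleftrightarrow> \<not> (fst A \<le> fst B \<and> fst B < snd A \<and> snd A \<le> snd B) \<and>
    \<not> (fst B < fst A \<and> fst A \<le> snd B \<and> snd B < snd A)"
proof -
  have "fst A < snd A" "fst B < snd B" using assms by (simp_all add: edge_def)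
  then show ?thesis unfolding exc_def pts_def atLeastLessThan_iff by linarith
qed

lemma edge_reflect: "edge n A \<Longrightarrow> edge n (reflect n A)"
  by (auto simp: edge_def reflect_def)

lemma reflect_reflect: "edge n A \<Longrightarrow> reflect n (reflect n A) = A"
  by (cases A) (auto simp: edge_def reflect_def)

lemma exc_reflect:
  assumes A: "edge n A" and B: "edge n B"
  shows "exc (reflect n B) (reflect n A) \<longleftrightarrow> exc A B"
proof -
  have le: "Suc (Suc n) - a \<le> Suc (Suc n) - b \<longleftrightarrow> b \<le> a" "Suc (Suc n) - a < Suc (Suc n) - b \<longleftrightarrow> b < a"
    if "a \<le> Suc n" "b \<le> Suc n" for a b
    using that by auto
  have "fst A \<le> Suc n" "snd A \<le> Suc n" "fst B \<le> Suc n" "snd B \<le> Suc n"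
    using A B by (simp_all add: edge_def)
  then show ?thesis
    unfolding exc_iff[OF A B] exc_iff[OF edge_reflect[OF B] edge_reflect[OF A]]
    by (auto simp: reflect_def le)
qed

lemma pts_reflect_subset:
  assumes A: "edge n A" and B: "edge n B"
  shows "pts (reflect n A) \<subseteq> pts (reflect n B) \<longleftrightarrow> pts A \<subseteq> pts B"
  using A B unfolding pts_subset_iff[OF A] pts_subset_iff[OF edge_reflect[OF A]]
  by (auto simp: reflect_def edge_def)

lemma ces_edge: "ces n T \<Longrightarrow> i \<in> {1..n} \<Longrightarrow> edge n (T i)"
  by (simp add: ces_def)

lemma ces_exc: "ces n T \<Longrightarrow> i \<in> {1..n} \<Longrightarrow> j \<in> {1..n} \<Longrightarrow> i < j \<Longrightarrow> exc (T i) (T j)"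
  by (simp add: ces_def)

lemma flip_mem: "i \<in> {1..n} \<Longrightarrow> Suc n - i \<in> {1..n}"
  by auto

lemma flip_flip: "i \<in> {1..n} \<Longrightarrow> Suc n - (Suc n - i) = i"
  by auto

lemma ces_rev_seq:
  assumes "ces n T"
  shows "ces n (rev_seq n T)"
  unfolding ces_def
proof (intro conjI ballI impI)
  fix i assume i: "i \<in> {1..n}"
  show "edge n (rev_seq n T i)"
    unfolding rev_seq_def by (intro edge_reflect ces_edge[OF assms] flip_mem i)
  fix j assume j: "j \<in> {1..n}" and "i < j"
  then have "Suc n - j < Suc n - i" using i by auto
  then have "exc (T (Suc n - j)) (T (Suc n - i))"
    using ces_exc[OF assms flip_mem[OF j] flip_mem[OF i]] by blast
  then show "exc (rev_seq n T i) (rev_seq n T j)"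
    unfolding rev_seq_def using exc_reflect ces_edge[OF assms] flip_mem i j by blast
qed

lemma hasse_rev_seq:
  assumes T: "\<And>i. i \<in> {1..n} \<Longrightarrow> edge n (T i)"
  shows "hasse n (rev_seq n T) = dual n (hasse n T)"
proof -
  let ?f = "\<lambda>i. Suc n - i"
  have ps: "pts (rev_seq n T i) \<subset> pts (rev_seq n T j) \<longleftrightarrow> pts (T (?f i)) \<subset> pts (T (?f j))"
    if "i \<in> {1..n}" "j \<in> {1..n}" for i j
    unfolding less_le_not_le rev_seq_def
    using pts_reflect_subset[OF T T] flip_mem that by metis
  have flip_bex: "(\<exists>k\<in>{1..n}. P (?f k)) \<longleftrightarrow> (\<exists>k\<in>{1..n}. P k)" for P
    using flip_mem[of _ n] flip_flip[of _ n] by metis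
  have mem: "(i, j) \<in> hasse n (rev_seq n T) \<longleftrightarrow> (?f i, ?f j) \<in> hasse n T"
    if ij: "i \<in> {1..n}" "j \<in> {1..n}" for i j
  proof -
    have "(\<exists>k\<in>{1..n}. pts (rev_seq n T i) \<subset> pts (rev_seq n T k) \<and>
        pts (rev_seq n T k) \<subset> pts (rev_seq n T j))
        \<longleftrightarrow> (\<exists>k\<in>{1..n}. pts (T (?f i)) \<subset> pts (T (?f k)) \<and> pts (T (?f k)) \<subset> pts (T (?f j)))"
      using ij by (intro bex_cong) (simp_all only: ps)
    also have "\<dots> \<longleftrightarrow> (\<exists>k\<in>{1..n}. pts (T (?f i)) \<subset> pts (T k) \<and> pts (T k) \<subset> pts (T (?f j)))"
      by (rule flip_bex)
    finally show ?thesis using ij flip_mem[OF ij(1)] flip_mem[OF ij(2)]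
      by (simp only: hasse_def mem_Collect_eq prod.case mem_Sigma_iff ps simp_thms)
  qed
  have d: "hasse n S \<subseteq> {1..n} \<times> {1..n}" for S by (auto simp: hasse_def)
  show ?thesis
  proof (intro equalityI subrelI)
    fix i j assume h: "(i, j) \<in> hasse n (rev_seq n T)"
    then have ij: "i \<in> {1..n}" "j \<in> {1..n}" using subsetD[OF d h] by auto
    have "(?f i, ?f j) \<in> hasse n T" using mem[OF ij] h by simp
    then have "(?f (?f i), ?f (?f j)) \<in> dual n (hasse n T)" unfolding dual_def by force
    then show "(i, j) \<in> dual n (hasse n T)" using ij by (simp add: flip_flip)
  next
    fix i j assume "(i, j) \<in> dual n (hasse n T)"
    then obtain c p where cp: "i = ?f c" "j = ?f p" "(c, p) \<in> hasse n T" by (auto simp: dual_def)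
    then have m: "c \<in> {1..n}" "p \<in> {1..n}" using subsetD[OF d cp(3)] by auto
    then show "(i, j) \<in> hasse n (rev_seq n T)"
      using mem[OF flip_mem[OF m(1)] flip_mem[OF m(2)]] cp
          unfolding flip_flip[OF m(1)] flip_flip[OF m(2)] by simp
  qed
qed

lemma hasse_cong:
  assumes "\<And>i. i \<in> {1..n} \<Longrightarrow> T i = T' i"
  shows "hasse n T = hasse n T'"
  by (intro equalityI subrelI) (simp_all add: hasse_def assms cong: conj_cong)

context exc_seq begin

text \<open>Dual edges come in reversed order, as \<open>exc_dual_edges\<close> demands. Mixed pairs
  fall under \<open>exc_dual_edge\<close>, because a dual edge in front has a label at most
  \<open>k\<close> and an original term behind has a larger one.\<close>

lemma ces_garside_stage:
  assumes "k \<le> n"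
  shows "ces n (garside_stage n T k)"
  unfolding ces_def
proof (intro conjI ballI impI)
  fix i assume i: "i \<in> {1..n}"
  show "edge n (garside_stage n T k i)"
  proof (cases "i \<le> k")
    case True
    then have "Suc k - i \<in> {1..n}" using i assms by auto
    then show ?thesis using dual_edge True by (simp add: garside_stage_def)
  qed (use ces_edge[OF ces i] in \<open>simp add: garside_stage_def\<close>)
  fix j assume j: "j \<in> {1..n}" and "i < j"
  then consider "j \<le> k" | "i \<le> k" "k < j" | "k < i" by linarith
  then show "exc (garside_stage n T k i) (garside_stage n T k j)"
  proof cases
    case 1
    then have "Suc k - j \<in> {1..n}" "Suc k - i \<in> {1..n}" "Suc k - j < Suc k - i"
      using i j \<open>i < j\<close> assms by auto
    then show ?thesis using exc_dual_edges 1 \<open>i < j\<close> by (simp add: garside_stage_def)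
  next
    case 2
    then have "Suc k - i \<in> {1..n}" "j \<noteq> Suc k - i" using i j assms by auto
    then show ?thesis using exc_dual_edge j 2 by (simp add: garside_stage_def)
  next
    case 3
    then show ?thesis using ces_exc[OF ces i j] \<open>i < j\<close> by (simp add: garside_stage_def)
  qed
qed

lemma conj_seq_eq: "i \<in> {1..n} \<Longrightarrow> conj_seq n T i = rev_seq n (garside_stage n T n) i"
  by (auto simp: conj_seq_def rev_seq_def garside_stage_def)

lemma ces_conj_seq: "ces n (conj_seq n T)"
proof -
  have "ces n (rev_seq n (garside_stage n T n))" by (intro ces_rev_seq ces_garside_stage) simp
  then show ?thesis unfolding ces_def using conj_seq_eq by simp
qed

lemma hasse_conj_seq: "hasse n (conj_seq n T) = dual n (hasse n (garside_stage n T n))"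
proof -
  have "hasse n (conj_seq n T) = hasse n (rev_seq n (garside_stage n T n))"
    by (rule hasse_cong) (rule conj_seq_eq)
  also have "\<dots> = dual n (hasse n (garside_stage n T n))"
    by (rule hasse_rev_seq) (rule ces_edge[OF ces_garside_stage], simp_all)
  finally show ?thesis .
qed

text \<open>Towards the conjugate sequence, \<open>reflect n (T i)\<close> satisfies the relations
  that determine its \<open>i\<close>-th dual edge: reflection turns them into
  \<open>exc_dual_edge\<close> for \<open>T\<close>.\<close>

lemma conj_conj_seq:
  assumes i: "i \<in> {1..n}"
  shows "conj_seq n (conj_seq n T) i = T i"
proof -
  interpret D: exc_seq n "conj_seq n T" by unfold_locales (rule ces_conj_seq)
  have Ti: "edge n (T i)" using ces_edge[OF ces i] .
  have "D.dual_edge i = reflect n (T i)"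
  proof (rule D.edge_determined[OF i])
    show "edge n (D.dual_edge i)" using D.dual_edge[OF i] .
    show "edge n (reflect n (T i))" using edge_reflect[OF Ti] .
    fix j assume j: "j \<in> {1..n}" "j \<noteq> i"
    show "exc (D.dual_edge i) (conj_seq n T j)" using D.exc_dual_edge[OF i j] .
    show "exc (reflect n (T i)) (conj_seq n T j)"
      unfolding conj_seq_def exc_reflect[OF dual_edge[OF j(1)] Ti]
      using exc_dual_edge[OF j(1) i] j(2) by blast
  qed
  then show ?thesis using reflect_reflect[OF Ti] by (simp add: conj_seq_def)
qed

text \<open>The right end is \<open>Suc n\<close> iff the lower gap is 0, and 0 is the gap of the
  virtual root alone. So the parent of \<open>i\<close> has to be the virtual root.\<close>

lemma snd_conj_seq: "i \<in> {1..n} \<Longrightarrow> snd (conj_seq n T i) = Suc n \<longleftrightarrow> i \<in> roots n (hasse n T)"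
proof -
  assume i: "i \<in> {1..n}"
  have iL: "i \<in> L" "i \<noteq> Suc n" using i by auto
  have z: "gap v = 0 \<longleftrightarrow> v = Suc n" if "v \<in> L" for v
    using inj_onD[OF inj_gap, of v "Suc n"] that by auto
  have "snd (conj_seq n T i) = Suc n - low i" by (simp add: conj_seq_def reflect_def dual_edge_def)
  then have "snd (conj_seq n T i) = Suc n \<longleftrightarrow> low i = 0" by arith
  also have "\<dots> \<longleftrightarrow> gap (par i) = 0" using z[OF iL(1)] iL(2) by (simp add: low_def min_def)
  also have "\<dots> \<longleftrightarrow> par i = Suc n" using z[OF par_mem[OF i]] .
  also have "\<dots> \<longleftrightarrow> child i (Suc n)" using par[OF i] par_eq by metis
  also have "\<dots> \<longleftrightarrow> i \<in> roots n (hasse n T)" by (simp add: roots_hasse)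
  finally show ?thesis .
qed

text \<open>The left end is 1 iff the upper gap is the last one. This singles out the vertex with
  gap \<open>n\<close> and its children.\<close>

lemma fst_conj_seq:
  assumes i: "i \<in> {1..n}"
  shows "fst (conj_seq n T i) = 1 \<longleftrightarrow> gap i = n \<or> gap (par i) = n"
proof -
  have g: "gap i \<le> n" "gap (par i) \<le> n" using gap_le i par_mem[OF i] by auto
  have "fst (conj_seq n T i) = Suc n - up i" by (simp add: conj_seq_def reflect_def dual_edge_def)
  then have "fst (conj_seq n T i) = 1 \<longleftrightarrow> up i = n" using g unfolding up_def by arith
  then show ?thesis using g unfolding up_def by arith
qed

section \<open>Chains of projective vertices\<close>

definition lesser :: "nat \<Rightarrow> nat set" where "lesser w = {c. child c w \<and> c < w}"

lemma finite_lesser: "finite (lesser w)"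
  by (rule finite_subset[of _ "{..<w}"]) (auto simp: lesser_def)

lemma last_point: "w \<in> L \<Longrightarrow> n \<in> I w \<longleftrightarrow> hi w = Suc n"
  using lo_hi[of w] by auto

lemma last_child:
  assumes w: "w \<in> L" "hi w = Suc n" and g: "gap w \<noteq> n"
  obtains u where "u \<in> lesser w" "hi u = Suc n"
proof -
  obtain x where x: "x \<in> L" "gap x = n" using gap_surj[of n] by auto
  then have "below x w" using gap_mem_iff[OF x(1) w(1)] last_point[OF w(1)] w(2) g by metis
  then obtain u where u: "child u w" "x = u \<or> below x u" using below_child by blast
  have uL: "u \<in> L" and b: "below u w" using u(1) by (auto simp: child_def below_def)
  have "n \<in> I u" using gap_mem_iff[OF x(1) uL] u(2) x(2) by simp
  then have hu: "hi u = Suc n" using last_point[OF uL] by simp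
  then have "u \<in> lesser w" using right_end_label[OF b] w(2) u(1) by (simp add: lesser_def)
  then show ?thesis using that hu by blast
qed

lemma last_siblings:
  assumes "child u w" "child v w" "hi u = Suc n" "hi v = Suc n"
  shows "u = v"
proof (rule ccontr)
  assume "u \<noteq> v"
  moreover have "u \<in> L" "v \<in> L" using assms(1,2) by (auto simp: child_def below_def)
  ultimately show False using siblings_disjoint[OF assms(1,2)] lo_hi(1)[of u] lo_hi(1)[of v]
      assms(3,4)
    by linarith
qed

text \<open>Children with smaller label stand to the right of the gap in increasing order, so the
  largest one is the last. As the gap is not the last point, some such child covers that
  point.\<close>

lemma Max_lesser:
  assumes w: "w \<in> L" "hi w = Suc n" and ne: "lesser w \<noteq> {}"
  shows "child (Max (lesser w)) w" "Max (lesser w) < w" "hi (Max (lesser w)) = Suc n"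
proof -
  let ?m = "Max (lesser w)"
  have "?m \<in> lesser w" using Max_in[OF finite_lesser ne] .
  then show m: "child ?m w" "?m < w" by (auto simp: lesser_def)
  have mL: "?m \<in> L" using m(1) by (auto simp: child_def below_def)
  have "gap w \<noteq> n" using child_side(2)[OF m] lo_hi[OF mL] by auto
  then obtain u where u: "u \<in> lesser w" "hi u = Suc n" using last_child[OF w] by blast
  have "u \<le> ?m" using Max_ge[OF finite_lesser u(1)] .
  moreover have "\<not> u < ?m"
    using sibling_order[of u w ?m] m u lo_hi[OF mL] by (auto simp: lesser_def)
  ultimately show "hi ?m = Suc n" using u(2) by simp
qed

text \<open>The child of \<open>w\<close> at or above \<open>v\<close> also ends at
  \<open>Suc n\<close>, and only one child of \<open>w\<close> can do so.\<close>

lemma below_Max_lesser: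
  assumes b: "below v w" and v: "hi v = Suc n"
  shows "lesser w \<noteq> {}" "v = Max (lesser w) \<or> below v (Max (lesser w))"
proof -
  have w: "w \<in> L" "hi w = Suc n" using b v lo_hi[of w] by (auto simp: below_def)
  obtain u where u: "child u w" "v = u \<or> below v u" using below_child b by blast
  have uL: "u \<in> L" and bu: "below u w" using u(1) by (auto simp: child_def below_def)
  have hu: "hi u = Suc n" using u(2) v lo_hi(2)[OF uL] by (auto simp: below_def)
  have "u \<in> lesser w" using u(1) right_end_label[OF bu] hu w by (simp add: lesser_def)
  then show ne: "lesser w \<noteq> {}" by blast
  note m = Max_lesser[OF w ne]
  have "u = Max (lesser w)" using last_siblings[OF u(1) m(1) hu m(3)] .
  then show "v = Max (lesser w) \<or> below v (Max (lesser w))" using u(2) by simp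
qed

text \<open>The virtual root is meant as the last entry: its lesser children are the roots, so the
  rule for the last projective vertex becomes an instance of the rule for the others.\<close>

definition proj_chain :: "nat list \<Rightarrow> bool" where
  "proj_chain xs \<longleftrightarrow>
     (\<forall>i. Suc i < length xs \<longrightarrow> lesser (xs ! Suc i) \<noteq> {} \<and> xs ! i = Max (lesser (xs ! Suc i))) \<and>
     lesser (hd xs) = {}"

text \<open>The supports ending at \<open>Suc n\<close> are nested, and each step down from the
  virtual root passes to the next one. The chain cannot stop early, because a further such support
  below its last vertex would make \<open>lesser\<close> nonempty.\<close>

lemma proj_chain_set:
  assumes pc: "proj_chain (js @ [Suc n])"
  shows "sorted_wrt (<) js" "set js = {v \<in> {1..n}. hi v = Suc n}"
proof -
  let ?xs = "js @ [Suc n]" and ?m = "length js"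
  have st: "lesser (?xs ! Suc i) \<noteq> {}" "?xs ! i = Max (lesser (?xs ! Suc i))" if "i < ?m" for i
    using pc that unfolding proj_chain_def by auto
  have hi: "?xs ! i \<in> L \<and> hi (?xs ! i) = Suc n" if "i \<le> ?m" for i
    using that
  proof (induction i rule: inc_induct)
    case base
    then show ?case by simp
  next
    case (step i)
    have "child (?xs ! i) (?xs ! Suc i)" "hi (?xs ! i) = Suc n"
      using Max_lesser[of "?xs ! Suc i"] step st[of i] by auto
    then show ?case by (auto simp: child_def below_def)
  qed
  have ch: "child (?xs ! i) (?xs ! Suc i) \<and> ?xs ! i < ?xs ! Suc i" if "i < ?m" for i
    using Max_lesser[of "?xs ! Suc i"] hi[of "Suc i"] st[OF that] that by auto
  have "sorted_wrt (<) ?xs" using ch by (auto simp: sorted_wrt_iff_nth_Suc_transp)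
  then show "sorted_wrt (<) js" by (simp add: sorted_wrt_append)
  have "v \<in> {v \<in> {1..n}. hi v = Suc n}" if "v \<in> set js" for v
  proof -
    obtain i where i: "i < ?m" "v = ?xs ! i" using \<open>v \<in> set js\<close>
        by (auto simp: in_set_conv_nth nth_append)
    then show ?thesis using ch[OF i(1)] hi[of i] child_mem by auto
  qed
  moreover have "v \<in> set js" if v: "v \<in> {1..n}" "hi v = Suc n" for v
  proof (rule ccontr)
    assume nv: "v \<notin> set js"
    have "below v (?xs ! i)" if "i \<le> ?m" for i
      using that
    proof (induction i rule: inc_induct)
      case base
      then show ?case using below_top[OF v(1)] by simp
    next
      case (step i)
      have "?xs ! i \<in> set js" using step.hyps by (simp add: nth_append)
      then have "v \<noteq> ?xs ! i" using nv by blast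
      then show ?case using below_Max_lesser(2)[OF step.IH v(2)] st(2)[OF step.hyps(2)] by metis
    qed
    then have b: "below v (?xs ! 0)" by simp
    have "lesser (?xs ! 0) = {}" using pc by (simp add: proj_chain_def hd_conv_nth)
    then show False using below_Max_lesser(1)[OF b v(2)] by blast
  qed
  ultimately show "set js = {v \<in> {1..n}. hi v = Suc n}" by blast
qed

lemma ex_proj_chain: "w \<in> L \<Longrightarrow> hi w = Suc n \<Longrightarrow> \<exists>js. proj_chain (js @ [w])"
proof (induction "hi w - lo w" arbitrary: w rule: less_induct)
  case less
  show ?case
  proof (cases "lesser w = {}")
    case True
    then have "proj_chain ([] @ [w])" by (simp add: proj_chain_def)
    then show ?thesis by blast
  next
    case False
    let ?m = "Max (lesser w)"
    note m = Max_lesser[OF less.prems False]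
    have "below ?m w" using m(1) by (simp add: child_def)
    then have "hi ?m - lo ?m < hi w - lo w" "?m \<in> L" using below_size by (auto simp: below_def)
    then obtain js where js: "proj_chain (js @ [?m])" using less.hyps[of ?m] m(3) by blast
    have "proj_chain ((js @ [?m]) @ [w])"
      unfolding proj_chain_def
    proof (intro conjI allI impI)
      fix i assume i: "Suc i < length ((js @ [?m]) @ [w])"
      consider "Suc i < length (js @ [?m])" | "i = length js" using i by fastforce
      then have "lesser (((js @ [?m]) @ [w]) ! Suc i) \<noteq> {} \<and>
          ((js @ [?m]) @ [w]) ! i = Max (lesser (((js @ [?m]) @ [w]) ! Suc i))"
      proof cases
        case 1
        then have "((js @ [?m]) @ [w]) ! Suc i = (js @ [?m]) ! Suc i"
          "((js @ [?m]) @ [w]) ! i = (js @ [?m]) ! i" by (simp_all only: nth_append) simp_all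
        then show ?thesis using js 1 unfolding proj_chain_def by metis
      next
        case 2
        then show ?thesis using False by (simp add: nth_append)
      qed
      then show "lesser (((js @ [?m]) @ [w]) ! Suc i) \<noteq> {}"
        "((js @ [?m]) @ [w]) ! i = Max (lesser (((js @ [?m]) @ [w]) ! Suc i))" by blast+
    next
      show "lesser (hd ((js @ [?m]) @ [w])) = {}" using js
          by (cases js) (simp_all add: proj_chain_def)
    qed
    then show ?thesis by blast
  qed
qed

lemma lesser_top: "lesser (Suc n) = roots n (hasse n T)"
  using child_mem by (fastforce simp: lesser_def roots_hasse)

lemma lesser_hasse: "w \<noteq> Suc n \<Longrightarrow> lesser w = smaller_children (hasse n T) w"
  by (simp add: lesser_def smaller_children_def children_hasse)

lemma roots_nonempty: assumes "n \<ge> 1" shows "roots n (hasse n T) \<noteq> {}"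
proof
  assume "roots n (hasse n T) = {}"
  then have "lesser (Suc n) = {}" using lesser_top by simp
  then have "gap (Suc n) = n" using last_child[of "Suc n"] by force
  then show False using assms by simp
qed

lemma projective_iff_proj_chain:
  assumes n: "n \<ge> 1"
  shows "projective_vertices n (hasse n T) js \<longleftrightarrow> proj_chain (js @ [Suc n])"
proof -
  let ?F = "hasse n T" and ?xs = "js @ [Suc n]"
  have eq: "projective_vertices n ?F js \<longleftrightarrow> proj_chain ?xs"
      if mem: "set js \<subseteq> {1..n}" and ne: "js \<noteq> []"
  proof -
    have L: "lesser v = smaller_children ?F v" if "v \<in> set js" for v
      using lesser_hasse[of v] mem that by fastforce
    have l: "lesser (js ! i) = smaller_children ?F (js ! i)" if "i < length js" for i
      using L that by simp
    have hd: "lesser (hd ?xs) = smaller_children ?F (hd js)" using L ne by simp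
    have last: "?xs ! (length js - 1) = last js" "?xs ! (length js) = Suc n"
      using ne by (simp_all add: nth_append last_conv_nth)
    have "(\<forall>i. Suc i < length ?xs \<longrightarrow> lesser (?xs ! Suc i) \<noteq> {} \<and> ?xs ! i =
        Max (lesser (?xs ! Suc i))) \<longleftrightarrow>
       last js = Max (roots n ?F) \<and> (\<forall>i. Suc i < length js \<longrightarrow>
        smaller_children ?F (js ! Suc i) \<noteq> {} \<and> js ! i = Max (smaller_children ?F (js ! Suc i)))"
      (is "?A \<longleftrightarrow> ?B")
    proof
      assume A: ?A
      have "?xs ! (length js - 1) = Max (lesser (?xs ! Suc (length js - 1)))" using A ne by simp
      then have "last js = Max (roots n ?F)" using last ne lesser_top by simp
      moreover have "smaller_children ?F (js ! Suc i) \<noteq> {} \<and> js ! i =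
          Max (smaller_children ?F (js ! Suc i))"
        if "Suc i < length js" for i
        using A[rule_format, of i] that l[of "Suc i"] by (simp add: nth_append)
      ultimately show ?B by blast
    next
      assume B: ?B
      show ?A
      proof (intro allI impI)
        fix i assume i: "Suc i < length ?xs"
        show "lesser (?xs ! Suc i) \<noteq> {} \<and> ?xs ! i = Max (lesser (?xs ! Suc i))"
        proof (cases "Suc i < length js")
          case True
          then show ?thesis using B l[of "Suc i"] by (simp add: nth_append)
        next
          case False
          then have "Suc i = length js" using i by simp
          moreover from this have "i = length js - 1" by simp
          ultimately have "?xs ! Suc i = Suc n" "?xs ! i = last js" using last by simp_all
          then show ?thesis using B lesser_top roots_nonempty[OF n] by simp
        qed
      qed
    qed
    then show ?thesis using ne hd unfolding projective_vertices_def proj_chain_def by blast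
  qed
  have fin: "finite (roots n ?F)" by (simp add: roots_def)
  have finF: "finite (smaller_children ?F v)" for v
    by (rule finite_subset[of _ "{..<v}"]) (auto simp: smaller_children_def)
  have "set js \<subseteq> {1..n} \<and> js \<noteq> []" if p: "projective_vertices n ?F js"
  proof -
    have ne: "js \<noteq> []" using p by (simp add: projective_vertices_def)
    have "js ! i \<in> {1..n}" if i: "i < length js" for i
    proof (cases "Suc i < length js")
      case True
      then have "smaller_children ?F (js ! Suc i) \<noteq> {}" "js ! i =
          Max (smaller_children ?F (js ! Suc i))"
        using p by (simp_all add: projective_vertices_def)
      then have "js ! i \<in> smaller_children ?F (js ! Suc i)" using Max_in[OF finF] by metis
      then show ?thesis by (auto simp: smaller_children_def children_def hasse_def)
    next
      case False
      then have "i = length js - 1" using i by simp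
      then have "js ! i = last js" using ne by (simp add: last_conv_nth)
      then have "js ! i = Max (roots n ?F)" using p by (simp add: projective_vertices_def)
      then have "js ! i \<in> roots n ?F" using Max_in[OF fin roots_nonempty[OF n]] by simp
      then show ?thesis by (simp add: roots_def)
    qed
    then show ?thesis using ne by (auto simp: in_set_conv_nth)
  qed
  moreover have "set js \<subseteq> {1..n} \<and> js \<noteq> []" if p: "proj_chain ?xs"
  proof -
    have "js \<noteq> []"
    proof
      assume "js = []"
      then have "roots n ?F = {}" using p lesser_top by (simp add: proj_chain_def)
      then show False using roots_nonempty[OF n] by blast
    qed
    then show ?thesis using proj_chain_set(2)[OF p] by blast
  qed
  ultimately show ?thesis using eq by blast
qed

theorem projective_vertices_hasse:
  assumes "n \<ge> 1"
  shows "projective_vertices n (hasse n T) js \<longleftrightarrow>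
    sorted_wrt (<) js \<and> set js = {v \<in> {1..n}. snd (T v) = Suc n}"
proof -
  have hs: "{v \<in> {1..n}. hi v = Suc n} = {v \<in> {1..n}. snd (T v) = Suc n}" by (auto simp: hi_def)
  \<comment> \<open>A chain exists, and a strictly increasing list is determined by its set of
    entries; this gives the direction from the right to the left.\<close>
  obtain js' where "proj_chain (js' @ [Suc n])" using ex_proj_chain[of "Suc n"] by auto
  then show ?thesis
    unfolding projective_iff_proj_chain[OF assms] using proj_chain_set hs strict_sorted_equal
        by metis
qed

end

section \<open>Duality and injective vertices\<close>

lemma Max_flip:
  assumes "A \<subseteq> {1..n}" "A \<noteq> {}"
  shows "Max ((\<lambda>x. Suc n - x) ` A) = Suc n - Min A"
proof (rule Max_eqI)
  have fin: "finite A" using assms(1) finite_subset by blast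
  then show "finite ((\<lambda>x. Suc n - x) ` A)" by blast
  show "Suc n - Min A \<in> (\<lambda>x. Suc n - x) ` A" using Min_in[OF fin assms(2)] by blast
  fix y assume "y \<in> (\<lambda>x. Suc n - x) ` A"
  then show "y \<le> Suc n - Min A" using Min_le[OF fin] by (auto intro: diff_le_mono2)
qed

lemma flip_eq_iff: "i \<in> {1..n} \<Longrightarrow> j \<in> {1..n} \<Longrightarrow> Suc n - i = Suc n - j \<longleftrightarrow> i = j"
  by auto

lemma mem_dual:
  assumes "F \<subseteq> {1..n} \<times> {1..n}" "i \<in> {1..n}" "j \<in> {1..n}"
  shows "(Suc n - i, Suc n - j) \<in> dual n F \<longleftrightarrow> (i, j) \<in> F"
proof
  assume "(Suc n - i, Suc n - j) \<in> dual n F"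
  then obtain c p where cp: "Suc n - i = Suc n - c" "Suc n - j = Suc n - p" "(c, p) \<in> F"
    by (auto simp: dual_def)
  then have "c \<in> {1..n}" "p \<in> {1..n}" using assms(1) by auto
  then have "i = c" "j = p" using cp flip_eq_iff assms(2,3) by blast+
  then show "(i, j) \<in> F" using cp by simp
next
  show "(i, j) \<in> F \<Longrightarrow> (Suc n - i, Suc n - j) \<in> dual n F" by (force simp: dual_def)
qed

lemma dual_subset: "F \<subseteq> {1..n} \<times> {1..n} \<Longrightarrow> dual n F \<subseteq> {1..n} \<times> {1..n}"
  by (fastforce simp: dual_def)

lemma dual_dual:
  assumes F: "F \<subseteq> {1..n} \<times> {1..n}"
  shows "dual n (dual n F) = F"
proof -
  have "(i, j) \<in> dual n (dual n F) \<longleftrightarrow> (i, j) \<in> F" if "i \<in> {1..n}" "j \<in> {1..n}" for i j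
    using mem_dual[OF dual_subset[OF F] flip_mem[OF that(1)] flip_mem[OF that(2)]]
      mem_dual[OF F that] flip_flip[OF that(1)] flip_flip[OF that(2)] by simp
  moreover have "dual n (dual n F) \<subseteq> {1..n} \<times> {1..n}" using dual_subset F by blast
  ultimately show ?thesis using F by (intro equalityI subrelI) blast+
qed

lemma flip_image_eqI:
  assumes A: "A \<subseteq> {1..n}" and B: "B \<subseteq> {1..n}" and "\<And>i. i \<in> {1..n} \<Longrightarrow> Suc n - i \<in> A \<longleftrightarrow> i \<in> B"
  shows "A = (\<lambda>x. Suc n - x) ` B"
proof (intro equalityI subsetI)
  fix x assume x: "x \<in> A"
  then have "x \<in> {1..n}" using A by blast
  then have "x = Suc n - (Suc n - x)" "Suc n - x \<in> {1..n}" using flip_flip flip_mem by auto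
  then show "x \<in> (\<lambda>x. Suc n - x) ` B" using assms(3) x by (metis image_eqI)
next
  fix x assume "x \<in> (\<lambda>x. Suc n - x) ` B"
  then show "x \<in> A" using assms(2,3) by blast
qed

lemma children_subset: "F \<subseteq> {1..n} \<times> {1..n} \<Longrightarrow> children F v \<subseteq> {1..n}"
  by (auto simp: children_def)

lemma children_dual:
  assumes F: "F \<subseteq> {1..n} \<times> {1..n}" and v: "v \<in> {1..n}"
  shows "children (dual n F) (Suc n - v) = (\<lambda>x. Suc n - x) ` children F v"
  by (rule flip_image_eqI[OF children_subset[OF dual_subset[OF F]] children_subset[OF F]])
    (simp add: children_def mem_dual[OF F _ v])

lemma smaller_children_dual:
  assumes F: "F \<subseteq> {1..n} \<times> {1..n}" and v: "v \<in> {1..n}"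
  shows "smaller_children (dual n F) (Suc n - v) = (\<lambda>x. Suc n - x) ` larger_children F v"
proof (rule flip_image_eqI)
  show "smaller_children (dual n F) (Suc n - v) \<subseteq> {1..n}"
    using children_subset[OF dual_subset[OF F]] by (auto simp: smaller_children_def)
  show "larger_children F v \<subseteq> {1..n}" using children_subset[OF F]
      by (auto simp: larger_children_def)
  fix i assume i: "i \<in> {1..n}"
  have "Suc n - i < Suc n - v \<longleftrightarrow> v < i" using i v by auto
  then show "Suc n - i \<in> smaller_children (dual n F) (Suc n - v) \<longleftrightarrow> i \<in> larger_children F v"
    using mem_dual[OF F i v] by (simp add: smaller_children_def larger_children_def children_def)
qed

lemma roots_dual:
  assumes F: "F \<subseteq> {1..n} \<times> {1..n}"
  shows "roots n (dual n F) = (\<lambda>x. Suc n - x) ` roots n F"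
proof (rule flip_image_eqI)
  fix i assume i: "i \<in> {1..n}"
  have "Suc n - i \<in> Domain (dual n F) \<longleftrightarrow> i \<in> Domain F"
  proof
    assume "Suc n - i \<in> Domain (dual n F)"
    then obtain j where j: "(Suc n - i, j) \<in> dual n F" by blast
    then have "j \<in> {1..n}" using dual_subset[OF F] by blast
    then have "(i, Suc n - j) \<in> F" using j mem_dual[OF F i flip_mem] flip_flip by metis
    then show "i \<in> Domain F" by blast
  next
    assume "i \<in> Domain F"
    then obtain j where j: "(i, j) \<in> F" by blast
    then have "j \<in> {1..n}" using F by blast
    then show "Suc n - i \<in> Domain (dual n F)" using mem_dual[OF F i] j by blast
  qed
  then show "Suc n - i \<in> roots n (dual n F) \<longleftrightarrow> i \<in> roots n F"
    using i flip_mem[OF i] by (simp only: roots_def Diff_iff simp_thms)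
qed (auto simp: roots_def)

text \<open>Flipping the labels exchanges larger and smaller children as well as minima and maxima,
  and turns an increasing list into a decreasing one, hence the reversal.\<close>

lemma injective_iff_projective_dual:
  assumes F: "F \<subseteq> {1..n} \<times> {1..n}" and r: "roots n F \<noteq> {}" and ks: "set ks \<subseteq> {1..n}"
  shows "injective_vertices n F ks \<longleftrightarrow>
      projective_vertices n (dual n F) (rev (map (\<lambda>x. Suc n - x) ks))"
proof (cases "ks = []")
  case True
  then show ?thesis by (simp add: injective_vertices_def projective_vertices_def)
next
  case False
  let ?js = "rev (map (\<lambda>x. Suc n - x) ks)"
  have mem: "ks ! i \<in> {1..n}" if "i < length ks" for i using subsetD[OF ks nth_mem[OF that]] .
  have hd_mem: "hd ks \<in> {1..n}" "last ks \<in> {1..n}"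
    using subsetD[OF ks hd_in_set[OF False]] subsetD[OF ks last_in_set[OF False]] .
  have js: "?js ! i = Suc n - ks ! (length ks - Suc i)" if "i < length ks" for i
    using that by (simp add: rev_nth)
  have rs: "roots n F \<subseteq> {1..n}" by (auto simp: roots_def)
  have lc: "larger_children F v \<subseteq> {1..n}" for v
    using children_subset[OF F] by (auto simp: larger_children_def)
  have "last ?js = Max (roots n (dual n F)) \<longleftrightarrow> hd ks = Min (roots n F)"
  proof -
    have "Min (roots n F) \<in> {1..n}" using Min_in[OF finite_subset[OF rs] r] rs by auto
    moreover have "last ?js = Suc n - hd ks" using False by (simp add: last_rev hd_map)
    ultimately show ?thesis
      unfolding roots_dual[OF F] Max_flip[OF rs r] using flip_eq_iff hd_mem by metis
  qed
  moreover have "smaller_children (dual n F) (hd ?js) = {} \<longleftrightarrow> larger_children F (last ks) = {}"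
  proof -
    have "hd ?js = Suc n - last ks" using False by (simp add: hd_rev last_map)
    then show ?thesis using smaller_children_dual[OF F hd_mem(2)] by simp
  qed
  moreover have "(\<forall>i. Suc i < length ?js \<longrightarrow> smaller_children (dual n F) (?js ! Suc i) \<noteq> {} \<and>
        ?js ! i = Max (smaller_children (dual n F) (?js ! Suc i))) \<longleftrightarrow>
      (\<forall>i. Suc i < length ks \<longrightarrow> larger_children F (ks ! i) \<noteq> {} \<and>
        ks ! Suc i = Min (larger_children F (ks ! i)))"
    (is "(\<forall>i. Suc i < length ?js \<longrightarrow> ?P i) \<longleftrightarrow> (\<forall>i. Suc i < length ks \<longrightarrow> ?R i)")
  proof -
    \<comment> \<open>Entry \<open>i\<close> of the reversed list is entry
      \<open>length ks - Suc i\<close> of \<open>ks\<close>, so the pair of neighbours at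
      \<open>i\<close> corresponds to the pair at \<open>length ks - Suc (Suc i)\<close>.\<close>
    have PR: "?P i \<longleftrightarrow> ?R (length ks - Suc (Suc i))" if i: "Suc i < length ks" for i
    proof -
      let ?l = "length ks - Suc (Suc i)"
      have l: "?l < length ks" "Suc ?l < length ks" "length ks - Suc i = Suc ?l" using i by auto
      have j1: "?js ! Suc i = Suc n - ks ! ?l" using js[OF i] .
      have j0: "?js ! i = Suc n - ks ! Suc ?l" using js[of i] i l(3) by simp
      have sc: "smaller_children (dual n F) (?js ! Suc i) =
          (\<lambda>x. Suc n - x) ` larger_children F (ks ! ?l)"
        unfolding j1 by (rule smaller_children_dual[OF F mem[OF l(1)]])
      show ?thesis
      proof (cases "larger_children F (ks ! ?l) = {}")
        case True
        then show ?thesis using sc by simp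
      next
        case False
        then have "Min (larger_children F (ks ! ?l)) \<in> {1..n}"
          using subsetD[OF lc Min_in[OF finite_subset[OF lc] False]] by simp
        then have "Suc n - ks ! Suc ?l = Suc n - Min (larger_children F (ks ! ?l)) \<longleftrightarrow>
            ks ! Suc ?l = Min (larger_children F (ks ! ?l))"
          using flip_eq_iff mem[OF l(2)] by blast
        then show ?thesis unfolding sc j0 Max_flip[OF lc False] using False by simp
      qed
    qed
    have len: "length ?js = length ks" by simp
    show ?thesis unfolding len
    proof (intro iffI allI impI)
      fix i assume A: "\<forall>i. Suc i < length ks \<longrightarrow> ?P i" and i: "Suc i < length ks"
      then have "?P (length ks - Suc (Suc i))" by simp
      then show "?R i" using PR[of "length ks - Suc (Suc i)"] i by (simp add: Suc_diff_Suc)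
    next
      fix i assume A: "\<forall>i. Suc i < length ks \<longrightarrow> ?R i" and i: "Suc i < length ks"
      then have "?R (length ks - Suc (Suc i))" by simp
      then show "?P i" using PR[OF i] by blast
    qed
  qed
  ultimately show ?thesis using False unfolding injective_vertices_def projective_vertices_def
      by simp
qed

lemma injective_vertices_mem:
  assumes F: "F \<subseteq> {1..n} \<times> {1..n}" and r: "roots n F \<noteq> {}" and inj: "injective_vertices n F ks"
  shows "set ks \<subseteq> {1..n}"
proof -
  have ne: "ks \<noteq> []" using inj by (simp add: injective_vertices_def)
  have fin: "finite (larger_children F v)" for v
    by (rule finite_subset[of _ "{1..n}"]) (use children_subset[OF F] in \<open>auto simp:
        larger_children_def\<close>)
  have "ks ! i \<in> {1..n}" if i: "i < length ks" for i
  proof (cases i)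
    case 0
    have "hd ks = Min (roots n F)" using inj by (simp add: injective_vertices_def)
    moreover have "finite (roots n F)" by (simp add: roots_def)
    ultimately have "hd ks \<in> roots n F" using Min_in r by metis
    then show ?thesis using 0 ne by (simp add: hd_conv_nth roots_def)
  next
    case (Suc m)
    then have "larger_children F (ks ! m) \<noteq> {}" "ks ! i = Min (larger_children F (ks ! m))"
      using inj i by (simp_all add: injective_vertices_def)
    then have "ks ! i \<in> larger_children F (ks ! m)" using Min_in[OF fin] by metis
    then show ?thesis using subsetD[OF children_subset[OF F]] unfolding larger_children_def by blast
  qed
  then show ?thesis by (auto simp: in_set_conv_nth)
qed

lemma sorted_flip:
  assumes "set ks \<subseteq> {1..n}"
  shows "sorted_wrt (<) (rev (map (\<lambda>x. Suc n - x) ks)) \<longleftrightarrow> sorted_wrt (<) ks"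
proof -
  have "Suc n - y < Suc n - x \<longleftrightarrow> x < y" if "x \<in> set ks" "y \<in> set ks" for x y
    using that assms by auto
  then have "sorted_wrt (\<lambda>x y. Suc n - y < Suc n - x) ks \<longleftrightarrow> sorted_wrt (<) ks"
    using sorted_wrt_mono_rel[of ks "\<lambda>x y. Suc n - y < Suc n - x" "(<)"]
      sorted_wrt_mono_rel[of ks "(<)" "\<lambda>x y. Suc n - y < Suc n - x"] by blast
  then show ?thesis by (simp add: sorted_wrt_rev sorted_wrt_map)
qed

lemma image_flip_flip: "A \<subseteq> {1..n} \<Longrightarrow> (\<lambda>x. Suc n - x) ` (\<lambda>x. Suc n - x) ` A = A"
  by (force simp: image_image)

lemma image_flip_eq_iff:
  assumes "A \<subseteq> {1..n}" "B \<subseteq> {1..n}"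
  shows "(\<lambda>x. Suc n - x) ` A = (\<lambda>x. Suc n - x) ` B \<longleftrightarrow> A = B"
  using image_flip_flip assms by metis

lemma hasse_subset: "hasse n T \<subseteq> {1..n} \<times> {1..n}"
  by (auto simp: hasse_def)

context exc_seq begin

text \<open>Reflection turns the left end 1 into the right end \<open>Suc n\<close>, so the claim is
  the projective one for the reversed sequence.\<close>

theorem injective_vertices_hasse:
  assumes n: "n \<ge> 1"
  shows "injective_vertices n (hasse n T) ks \<longleftrightarrow>
    sorted_wrt (<) ks \<and> set ks = {v \<in> {1..n}. fst (T v) = 1}"
proof -
  interpret R: exc_seq n "rev_seq n T" by unfold_locales (rule ces_rev_seq[OF ces])
  have dual: "hasse n (rev_seq n T) = dual n (hasse n T)"
    by (rule hasse_rev_seq) (rule ces_edge[OF ces])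
  have ends: "{v \<in> {1..n}. snd (rev_seq n T v) = Suc n} = (\<lambda>x. Suc n - x) ` {v \<in> {1..n}. fst (T v) =
      1}"
  proof (rule flip_image_eqI)
    fix i assume i: "i \<in> {1..n}"
    have "1 \<le> fst (T i)" "fst (T i) \<le> Suc n" using ces_edge[OF ces i] by (auto simp: edge_def)
    then show "Suc n - i \<in> {v \<in> {1..n}. snd (rev_seq n T v) = Suc n} \<longleftrightarrow>
        i \<in> {v \<in> {1..n}. fst (T v) = 1}"
      using i by (auto simp: rev_seq_def reflect_def)
  qed auto
  have "injective_vertices n (hasse n T) ks \<longleftrightarrow>
      sorted_wrt (<) ks \<and> set ks = {v \<in> {1..n}. fst (T v) = 1}" if ks: "set ks \<subseteq> {1..n}"
  proof -
    have "injective_vertices n (hasse n T) ks \<longleftrightarrow>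
        sorted_wrt (<) (rev (map (\<lambda>x. Suc n - x) ks)) \<and>
        set (rev (map (\<lambda>x. Suc n - x) ks)) = (\<lambda>x. Suc n - x) ` {v \<in> {1..n}. fst (T v) = 1}"
      unfolding injective_iff_projective_dual[OF hasse_subset roots_nonempty[OF n] ks]
        dual[symmetric] R.projective_vertices_hasse[OF n] ends ..
    also have "\<dots> \<longleftrightarrow> sorted_wrt (<) ks \<and> set ks = {v \<in> {1..n}. fst (T v) = 1}"
      unfolding sorted_flip[OF ks] set_rev set_map by (subst image_flip_eq_iff[OF ks]) auto
    finally show ?thesis .
  qed
  then show ?thesis using injective_vertices_mem[OF hasse_subset roots_nonempty[OF n]] by blast
qed

text \<open>The chain stops at a vertex ending at \<open>Suc n\<close> without lesser children, so
  the last point must be its gap. All its children then lie to the left of the gap and have larger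
  labels.\<close>

lemma ex_first_projective:
  assumes n: "n \<ge> 1"
  obtains k where "k \<in> {1..n}" "gap k = n" "\<And>v. first_projective n (hasse n T) v \<longleftrightarrow> v = k"
    "\<And>c. c \<in> children (hasse n T) k \<Longrightarrow> k < c"
proof -
  obtain k where k: "k \<in> L" "gap k = n" using gap_surj[of n] by auto
  then have "k \<noteq> Suc n" using n by auto
  then have kn: "k \<in> {1..n}" using k by auto
  have hd: "hd js = k" if p: "projective_vertices n (hasse n T) js" for js
  proof -
    have pc: "proj_chain (js @ [Suc n])" using p projective_iff_proj_chain[OF n] by blast
    have ne: "js \<noteq> []" using p by (simp add: projective_vertices_def)
    then have "lesser (hd js) = {}" using pc by (simp add: proj_chain_def)
    moreover have h: "hd js \<in> L" "hi (hd js) = Suc n"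
        using proj_chain_set(2)[OF pc] hd_in_set[OF ne] by auto
    ultimately have "gap (hd js) = n" using last_child by blast
    then show ?thesis using inj_onD[OF inj_gap] h k by metis
  qed
  obtain js where "proj_chain (js @ [Suc n])" using ex_proj_chain[of "Suc n"] by auto
  then have "projective_vertices n (hasse n T) js" using projective_iff_proj_chain[OF n] by blast
  then have fp: "first_projective n (hasse n T) v \<longleftrightarrow> v = k" for v
    using hd unfolding first_projective_def by blast
  have "k < c" if "c \<in> children (hasse n T) k" for c
  proof (rule ccontr)
    assume "\<not> k < c"
    have c: "child c k" using that \<open>k \<noteq> Suc n\<close> by (simp add: children_hasse)
    then have "c < k" using \<open>\<not> k < c\<close> by (auto simp: child_def below_def)
    then have "n < lo c" using child_side(2)[OF c] k by simp
    then show False using c lo_hi[of c] by (auto simp: child_def below_def)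
  qed
  then show ?thesis using that kn k fp by blast
qed

text \<open>Conjugating twice gives \<open>T\<close> back, so \<open>snd_conj_seq\<close> for the
  conjugate sequence describes the right ends of \<open>T\<close>.\<close>

theorem projective_vertices_conj:
  assumes n: "n \<ge> 1"
  shows "projective_vertices n (hasse n T) js \<longleftrightarrow>
    sorted_wrt (<) js \<and> set js = roots n (hasse n (conj_seq n T))"
proof -
  interpret D: exc_seq n "conj_seq n T" by unfold_locales (rule ces_conj_seq)
  have "{v \<in> {1..n}. snd (T v) = Suc n} = roots n (hasse n (conj_seq n T))"
    using D.snd_conj_seq conj_conj_seq by (auto simp: roots_def)
  then show ?thesis using projective_vertices_hasse[OF n] by simp
qed

text \<open>By \<open>fst_conj_seq\<close> for the conjugate sequence, the supports of
  \<open>T\<close> starting at 1 belong to the vertex \<open>k0\<close> whose gap is the last point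
  there, and to its children. These have larger labels, so \<open>k0\<close> heads the increasing
  list.\<close>

theorem injective_vertices_conj:
  assumes n: "n \<ge> 1"
  shows "injective_vertices n (hasse n T) (k # ks) \<longleftrightarrow>
    first_projective n (hasse n (conj_seq n T)) k \<and> sorted_wrt (<) ks \<and>
    set ks = children (hasse n (conj_seq n T)) k"
proof -
  interpret D: exc_seq n "conj_seq n T" by unfold_locales (rule ces_conj_seq)
  let ?G = "hasse n (conj_seq n T)"
  obtain k0 where k0: "k0 \<in> {1..n}" "D.gap k0 = n" "\<And>v. first_projective n ?G v \<longleftrightarrow> v = k0"
    and less: "\<And>c. c \<in> children ?G k0 \<Longrightarrow> k0 < c"
    using D.ex_first_projective[OF n] by blast
  have k0L: "k0 \<in> L" "k0 \<noteq> Suc n" using k0 by auto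
  have g: "D.gap v = n \<longleftrightarrow> v = k0" if "v \<in> L" for v
    using inj_onD[OF D.inj_gap, of v k0] that k0L k0(2) by auto
  have "fst (T v) = 1 \<longleftrightarrow> v = k0 \<or> v \<in> children ?G k0" if v: "v \<in> {1..n}" for v
  proof -
    have vL: "v \<in> L" using v by auto
    have "fst (T v) = 1 \<longleftrightarrow> D.gap v = n \<or> D.gap (D.par v) = n"
      using D.fst_conj_seq[OF v] conj_conj_seq[OF v] by simp
    also have "\<dots> \<longleftrightarrow> v = k0 \<or> D.par v = k0" using g[OF vL] g[OF D.par_mem[OF v]] by simp
    also have "\<dots> \<longleftrightarrow> v = k0 \<or> D.child v k0" using D.par[OF v] D.par_eq by metis
    finally show ?thesis using D.children_hasse[OF k0L(2)] by simp
  qed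
  moreover have "children ?G k0 \<subseteq> {1..n}" by (rule children_subset[OF hasse_subset])
  ultimately have S: "{v \<in> {1..n}. fst (T v) = 1} = insert k0 (children ?G k0)" using k0(1) by auto
  have "sorted_wrt (<) (k # ks) \<and> set (k # ks) = insert k0 (children ?G k0) \<longleftrightarrow>
      k = k0 \<and> sorted_wrt (<) ks \<and> set ks = children ?G k0" (is "?A \<longleftrightarrow> ?B")
  proof
    assume A: ?A
    then have gt: "\<forall>x\<in>set ks. k < x" by simp
    have "k = k0"
    proof (rule ccontr)
      assume "k \<noteq> k0"
      then have "k \<in> children ?G k0" "k0 \<in> set ks" using A by auto
      then have "k0 < k" "k < k0" using gt less by blast+
      then show False by simp
    qed
    moreover have "k \<notin> set ks" using gt by auto
    moreover have "k0 \<notin> children ?G k0" using less by blast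
    ultimately show ?B using A by auto
  next
    assume ?B
    then show ?A using less by auto
  qed
  then show ?thesis unfolding injective_vertices_hasse[OF n] S using k0(3) by auto
qed

end

section \<open>Interval modules\<close>

text \<open>Arrow entries only have to be nonzero, since the modules picked by
  \<open>seq_of_forest\<close> and \<open>braid_seq\<close> are determined only up to
  isomorphism.\<close>

definition interval_rep :: "nat \<Rightarrow> nat \<times> nat \<Rightarrow> 'k::field quiver_rep \<Rightarrow> bool" where
  "interval_rep n A V \<longleftrightarrow> is_rep n V \<and> (\<forall>i\<in>{1..n}. vdim V i = (if i \<in> pts A then 1 else 0)) \<and>
     (\<forall>i\<in>{1..<n}. i \<in> pts A \<and> Suc i \<in> pts A \<longrightarrow> arrow V i $$ (0, 0) \<noteq> 0)"

lemma interval_repD: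
  assumes "interval_rep n A V"
  shows interval_rep_is_rep: "is_rep n V"
    and interval_rep_dim: "i \<in> {1..n} \<Longrightarrow> vdim V i = (if i \<in> pts A then 1 else 0)"
    and interval_rep_arrow: "i \<in> {1..<n} \<Longrightarrow> i \<in> pts A \<Longrightarrow> Suc i \<in> pts A \<Longrightarrow> arrow V i $$ (0, 0) \<noteq> 0"
  using assms by (auto simp: interval_rep_def)

lemma arrow_carrier: "is_rep n V \<Longrightarrow> i \<in> {1..<n} \<Longrightarrow>
    arrow V i \<in> carrier_mat (vdim V (Suc i)) (vdim V i)"
  by (simp add: is_rep_def)

lemma supp_interval_rep: "edge n A \<Longrightarrow> interval_rep n A V \<Longrightarrow> supp n V = pts A"
  by (auto simp: supp_def interval_rep_def edge_def pts_def split: if_splits)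

lemma ex_interval_rep: "\<exists>V :: 'k::field quiver_rep. interval_rep n A V"
proof -
  let ?d = "\<lambda>i. if i \<in> pts A then 1 else 0 :: nat"
  let ?V = "\<lparr>vdim = ?d, arrow = (\<lambda>i. mat (?d (Suc i)) (?d i) (\<lambda>_. 1 :: 'k))\<rparr>"
  have "interval_rep n A ?V" by (simp add: interval_rep_def is_rep_def)
  then show ?thesis by blast
qed

lemma mult_mat_inner0:
  "A \<in> carrier_mat r 0 \<Longrightarrow> B \<in> carrier_mat 0 c \<Longrightarrow> A * B = 0\<^sub>m r c"
  by (intro eq_matI) (auto simp: scalar_prod_def)

lemma mult_mat_inner1:
  assumes "A \<in> carrier_mat r 1" "B \<in> carrier_mat 1 c" "i < r" "j < c"
  shows "(A * B) $$ (i, j) = A $$ (i, 0) * B $$ (0, j)"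
  using assms by (simp add: scalar_prod_def)

lemma eq_mat_no_rows: "A \<in> carrier_mat 0 c \<Longrightarrow> B \<in> carrier_mat 0 c \<Longrightarrow> A = B"
  by (intro eq_matI) auto

lemma eq_mat_no_cols: "A \<in> carrier_mat r 0 \<Longrightarrow> B \<in> carrier_mat r 0 \<Longrightarrow> A = B"
  by (intro eq_matI) auto

lemma eq_mat_1_1: "A \<in> carrier_mat 1 1 \<Longrightarrow> B \<in> carrier_mat 1 1 \<Longrightarrow> A $$ (0, 0) = B $$ (0, 0) \<Longrightarrow> A = B"
  by (intro eq_matI) auto

text \<open>Quotients of an interval module are its initial parts, submodules its final parts. The
  image of a nonzero map is both, so it is supported on \<open>{fst A..<snd B}\<close>.\<close>

lemma hom_vanishes_interval:
  fixes V W :: "'k::field quiver_rep"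
  assumes A: "edge n A" and B: "edge n B" and V: "interval_rep n A V" and W: "interval_rep n B W"
  shows "hom_vanishes n V W \<longleftrightarrow> \<not> (fst B \<le> fst A \<and> fst A < snd B \<and> snd B \<le> snd A)"
proof
  note VA = arrow_carrier[OF interval_rep_is_rep[OF V]] and WA = arrow_carrier[OF
      interval_rep_is_rep[OF W]]
  note Vd = interval_rep_dim[OF V] and Wd = interval_rep_dim[OF W]
  have eA: "1 \<le> fst A" "fst A < snd A" "snd A \<le> Suc n" using A by (auto simp: edge_def)
  have eB: "1 \<le> fst B" "fst B < snd B" "snd B \<le> Suc n" using B by (auto simp: edge_def)
  show "hom_vanishes n V W" if no: "\<not> (fst B \<le> fst A \<and> fst A < snd B \<and> snd B \<le> snd A)"
    unfolding hom_vanishes_def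
  proof (intro ballI)
    fix f i assume f: "f \<in> rep_hom n V W" and i: "i \<in> {1..n}"
    have fc: "f i \<in> carrier_mat (vdim W i) (vdim V i)" if "i \<in> {1..n}" for i
      using f that by (simp add: rep_hom_def)
    have sq: "f (Suc i) * arrow V i = arrow W i * f i" if "i \<in> {1..<n}" for i
      using f that by (simp add: rep_hom_def)
    have step: "f i $$ (0, 0) = 0 \<longleftrightarrow> f (Suc i) $$ (0, 0) = 0"
      if m: "i \<in> pts A \<inter> pts B" "Suc i \<in> pts A \<inter> pts B" for i
    proof -
      have iD: "i \<in> {1..n}" "Suc i \<in> {1..n}" "i \<in> {1..<n}"
        using m eA by (auto simp: pts_def)
      have d: "vdim V i = 1" "vdim V (Suc i) = 1" "vdim W i = 1" "vdim W (Suc i) = 1"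
        using Vd Wd iD m by auto
      have "f (Suc i) $$ (0, 0) * arrow V i $$ (0, 0) = (f (Suc i) * arrow V i) $$ (0, 0)"
        by (rule mult_mat_inner1[symmetric, of _ 1 _ 1]) (use fc[OF iD(2)] VA[OF iD(3)] d in auto)
      also have "\<dots> = arrow W i $$ (0, 0) * f i $$ (0, 0)"
        unfolding sq[OF iD(3)]
        by (rule mult_mat_inner1[of _ 1 _ 1]) (use fc[OF iD(1)] WA[OF iD(3)] d in auto)
      finally show ?thesis
        using interval_rep_arrow[OF V iD(3)] interval_rep_arrow[OF W iD(3)] m by auto
    qed
    have const: "f j $$ (0, 0) = 0 \<longleftrightarrow> f k $$ (0, 0) = 0"
      if "j \<le> k" "j \<in> pts A \<inter> pts B" "k \<in> pts A \<inter> pts B" for j k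
      by (rule telescope_eq[where e = "\<lambda>i. f i $$ (0, 0) = 0"]) (use that step in \<open>auto simp:
          pts_def\<close>)
    have zero: "f i $$ (0, 0) = 0" if m: "i \<in> pts A \<inter> pts B"
    proof -
      \<comment> \<open>The square of the arrow entering \<open>B\<close>, or of the one leaving
        \<open>A\<close>, has a zero corner and a nonzero arrow entry, which makes the map vanish at
        that end of the overlap; \<open>const\<close> spreads this.\<close>
      consider "fst A < fst B" | "snd A < snd B" using no m by (force simp: pts_def)
      then show ?thesis
      proof cases
        case 1
        let ?c = "fst B - 1"
        have c: "?c \<in> {1..<n}" "?c \<in> {1..n}" "Suc ?c = fst B" "fst B \<in> {1..n}"
            "fst B \<in> pts A \<inter> pts B"
          "?c \<in> pts A" "?c \<notin> pts B" "fst B \<le> i"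
          using 1 m eA eB by (auto simp: pts_def)
        have d: "vdim V ?c = 1" "vdim W ?c = 0" "vdim V (fst B) = 1" "vdim W (fst B) = 1"
          using Vd Wd c by auto
        have "f (fst B) $$ (0, 0) * arrow V ?c $$ (0, 0) = (f (fst B) * arrow V ?c) $$ (0, 0)"
          by (rule mult_mat_inner1[symmetric, of _ 1 _ 1]) (use fc[OF c(4)] VA[OF c(1)] d c(3) in
              auto)
        also have "f (fst B) * arrow V ?c = arrow W ?c * f ?c" using sq[OF c(1)] c(3) by simp
        also have "\<dots> = 0\<^sub>m 1 1"
          by (rule mult_mat_inner0) (use fc[OF c(2)] WA[OF c(1)] d c(3) in auto)
        finally have "f (fst B) $$ (0, 0) = 0"
          using interval_rep_arrow[OF V c(1)] c by auto
        then show ?thesis using const[of "fst B" i] c m by blast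
      next
        case 2
        let ?b = "snd A - 1"
        have b: "?b \<in> {1..<n}" "?b \<in> {1..n}" "Suc ?b = snd A" "snd A \<in> {1..n}" "?b \<in> pts A \<inter> pts B"
          "snd A \<notin> pts A" "snd A \<in> pts B" "i \<le> ?b"
          using 2 m eA eB by (auto simp: pts_def)
        have d: "vdim V ?b = 1" "vdim W ?b = 1" "vdim V (snd A) = 0" "vdim W (snd A) = 1"
          using Vd Wd b by auto
        have "arrow W ?b $$ (0, 0) * f ?b $$ (0, 0) = (arrow W ?b * f ?b) $$ (0, 0)"
          by (rule mult_mat_inner1[symmetric, of _ 1 _ 1]) (use fc[OF b(2)] WA[OF b(1)] d b(3) in
              auto)
        also have "arrow W ?b * f ?b = f (snd A) * arrow V ?b" using sq[OF b(1)] b(3) by simp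
        also have "\<dots> = 0\<^sub>m 1 1"
          by (rule mult_mat_inner0) (use fc[OF b(4)] VA[OF b(1)] d b(3) in auto)
        finally have "f ?b $$ (0, 0) = 0"
          using interval_rep_arrow[OF W b(1)] b by auto
        then show ?thesis using const[of i ?b] b m by blast
      qed
    qed
    show "f i = 0\<^sub>m (vdim W i) (vdim V i)"
    proof (cases "i \<in> pts A \<inter> pts B")
      case True
      then show ?thesis using fc[OF i] Vd[OF i] Wd[OF i] zero by (intro eq_matI) auto
    next
      case False
      then have "vdim W i = 0 \<or> vdim V i = 0" using Vd[OF i] Wd[OF i] by auto
      then show ?thesis using fc[OF i] by (intro eq_matI) auto
    qed
  qed
  show "\<not> (fst B \<le> fst A \<and> fst A < snd B \<and> snd B \<le> snd A)" if hv: "hom_vanishes n V W"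
  proof
    assume c: "fst B \<le> fst A \<and> fst A < snd B \<and> snd B \<le> snd A"
    let ?X = "{fst A..<snd B}"
    have X: "pts A \<inter> pts B = ?X" using c by (auto simp: pts_def)
    \<comment> \<open>These quotients, starting with 1 at \<open>fst A\<close>, make the squares
      inside the overlap commute.\<close>
    define g where "g = (\<lambda>i. \<Prod>j\<in>{fst A..<i}. arrow W j $$ (0, 0) / arrow V j $$ (0, 0))"
    define f where "f = (\<lambda>i. if i \<in> ?X then mat 1 1 (\<lambda>_. g i) else 0\<^sub>m (vdim W i) (vdim V i))"
    have d: "vdim V i = 1" "vdim W i = 1" "i \<in> {1..n}" "i \<in> pts A" "i \<in> pts B" if "i \<in> ?X" for i
    proof -
      show i: "i \<in> {1..n}" using that eA eB by auto
      have m: "i \<in> pts A \<inter> pts B" using that X by blast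
      then show "i \<in> pts A" "i \<in> pts B" by blast+
      with i show "vdim V i = 1" "vdim W i = 1" using Vd[of i] Wd[of i] by simp_all
    qed
    have fc: "f i \<in> carrier_mat (vdim W i) (vdim V i)" if "i \<in> {1..n}" for i
      using d by (auto simp: f_def)
    have "f \<in> rep_hom n V W"
      unfolding rep_hom_def
    proof (intro CollectI conjI ballI fc)
      fix i assume i: "i \<in> {1..<n}"
      have iD: "i \<in> {1..n}" "Suc i \<in> {1..n}" using i by auto
      have lc: "f (Suc i) * arrow V i \<in> carrier_mat (vdim W (Suc i)) (vdim V i)"
        using fc[OF iD(2)] VA[OF i] by auto
      have rc: "arrow W i * f i \<in> carrier_mat (vdim W (Suc i)) (vdim V i)"
        using fc[OF iD(1)] WA[OF i] by auto
      consider "i \<in> ?X" "Suc i \<in> ?X" | "i \<in> ?X" "Suc i \<notin> ?X" | "i \<notin> ?X" "Suc i \<in> ?X"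
        | "i \<notin> ?X" "Suc i \<notin> ?X" by blast
      then show "f (Suc i) * arrow V i = arrow W i * f i"
      proof cases
        case 1
        note d1 = d[OF 1(1)] and d2 = d[OF 1(2)]
        have "arrow V i $$ (0, 0) \<noteq> 0" using interval_rep_arrow[OF V i] d1 d2 by blast
        then have gs: "g (Suc i) * arrow V i $$ (0, 0) = arrow W i $$ (0, 0) * g i"
          using 1 by (simp add: g_def)
        show ?thesis
        proof (rule eq_mat_1_1)
          have "(f (Suc i) * arrow V i) $$ (0, 0) = f (Suc i) $$ (0, 0) * arrow V i $$ (0, 0)"
            by (rule mult_mat_inner1[of _ 1 _ 1]) (use fc[OF iD(2)] VA[OF i] d1 d2 in auto)
          moreover have "(arrow W i * f i) $$ (0, 0) = arrow W i $$ (0, 0) * f i $$ (0, 0)"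
            by (rule mult_mat_inner1[of _ 1 _ 1]) (use fc[OF iD(1)] WA[OF i] d1 d2 in auto)
          moreover have "f i $$ (0, 0) = g i" "f (Suc i) $$ (0, 0) = g (Suc i)"
            unfolding f_def if_P[OF 1(1)] if_P[OF 1(2)] by simp_all
          ultimately show "(f (Suc i) * arrow V i) $$ (0, 0) = (arrow W i * f i) $$ (0, 0)"
            using gs by simp
        qed (use lc rc d1 d2 in auto)
      next
        case 2
        then have "Suc i \<notin> pts B" using c by (auto simp: pts_def)
        then have "vdim W (Suc i) = 0" using Wd[OF iD(2)] by simp
        then show ?thesis using lc rc by (intro eq_mat_no_rows) auto
      next
        case 3
        then have "i \<notin> pts A" by (auto simp: pts_def)
        then have "vdim V i = 0" using Vd[OF iD(1)] by simp
        then show ?thesis using lc rc by (intro eq_mat_no_cols) auto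
      next
        case 4
        have "f (Suc i) = 0\<^sub>m (vdim W (Suc i)) (vdim V (Suc i))" "f i = 0\<^sub>m (vdim W i) (vdim V i)"
          unfolding f_def if_not_P[OF 4(1)] if_not_P[OF 4(2)] by simp_all
        then show ?thesis using VA[OF i] WA[OF i] by simp
      qed
    qed
    then have "f (fst A) = 0\<^sub>m (vdim W (fst A)) (vdim V (fst A))"
      using hv eA unfolding hom_vanishes_def by auto
    moreover have X0: "fst A \<in> ?X" using c by simp
    ultimately have "f (fst A) $$ (0, 0) = 0" using d[OF X0] by simp
    moreover have "f (fst A) $$ (0, 0) = 1" unfolding f_def if_P[OF X0] by (simp add: g_def)
    ultimately show False by simp
  qed
qed

section \<open>Indecomposable representations are interval modules\<close>

lemma subspace_iff:
  "VectorSpace.subspace class_ring U (module_vec TYPE('k::field) d) \<longleftrightarrow>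
     U \<subseteq> carrier_vec d \<and> 0\<^sub>v d \<in> U \<and> (\<forall>x\<in>U. \<forall>y\<in>U. x + y \<in> U) \<and> (\<forall>c. \<forall>x\<in>U. c \<cdot>\<^sub>v x \<in> U)"
proof -
  interpret V: vec_space "TYPE('k)" d .
  have vs: "vectorspace (class_ring :: 'k ring) (module_vec TYPE('k) d)" by unfold_locales
  have "VectorSpace.subspace class_ring U (module_vec TYPE('k) d) \<longleftrightarrow>
      submodule class_ring U (module_vec TYPE('k) d)"
    using vs by (auto simp: VectorSpace.subspace_def)
  also have "\<dots> \<longleftrightarrow> U \<subseteq> carrier_vec d \<and> 0\<^sub>v d \<in> U \<and> (\<forall>x\<in>U. \<forall>y\<in>U. x + y \<in> U) \<and> (\<forall>c. \<forall>x\<in>U. c \<cdot>\<^sub>v x \<in> U)"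
    using V.module_axioms by (auto simp: submodule_def module_vec_simps class_ring_simps)
  finally show ?thesis .
qed

lemma mult_mat_zero_vec: "A \<in> carrier_mat r c \<Longrightarrow> A *\<^sub>v 0\<^sub>v c = 0\<^sub>v r"
  by (intro eq_vecI) auto

fun transport :: "'k::field quiver_rep \<Rightarrow> nat \<Rightarrow> 'k vec \<Rightarrow> nat \<Rightarrow> 'k vec" where
  "transport V a v 0 = v"
| "transport V a v (Suc k) = arrow V (a + k) *\<^sub>v transport V a v k"

context
  fixes n :: nat and V :: "'k::field quiver_rep"
  assumes V: "is_rep n V"
begin

lemma transport_carrier:
  "1 \<le> a \<Longrightarrow> a + k \<le> n \<Longrightarrow> v \<in> carrier_vec (vdim V a) \<Longrightarrow>
      transport V a v k \<in> carrier_vec (vdim V (a + k))"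
proof (induction k)
  case (Suc k)
  have "arrow V (a + k) \<in> carrier_mat (vdim V (Suc (a + k))) (vdim V (a + k))"
    using arrow_carrier[OF V, of "a + k"] Suc.prems by simp
  then show ?case using Suc by auto
qed simp

lemma transport_Suc: "transport V a v (Suc k) = transport V (Suc a) (arrow V a *\<^sub>v v) k"
  by (induction k) simp_all

lemma transport_transport: "transport V (a + j) (transport V a v j) l = transport V a v (j + l)"
  by (induction l) (simp_all add: add.assoc)

lemma transport_add:
  assumes "1 \<le> a" "a + k \<le> n" "v \<in> carrier_vec (vdim V a)" "w \<in> carrier_vec (vdim V a)"
  shows "transport V a (v + w) k = transport V a v k + transport V a w k"
  using assms(2)
proof (induction k)
  case (Suc k)
  have "arrow V (a + k) \<in> carrier_mat (vdim V (Suc (a + k))) (vdim V (a + k))"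
    using arrow_carrier[OF V, of "a + k"] Suc.prems assms by simp
  then show ?case
    using Suc transport_carrier[of a k] assms by (simp add: mult_add_distrib_mat_vec)
qed simp

lemma transport_smult:
  assumes "1 \<le> a" "a + k \<le> n" "v \<in> carrier_vec (vdim V a)"
  shows "transport V a (c \<cdot>\<^sub>v v) k = c \<cdot>\<^sub>v transport V a v k"
  using assms(2)
proof (induction k)
  case (Suc k)
  have "arrow V (a + k) \<in> carrier_mat (vdim V (Suc (a + k))) (vdim V (a + k))"
    using arrow_carrier[OF V, of "a + k"] Suc.prems assms by simp
  then show ?case
    using Suc transport_carrier[of a k] assms by (simp add: mult_mat_vec)
qed simp

lemma transport_zero:
  assumes "1 \<le> a" "a + k \<le> n"
  shows "transport V a (0\<^sub>v (vdim V a)) k = 0\<^sub>v (vdim V (a + k))"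
  using assms(2)
proof (induction k)
  case (Suc k)
  have "arrow V (a + k) \<in> carrier_mat (vdim V (Suc (a + k))) (vdim V (a + k))"
    using arrow_carrier[OF V, of "a + k"] Suc.prems assms by simp
  then show ?case using Suc by (simp add: mult_mat_zero_vec)
qed simp

text \<open>A vector at the first vertex of the support whose image survives longest generates a
  subrepresentation with a complement, the kernel of a coordinate at the last vertex reached.\<close>
lemma indecomposable_imp_interval:
  assumes ind: "indecomposable n V"
  shows "\<exists>A. edge n A \<and> interval_rep n A V"
proof -
  note VA = arrow_carrier[OF V]
  define a where "a = (LEAST i. i \<in> {1..n} \<and> vdim V i \<noteq> 0)"
  have ex: "\<exists>i. i \<in> {1..n} \<and> vdim V i \<noteq> 0" using ind by (auto simp: indecomposable_def)
  have a: "a \<in> {1..n}" "vdim V a \<noteq> 0" using LeastI_ex[OF ex] by (auto simp: a_def)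
  have before_a: "vdim V i = 0" if "i \<in> {1..n}" "i < a" for i
    using not_less_Least[of i "\<lambda>i. i \<in> {1..n} \<and> vdim V i \<noteq> 0"] that by (auto simp: a_def)
  define P where "P k \<longleftrightarrow> a + k \<le> n \<and>
    (\<exists>v\<in>carrier_vec (vdim V a). transport V a v k \<noteq> 0\<^sub>v (vdim V (a + k)))" for k
  have unit: "unit_vec d j \<noteq> (0\<^sub>v d :: 'k vec)" if "j < d" for d j
    using that by (metis index_unit_vec(1) index_zero_vec(1) zero_neq_one)
  have P0: "P 0" unfolding P_def
    using a unit[of 0 "vdim V a"] by (auto intro!: bexI[of _ "unit_vec (vdim V a) 0"])
  define k where "k = (GREATEST k. P k)"
  have bound: "\<And>j. P j \<Longrightarrow> j \<le> n" by (simp add: P_def)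
  have Pk: "P k" unfolding k_def by (rule GreatestI_nat[where P = P, OF P0 bound])
  have k_max: "j \<le> k" if "P j" for j unfolding k_def
      by (rule Greatest_le_nat[where P = P, OF that bound])
  obtain v where v: "v \<in> carrier_vec (vdim V a)" "transport V a v k \<noteq> 0\<^sub>v (vdim V (a + k))"
    using Pk unfolding P_def by blast
  have bn: "a + k \<le> n" using Pk by (simp add: P_def)
  have a1: "1 \<le> a" using a by simp
  \<comment> \<open>Maximality of \<open>k\<close> gives this; it closes \<open>U\<close> under the
    arrow leaving \<open>a + k\<close>.\<close>
  have vanish: "transport V a x (Suc k) = 0\<^sub>v (vdim V (Suc (a + k)))"
    if "a + k < n" "x \<in> carrier_vec (vdim V a)" for x
    using k_max[of "Suc k"] that by (force simp: P_def)
  let ?v = "\<lambda>i. transport V a v (i - a)"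
  have vc: "?v i \<in> carrier_vec (vdim V i)" if "a \<le> i" "i \<le> a + k" for i
    using transport_carrier[OF a1, of "i - a" v] that bn v by simp
  have vS: "arrow V i *\<^sub>v ?v i = ?v (Suc i)" if "a \<le> i" for i
    using that by (simp add: Suc_diff_le)
  obtain r where r: "r < vdim V (a + k)" "transport V a v k $ r \<noteq> 0"
  proof -
    have c: "transport V a v k \<in> carrier_vec (vdim V (a + k))"
        using transport_carrier[OF a1 bn v(1)] .
    have "\<exists>r<vdim V (a + k). transport V a v k $ r \<noteq> 0"
    proof (rule ccontr)
      assume "\<not> ?thesis"
      then have "transport V a v k = 0\<^sub>v (vdim V (a + k))" using c by (intro eq_vecI) auto
      then show False using v(2) by blast
    qed
    then show ?thesis using that by blast
  qed
  \<comment> \<open>Transport to the vertex \<open>a + k\<close> and read the coordinate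
    \<open>r\<close> there. The arrows preserve this functional, and it is nonzero on
    \<open>?v i\<close>, so its kernel complements the line through \<open>?v i\<close>.\<close>
  let ?\<phi> = "\<lambda>i x. transport V i x (a + k - i) $ r"
  have fin: "transport V i x (a + k - i) \<in> carrier_vec (vdim V (a + k))"
    if "a \<le> i" "i \<le> a + k" "x \<in> carrier_vec (vdim V i)" for i x
    using transport_carrier[of i "a + k - i" x] that bn a1 by simp
  have \<phi>_add: "?\<phi> i (x + y) = ?\<phi> i x + ?\<phi> i y"
    if "a \<le> i" "i \<le> a + k" "x \<in> carrier_vec (vdim V i)" "y \<in> carrier_vec (vdim V i)" for i x y
    using transport_add[of i "a + k - i" x y] fin[of i x] fin[of i y] that bn a1 r by simp
  have \<phi>_smult: "?\<phi> i (c \<cdot>\<^sub>v x) = c * ?\<phi> i x"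
    if "a \<le> i" "i \<le> a + k" "x \<in> carrier_vec (vdim V i)" for i x c
    using transport_smult[of i "a + k - i" x] fin[of i x] that bn a1 r by simp
  have \<phi>_v: "?\<phi> i (?v i) = transport V a v k $ r" if "a \<le> i" "i \<le> a + k" for i
    using transport_transport[of a "i - a" v "a + k - i"] that by simp
  have \<phi>_zero: "?\<phi> i (0\<^sub>v (vdim V i)) = 0" if "a \<le> i" "i \<le> a + k" for i
    using transport_zero[of i "a + k - i"] that bn a1 r by simp
  have v_nz: "?v i \<noteq> 0\<^sub>v (vdim V i)" if "a \<le> i" "i \<le> a + k" for i
    using \<phi>_v[OF that] \<phi>_zero[OF that] r by metis
  define U where "U = (\<lambda>i. if a \<le> i \<and> i \<le> a + k then {c \<cdot>\<^sub>v ?v i | c. True} else {0\<^sub>v (vdim V i)})"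
  define W where "W = (\<lambda>i. if a \<le> i \<and> i \<le> a + k then {x \<in> carrier_vec (vdim V i). ?\<phi> i x = 0}
                          else carrier_vec (vdim V i))"
  have Uin: "U i = {c \<cdot>\<^sub>v ?v i | c. True}" "W i = {x \<in> carrier_vec (vdim V i). ?\<phi> i x = 0}"
    if "a \<le> i" "i \<le> a + k" for i
    using that by (simp_all add: U_def W_def)
  have Uout: "U i = {0\<^sub>v (vdim V i)}" "W i = carrier_vec (vdim V i)" if "\<not> (a \<le> i \<and> i \<le> a + k)"
      for i
    unfolding U_def W_def if_not_P[OF that] by blast+
  have subU: "VectorSpace.subspace class_ring (U i) (module_vec TYPE('k) (vdim V i))" for i
  proof (cases "a \<le> i \<and> i \<le> a + k")
    case True
    then have c: "?v i \<in> carrier_vec (vdim V i)" using vc by blast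
    have "0\<^sub>v (vdim V i) = 0 \<cdot>\<^sub>v ?v i" using c by (intro eq_vecI) auto
    moreover have "c \<cdot>\<^sub>v ?v i + d \<cdot>\<^sub>v ?v i = (c + d) \<cdot>\<^sub>v ?v i" for c d
      using c by (simp add: add_smult_distrib_vec)
    moreover have "c \<cdot>\<^sub>v (d \<cdot>\<^sub>v ?v i) = (c * d) \<cdot>\<^sub>v ?v i" for c d
      by (simp add: smult_smult_assoc)
    ultimately show ?thesis using c True unfolding subspace_iff by (auto simp: Uin)
  next
    case False
    have "c \<cdot>\<^sub>v 0\<^sub>v (vdim V i) = 0\<^sub>v (vdim V i)" for c :: 'k by (intro eq_vecI) auto
    then show ?thesis unfolding subspace_iff Uout(1)[OF False] by simp
  qed
  have subW: "VectorSpace.subspace class_ring (W i) (module_vec TYPE('k) (vdim V i))" for i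
  proof (cases "a \<le> i \<and> i \<le> a + k")
    case True
    then show ?thesis unfolding subspace_iff by (auto simp: Uin \<phi>_zero \<phi>_add \<phi>_smult)
  next
    case False
    then show ?thesis unfolding subspace_iff Uout(2)[OF False] by auto
  qed
  have zU: "0\<^sub>v (vdim V i) \<in> U i" "0\<^sub>v (vdim V i) \<in> W i" for i
    using subU subW unfolding subspace_iff by blast+
  have srU: "subrep n V U" unfolding subrep_def
  proof (intro conjI ballI subU)
    fix i assume i: "i \<in> {1..<n}"
    show "(*\<^sub>v) (arrow V i) ` U i \<subseteq> U (Suc i)"
    proof (cases "a \<le> i \<and> i \<le> a + k")
      case True
      then have t: "a \<le> i" "i \<le> a + k" by auto
      have "arrow V i *\<^sub>v (c \<cdot>\<^sub>v ?v i) \<in> U (Suc i)" for c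
      proof (cases "i = a + k")
        case True
        have "?v (Suc i) = 0\<^sub>v (vdim V (Suc i))" using vanish[OF _ v(1)] True i
            by (simp add: Suc_diff_le)
        then have "arrow V i *\<^sub>v (c \<cdot>\<^sub>v ?v i) = 0\<^sub>v (vdim V (Suc i))"
          using mult_mat_vec[OF VA[OF i] vc[OF t]] vS[OF t(1)] by auto
        then show ?thesis using zU by simp
      next
        case False
        then have "arrow V i *\<^sub>v (c \<cdot>\<^sub>v ?v i) = c \<cdot>\<^sub>v ?v (Suc i)"
          using mult_mat_vec[OF VA[OF i] vc[OF t]] vS[OF t(1)] by simp
        then show ?thesis using Uin(1)[of "Suc i"] t False by auto
      qed
      then show ?thesis using Uin(1)[OF t] by auto
    next
      case False
      have "arrow V i *\<^sub>v 0\<^sub>v (vdim V i) = 0\<^sub>v (vdim V (Suc i))" using VA[OF i] by auto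
      then show ?thesis using Uout(1)[OF False] zU by simp
    qed
  qed
  have srW: "subrep n V W" unfolding subrep_def
  proof (intro conjI ballI subW)
    fix i assume i: "i \<in> {1..<n}"
    have iD: "i \<in> {1..n}" using i by auto
    have ar: "arrow V i *\<^sub>v x \<in> carrier_vec (vdim V (Suc i))" if "x \<in> carrier_vec (vdim V i)" for x
      using VA[OF i] that by auto
    have Wc: "W i \<subseteq> carrier_vec (vdim V i)" using subW unfolding subspace_iff by blast
    show "(*\<^sub>v) (arrow V i) ` W i \<subseteq> W (Suc i)"
    proof (cases "a \<le> Suc i \<and> Suc i \<le> a + k")
      case True
      show ?thesis
      proof (cases "a \<le> i")
        case t: True
        have "arrow V i *\<^sub>v x \<in> W (Suc i)" if "x \<in> W i" for x
        proof -
          have x: "x \<in> carrier_vec (vdim V i)" "?\<phi> i x = 0" using that Uin(2)[of i] t True by auto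
          have "a + k - i = Suc (a + k - Suc i)" using True by arith
          then have "?\<phi> i x = ?\<phi> (Suc i) (arrow V i *\<^sub>v x)" by (simp only: transport_Suc)
          then show ?thesis using x ar True by (simp add: Uin(2))
        qed
        then show ?thesis by blast
      next
        case False
        \<comment> \<open>Only \<open>Suc i = a\<close> remains, and all spaces before
          \<open>a\<close> are zero.\<close>
        then have d: "vdim V i = 0" using before_a[OF iD] by simp
        have "arrow V i *\<^sub>v x \<in> W (Suc i)" if "x \<in> W i" for x
        proof -
          have "x \<in> carrier_vec (vdim V i)" using that Wc by blast
          then have "x = 0\<^sub>v (vdim V i)" using d by (intro eq_vecI) auto
          then have "arrow V i *\<^sub>v x = 0\<^sub>v (vdim V (Suc i))" using VA[OF i] by auto
          then show ?thesis using zU by simp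
        qed
        then show ?thesis by blast
      qed
    next
      case False
      then show ?thesis using ar Wc Uout(2)[OF False] by auto
    qed
  qed
  have "internal_direct_sum n V U W"
    unfolding internal_direct_sum_def
  proof (intro conjI ballI srU srW)
    fix i assume i: "i \<in> {1..n}"
    have Uc: "U i \<subseteq> carrier_vec (vdim V i)" "W i \<subseteq> carrier_vec (vdim V i)"
      using subU subW unfolding subspace_iff by blast+
    show "U i \<inter> W i = {0\<^sub>v (vdim V i)}"
    proof (cases "a \<le> i \<and> i \<le> a + k")
      case True
      have "x = 0\<^sub>v (vdim V i)" if "x \<in> U i" "x \<in> W i" for x
      proof -
        have "x \<in> {c \<cdot>\<^sub>v ?v i | c. True}" using that(1) Uin(1)[of i] True by simp
        then obtain c where c: "x = c \<cdot>\<^sub>v ?v i" by blast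
        have vi: "?v i \<in> carrier_vec (vdim V i)" using vc True by blast
        have "?\<phi> i x = 0" using that(2) Uin(2)[of i] True by auto
        then have "c * (transport V a v k $ r) = 0"
            using \<phi>_smult[of i "?v i" c] \<phi>_v[of i] vi True c by simp
        then have "c = 0" using r by simp
        then show ?thesis using c vi by (intro eq_vecI) auto
      qed
      then show ?thesis using zU by blast
    next
      case False
      then show ?thesis using Uout[OF False] by auto
    qed
    show "{u + w |u w. u \<in> U i \<and> w \<in> W i} = carrier_vec (vdim V i)"
    proof
      show "{u + w |u w. u \<in> U i \<and> w \<in> W i} \<subseteq> carrier_vec (vdim V i)" using Uc add_carrier_vec
          by blast
      have "\<exists>u w. x = u + w \<and> u \<in> U i \<and> w \<in> W i" if x: "x \<in> carrier_vec (vdim V i)" for x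
      proof (cases "a \<le> i \<and> i \<le> a + k")
        case True
        then have t: "a \<le> i" "i \<le> a + k" by auto
        have vi: "?v i \<in> carrier_vec (vdim V i)" using vc[OF t] .
        define c where "c = ?\<phi> i x / (transport V a v k $ r)"
        have xs: "x = c \<cdot>\<^sub>v ?v i + (x + (- c) \<cdot>\<^sub>v ?v i)" using x vi by (intro eq_vecI) auto
        have "?\<phi> i (x + (- c) \<cdot>\<^sub>v ?v i) = ?\<phi> i x + (- c) * (transport V a v k $ r)"
          using \<phi>_add[OF t x, of "(- c) \<cdot>\<^sub>v ?v i"] \<phi>_smult[OF t vi, of "- c"] \<phi>_v[OF t] vi by simp
        also have "\<dots> = 0" using r by (simp add: c_def)
        finally have "x + (- c) \<cdot>\<^sub>v ?v i \<in> W i" using Uin(2)[OF t] x vi by simp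
        moreover have "c \<cdot>\<^sub>v ?v i \<in> U i" using Uin(1)[OF t] by blast
        ultimately show ?thesis using xs by blast
      next
        case False
        then show ?thesis using Uout[OF False] x
            by (intro exI[of _ "0\<^sub>v (vdim V i)"] exI[of _ x]) auto
      qed
      then show "carrier_vec (vdim V i) \<subseteq> {u + w |u w. u \<in> U i \<and> w \<in> W i}" by blast
    qed
  qed
  note ds = this
  have "v \<in> U a" using Uin(1)[of a] v(1) by (auto intro!: exI[of _ "1 :: 'k"])
  moreover have "v \<noteq> 0\<^sub>v (vdim V a)" using v_nz[of a] by simp
  \<comment> \<open>As \<open>U\<close> is nonzero, indecomposability makes \<open>W\<close> zero
    and \<open>V\<close> equal to \<open>U\<close>, which is a line at each vertex from
    \<open>a\<close> to \<open>a + k\<close>.\<close>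
  ultimately have "\<not> (\<forall>i\<in>{1..n}. U i = {0\<^sub>v (vdim V i)})" using a by auto
  then have W0: "W i = {0\<^sub>v (vdim V i)}" if "i \<in> {1..n}" for i
    using ind ds that unfolding indecomposable_def by blast
  have all_U: "carrier_vec (vdim V i) \<subseteq> U i" if i: "i \<in> {1..n}" for i
  proof
    fix x :: "'k vec" assume x: "x \<in> carrier_vec (vdim V i)"
    then have "x \<in> {u + w |u w. u \<in> U i \<and> w \<in> W i}" using ds i
        by (simp add: internal_direct_sum_def)
    then obtain u where "u \<in> U i" "x = u + 0\<^sub>v (vdim V i)" using W0[OF i] by auto
    moreover have "U i \<subseteq> carrier_vec (vdim V i)" using subU unfolding subspace_iff by blast
    ultimately show "x \<in> U i" by auto
  qed
  have din: "vdim V i = 1" if i: "a \<le> i" "i \<le> a + k" for i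
  proof -
    have iD: "i \<in> {1..n}" using i a1 bn by auto
    have vi: "?v i \<in> carrier_vec (vdim V i)" using vc[OF i] .
    have "vdim V i \<noteq> 0"
    proof
      assume "vdim V i = 0"
      then have "?v i = 0\<^sub>v (vdim V i)" using vi by (intro eq_vecI) auto
      then show False using v_nz[OF i] by blast
    qed
    moreover have "\<not> 2 \<le> vdim V i"
    proof
      assume d: "2 \<le> vdim V i"
      have "\<exists>c. unit_vec (vdim V i) j = c \<cdot>\<^sub>v ?v i" for j
      proof -
        have "unit_vec (vdim V i) j \<in> {c \<cdot>\<^sub>v ?v i | c. True}"
          using subsetD[OF all_U[OF iD] unit_vec_carrier] Uin(1)[OF i] by simp
        then show ?thesis by blast
      qed
      then obtain c c' where c: "unit_vec (vdim V i) 0 = c \<cdot>\<^sub>v ?v i"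
          "unit_vec (vdim V i) 1 = c' \<cdot>\<^sub>v ?v i" by metis
      have e: "unit_vec (vdim V i) 0 $ 0 = (1::'k)" "unit_vec (vdim V i) 0 $ 1 = (0::'k)"
        "unit_vec (vdim V i) 1 $ 1 = (1::'k)" using d by simp_all
      have "c * ?v i $ 0 = 1" "c * ?v i $ 1 = 0" "c' * ?v i $ 1 = 1"
        using e d vi unfolding c by auto
      then show False by auto
    qed
    ultimately show ?thesis by linarith
  qed
  have dout: "vdim V i = 0" if "i \<in> {1..n}" "\<not> (a \<le> i \<and> i \<le> a + k)" for i
  proof (rule ccontr)
    assume "vdim V i \<noteq> 0"
    then have "unit_vec (vdim V i) 0 \<noteq> (0\<^sub>v (vdim V i) :: 'k vec)" using unit by blast
    moreover have "unit_vec (vdim V i) 0 \<in> U i" using all_U[OF that(1)] by auto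
    ultimately show False using Uout(1)[OF that(2)] by simp
  qed
  let ?A = "(a, Suc (a + k))"
  have pA: "i \<in> pts ?A \<longleftrightarrow> a \<le> i \<and> i \<le> a + k" for i by (auto simp: pts_def)
  have "arrow V i $$ (0, 0) \<noteq> 0" if i: "i \<in> {1..<n}" "i \<in> pts ?A" "Suc i \<in> pts ?A" for i
  proof
    assume z: "arrow V i $$ (0, 0) = 0"
    have t: "a \<le> i" "i \<le> a + k" "a \<le> Suc i" "Suc i \<le> a + k" using i pA by auto
    have "arrow V i \<in> carrier_mat 1 1" using VA[OF i(1)] din t by auto
    then have "arrow V i = 0\<^sub>m 1 1" using z by (intro eq_matI) auto
    then have "arrow V i *\<^sub>v ?v i = 0\<^sub>v 1" using vc[OF t(1,2)] din[OF t(1,2)]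
        by (intro eq_vecI) auto
    then show False using vS[OF t(1)] v_nz[OF t(3,4)] din[OF t(3,4)] by simp
  qed
  then have "interval_rep n ?A V" using V din dout pA by (simp add: interval_rep_def)
  moreover have "edge n ?A" using a1 bn by (simp add: edge_def)
  ultimately show ?thesis by blast
qed

end

lemma vec_1_smult:
  assumes "x \<in> carrier_vec 1" "y \<in> carrier_vec 1" "x \<noteq> 0\<^sub>v 1"
  shows "\<exists>c :: 'k::field. y = c \<cdot>\<^sub>v x"
proof -
  have "x $ 0 \<noteq> 0"
  proof
    assume "x $ 0 = 0"
    then have "x = 0\<^sub>v 1" using assms(1) by (intro eq_vecI) auto
    then show False using assms(3) by blast
  qed
  then have "y = (y $ 0 / x $ 0) \<cdot>\<^sub>v x" using assms by (intro eq_vecI) auto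
  then show ?thesis by blast
qed

text \<open>A nonzero vector at the first vertex is carried along the nonzero arrows and fills every
  one-dimensional space, which leaves nothing for the complement.\<close>

lemma interval_rep_summand:
  fixes V :: "'k::field quiver_rep"
  assumes A: "edge n A" and V: "interval_rep n A V"
    and U: "subrep n V U" and W: "subrep n V W" and UW: "\<And>i. i \<in> {1..n} \<Longrightarrow> U i \<inter> W i =
        {0\<^sub>v (vdim V i)}"
    and x: "x \<in> U (fst A)" "x \<noteq> 0\<^sub>v (vdim V (fst A))" and i: "i \<in> {1..n}"
  shows "W i = {0\<^sub>v (vdim V i)}"
proof -
  note VA = arrow_carrier[OF interval_rep_is_rep[OF V]] and Vd = interval_rep_dim[OF V]
  have eA: "1 \<le> fst A" "fst A < snd A" "snd A \<le> Suc n" using A by (auto simp: edge_def)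
  have sU: "U i \<subseteq> carrier_vec (vdim V i)" "0\<^sub>v (vdim V i) \<in> U i" "\<And>c x. x \<in> U i \<Longrightarrow> c \<cdot>\<^sub>v x \<in> U i"
    if "i \<in> {1..n}" for i
    using U that unfolding subrep_def subspace_iff by blast+
  have sW: "W i \<subseteq> carrier_vec (vdim V i)" "0\<^sub>v (vdim V i) \<in> W i"
    using W i unfolding subrep_def subspace_iff by blast+
  have nz: "\<exists>x\<in>U j. x \<noteq> 0\<^sub>v (vdim V j)" if "fst A \<le> j" "j < snd A" for j
    using that
  proof (induction j rule: dec_induct)
    case base
    then show ?case using x by blast
  next
    case (step j)
    then obtain y where y: "y \<in> U j" "y \<noteq> 0\<^sub>v (vdim V j)" by auto
    have j: "j \<in> {1..<n}" "j \<in> {1..n}" "Suc j \<in> {1..n}" "j \<in> pts A" "Suc j \<in> pts A"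
      using step eA by (auto simp: pts_def)
    have d: "vdim V j = 1" "vdim V (Suc j) = 1" using Vd j by auto
    have yc: "y \<in> carrier_vec 1" using sU(1)[OF j(2)] y d by auto
    have y0: "y $ 0 \<noteq> 0"
    proof
      assume "y $ 0 = 0"
      then have "y = 0\<^sub>v 1" using yc by (intro eq_vecI) auto
      then show False using y d by simp
    qed
    have "arrow V j *\<^sub>v y \<in> U (Suc j)" using U j(1) y unfolding subrep_def by blast
    moreover have "(arrow V j *\<^sub>v y) $ 0 = arrow V j $$ (0, 0) * y $ 0"
      using VA[OF j(1)] yc d by (simp add: scalar_prod_def)
    then have "(arrow V j *\<^sub>v y) $ 0 \<noteq> 0" using interval_rep_arrow[OF V j(1,4,5)] y0 by simp
    then have "arrow V j *\<^sub>v y \<noteq> 0\<^sub>v (vdim V (Suc j))" using d by auto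
    ultimately show ?case by blast
  qed
  show ?thesis
  proof (cases "i \<in> pts A")
    case True
    then obtain y where y: "y \<in> U i" "y \<noteq> 0\<^sub>v (vdim V i)" using nz by (auto simp: pts_def)
    have d: "vdim V i = 1" using Vd[OF i] True by simp
    have "w \<in> U i" if "w \<in> W i" for w
    proof -
      have "y \<in> carrier_vec 1" "w \<in> carrier_vec 1" using y(1) sU(1)[OF i] sW(1) that d by auto
      then obtain c where "w = c \<cdot>\<^sub>v y" using vec_1_smult[of y w] y d by auto
      then show ?thesis using sU(3)[OF i y(1)] by simp
    qed
    then show ?thesis using UW[OF i] sW by blast
  next
    case False
    then have d: "vdim V i = 0" using Vd[OF i] by simp
    have "w = 0\<^sub>v (vdim V i)" if "w \<in> W i" for w
      using subsetD[OF sW(1) that] d by (intro eq_vecI) auto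
    then show ?thesis using sW by blast
  qed
qed

lemma indecomposable_interval_rep:
  fixes V :: "'k::field quiver_rep"
  assumes A: "edge n A" and V: "interval_rep n A V"
  shows "indecomposable n V"
  unfolding indecomposable_def
proof (intro conjI allI impI)
  have a: "fst A \<in> {1..n}" "fst A \<in> pts A" using A by (auto simp: edge_def pts_def)
  have d: "vdim V (fst A) = 1" using interval_rep_dim[OF V a(1)] a(2) by simp
  show "\<exists>i\<in>{1..n}. vdim V i \<noteq> 0" using a d by force
  fix U W assume ds: "internal_direct_sum n V U W"
  then have s: "subrep n V U" "subrep n V W" and I: "\<And>i. i \<in> {1..n} \<Longrightarrow> U i \<inter> W i = {0\<^sub>v (vdim V i)}"
    by (auto simp: internal_direct_sum_def)
  have "unit_vec 1 0 \<in> {u + w |u w. u \<in> U (fst A) \<and> w \<in> W (fst A)}"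
    using ds a d by (auto simp: internal_direct_sum_def)
  then obtain u w where uw: "unit_vec 1 0 = u + w" "u \<in> U (fst A)" "w \<in> W (fst A)" by blast
  have "u \<noteq> 0\<^sub>v 1 \<or> w \<noteq> 0\<^sub>v 1"
  proof (rule ccontr)
    assume "\<not> ?thesis"
    then have "unit_vec 1 0 = (0\<^sub>v 1 :: 'k vec)" using uw(1) by simp
    then have "(unit_vec 1 0 :: 'k vec) $ 0 = 0\<^sub>v 1 $ 0" by simp
    then show False by simp
  qed
  then show "(\<forall>i\<in>{1..n}. U i = {0\<^sub>v (vdim V i)}) \<or> (\<forall>i\<in>{1..n}. W i = {0\<^sub>v (vdim V i)})"
    using interval_rep_summand[OF A V s I uw(2)] interval_rep_summand[OF A V s(2,1) _ uw(3)] I d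
    by (metis Int_commute)
qed

section \<open>Extensions of interval modules\<close>

text \<open>A preimage of the generator of \<open>V\<close> is transported along \<open>X\<close>. It need not die where \<open>V\<close>
  ends, but then its image comes from \<open>W\<close>, and \<open>W\<close> reaches back far enough to correct the
  preimage.\<close>
lemma ext1_vanishes_interval:
  fixes V W :: "'k::field quiver_rep"
  assumes A: "edge n A" and B: "edge n B" and V: "interval_rep n A V" and W: "interval_rep n B W"
    and no: "\<not> (fst A < fst B \<and> fst B \<le> snd A \<and> snd A < snd B)"
  shows "ext1_vanishes n V W"
  unfolding ext1_vanishes_def
proof (intro allI impI)
  fix X :: "'k quiver_rep" and f g
  assume "is_rep n X \<and> short_exact n W f X g V"
  then have X: "is_rep n X" and ex: "short_exact n W f X g V" by auto
  note VA = arrow_carrier[OF interval_rep_is_rep[OF V]] and WA = arrow_carrier[OF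
      interval_rep_is_rep[OF W]]
    and XA = arrow_carrier[OF X]
  note Vd = interval_rep_dim[OF V] and Wd = interval_rep_dim[OF W]
  obtain a b where ab: "fst A = a" "snd A = Suc b" and eA: "1 \<le> a" "a \<le> b" "b \<le> n"
    using A by (cases "snd A") (auto simp: edge_def)
  have eB: "1 \<le> fst B" "fst B < snd B" "snd B \<le> Suc n" using B by (auto simp: edge_def)
  have fc: "f i \<in> carrier_mat (vdim X i) (vdim W i)" and gc: "g i \<in> carrier_mat (vdim V i) (vdim X
      i)"
    if "i \<in> {1..n}" for i
    using ex that by (auto simp: short_exact_def rep_hom_def)
  have fs: "f (Suc i) * arrow W i = arrow X i * f i" and gs: "g (Suc i) * arrow X i =
      arrow V i * g i"
    if "i \<in> {1..<n}" for i
    using ex that by (auto simp: short_exact_def rep_hom_def)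
  have ker: "(*\<^sub>v) (f i) ` carrier_vec (vdim W i) = mat_kernel (g i)"
    and surj: "(*\<^sub>v) (g i) ` carrier_vec (vdim X i) = carrier_vec (vdim V i)" if "i \<in> {1..n}" for i
    using ex that by (auto simp: short_exact_def)
  let ?e = "vec 1 (\<lambda>_. 1 :: 'k)"
  have pA: "i \<in> pts A \<longleftrightarrow> a \<le> i \<and> i \<le> b" for i using ab by (auto simp: pts_def)
  have aD: "a \<in> {1..n}" "a \<in> pts A" "b \<in> {1..n}" "b \<in> pts A" "a \<le> b" using eA by (simp_all add: pA)
  let ?\<alpha> = "\<lambda>i. arrow V i $$ (0, 0)" and ?\<beta> = "\<lambda>i. arrow W i $$ (0, 0)"
  have dV: "vdim V i = 1" if "a \<le> i" "i \<le> b" for i using that Vd[of i] pA[of i] eA by auto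
  have \<alpha>: "?\<alpha> i \<noteq> 0" if "a \<le> i" "i < b" for i
    using interval_rep_arrow[OF V, of i] pA[of i] pA[of "Suc i"] that eA by auto
  have scal: "M *\<^sub>v (c \<cdot>\<^sub>v ?e) = (M $$ (0, 0) * c) \<cdot>\<^sub>v ?e" if "M \<in> carrier_mat 1 1" for M c
    using that by (intro eq_vecI) (auto simp: scalar_prod_def)
  obtain x where x: "x \<in> carrier_vec (vdim X a)" "g a *\<^sub>v x = ?e"
  proof -
    have "?e \<in> carrier_vec (vdim V a)" using dV[of a] aD by simp
    then have "?e \<in> (*\<^sub>v) (g a) ` carrier_vec (vdim X a)" using surj[OF aD(1)] by simp
    then show ?thesis using that by auto
  qed
  \<comment> \<open>Dividing by the arrow entries of \<open>V\<close> keeps the image under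
    \<open>g\<close> equal to \<open>?e\<close> at each vertex.\<close>
  define y where "y = (\<lambda>i. rec_nat x (\<lambda>k v. inverse (?\<alpha> (a + k)) \<cdot>\<^sub>v (arrow X (a + k) *\<^sub>v v)) (i -
      a))"
  have y_a: "y a = x" by (simp add: y_def)
  have y_Suc: "y (Suc i) = inverse (?\<alpha> i) \<cdot>\<^sub>v (arrow X i *\<^sub>v y i)" if "a \<le> i" for i
    using that by (simp add: y_def Suc_diff_le)
  have y: "y i \<in> carrier_vec (vdim X i) \<and> g i *\<^sub>v y i = ?e" if "a \<le> i" "i \<le> b" for i
    using that
  proof (induction i rule: dec_induct)
    case base
    then show ?case using x y_a by simp
  next
    case (step i)
    have iD: "i \<in> {1..<n}" "i \<in> {1..n}" "Suc i \<in> {1..n}" using step eA by auto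
    have yi: "y i \<in> carrier_vec (vdim X i)" "g i *\<^sub>v y i = ?e" using step by auto
    have Xy: "arrow X i *\<^sub>v y i \<in> carrier_vec (vdim X (Suc i))" using XA[OF iD(1)] yi by auto
    have "g (Suc i) *\<^sub>v (arrow X i *\<^sub>v y i) = (g (Suc i) * arrow X i) *\<^sub>v y i"
      using assoc_mult_mat_vec[OF gc[OF iD(3)] XA[OF iD(1)] yi(1)] by simp
    also have "\<dots> = arrow V i *\<^sub>v (g i *\<^sub>v y i)"
      unfolding gs[OF iD(1)] using assoc_mult_mat_vec[OF VA[OF iD(1)] gc[OF iD(2)] yi(1)] .
    also have "\<dots> = ?\<alpha> i \<cdot>\<^sub>v ?e"
      using scal[of "arrow V i" 1] VA[OF iD(1)] dV[of i] dV[of "Suc i"] step yi(2) by simp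
    finally have "g (Suc i) *\<^sub>v (arrow X i *\<^sub>v y i) = ?\<alpha> i \<cdot>\<^sub>v ?e" .
    then have "g (Suc i) *\<^sub>v y (Suc i) = inverse (?\<alpha> i) \<cdot>\<^sub>v (?\<alpha> i \<cdot>\<^sub>v ?e)"
      unfolding y_Suc[OF step(1)] using mult_mat_vec[OF gc[OF iD(3)] Xy] by simp
    also have "\<dots> = ?e" using \<alpha>[of i] step by (intro eq_vecI) auto
    finally show ?case using Xy y_Suc[OF step(1)] by simp
  qed
  \<comment> \<open>Such a family is a section over the support of \<open>V\<close>; only the square
    of the arrow leaving the support is still missing.\<close>
  define good where "good z \<longleftrightarrow>
      (\<forall>i. a \<le> i \<and> i \<le> b \<longrightarrow> z i \<in> carrier_vec (vdim X i) \<and> g i *\<^sub>v z i = ?e) \<and>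
      (\<forall>i. a \<le> i \<and> i < b \<longrightarrow> arrow X i *\<^sub>v z i = ?\<alpha> i \<cdot>\<^sub>v z (Suc i))" for z
  have y_arrow: "arrow X i *\<^sub>v y i = ?\<alpha> i \<cdot>\<^sub>v y (Suc i)" if "a \<le> i" "i < b" for i
  proof -
    have iD: "i \<in> {1..<n}" using that eA by auto
    have "y i \<in> carrier_vec (vdim X i)" using y[of i] that by simp
    then have "arrow X i *\<^sub>v y i \<in> carrier_vec (vdim X (Suc i))" using XA[OF iD] by simp
    then show ?thesis unfolding y_Suc[OF that(1)] using \<alpha>[OF that] by (simp add: smult_smult_assoc)
  qed
  have good_y: "good y" unfolding good_def using y y_arrow by blast
  have "\<exists>z. good z \<and> (Suc b \<le> n \<longrightarrow> arrow X b *\<^sub>v z b = 0\<^sub>v (vdim X (Suc b)))"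
  proof (cases "Suc b \<le> n")
    case False
    then show ?thesis using good_y by blast
  next
    case True
    have bD: "b \<in> {1..<n}" "Suc b \<in> {1..n}" using True eA by auto
    have yb: "y b \<in> carrier_vec (vdim X b)" "g b *\<^sub>v y b = ?e" using y[of b] aD by auto
    let ?u = "arrow X b *\<^sub>v y b"
    have XAb: "arrow X b \<in> carrier_mat (vdim X (Suc b)) (vdim X b)" using XA[OF bD(1)] by simp
    have uc: "?u \<in> carrier_vec (vdim X (Suc b))" using XAb yb by auto
    have dVb: "vdim V (Suc b) = 0" using Vd[OF bD(2)] pA[of "Suc b"] eA by auto
    have "g (Suc b) *\<^sub>v ?u = 0\<^sub>v (vdim V (Suc b))"
      using gc[OF bD(2)] dVb by (intro eq_vecI) auto
    then have "?u \<in> mat_kernel (g (Suc b))" using mat_kernelI[OF gc[OF bD(2)] uc] by blast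
    then have "?u \<in> (*\<^sub>v) (f (Suc b)) ` carrier_vec (vdim W (Suc b))" using ker[OF bD(2)] by simp
    then obtain t where t: "t \<in> carrier_vec (vdim W (Suc b))" "?u = f (Suc b) *\<^sub>v t" by blast
    show ?thesis
    proof (cases "Suc b \<in> pts B")
      case False
      then have d0: "vdim W (Suc b) = 0" using Wd[OF bD(2)] by simp
      have "f (Suc b) *\<^sub>v t = 0\<^sub>v (vdim X (Suc b))"
        using fc[OF bD(2)] t(1) d0 by (intro eq_vecI) (auto simp: scalar_prod_def)
      then show ?thesis using good_y t by auto
    next
      case inB: True
      \<comment> \<open>Here the excluded pattern enters: \<open>W\<close> is nonzero at
        \<open>Suc b\<close>, so it has to reach back to \<open>a\<close>.\<close>
      then have aB: "fst B \<le> a" "Suc b < snd B" using no ab by (auto simp: pts_def)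
      have dW: "vdim W i = 1" if "a \<le> i" "i \<le> Suc b" for i
        using Wd[of i] that aB eA True by (auto simp: pts_def)
      have \<beta>: "?\<beta> i \<noteq> 0" if "a \<le> i" "i < Suc b" for i
        using interval_rep_arrow[OF W, of i] that aB eA True by (auto simp: pts_def)
      define G where "G i = (\<Prod>j\<in>{a..<i}. ?\<beta> j / ?\<alpha> j)" for i
      have G_Suc: "?\<alpha> i * G (Suc i) = ?\<beta> i * G i" if "a \<le> i" "i < b" for i
        using that \<alpha>[OF that] by (simp add: G_def)
      have Gb: "G b \<noteq> 0" unfolding G_def using \<alpha> \<beta> eA by auto
      \<comment> \<open>The factors \<open>G\<close> make \<open>h\<close> compatible with the
        arrows in the same way as \<open>y\<close>, and \<open>\<gamma>\<close> is fitted so that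
        \<open>h\<close> and \<open>y\<close> have the same image beyond \<open>b\<close>. Their
        difference then dies there.\<close>
      define \<gamma> where "\<gamma> = t $ 0 / (?\<beta> b * G b)"
      have \<beta>b: "?\<beta> b \<noteq> 0" using \<beta>[of b] aD eA by simp
      define h where "h i = f i *\<^sub>v ((\<gamma> * G i) \<cdot>\<^sub>v ?e)" for i
      have wc: "c \<cdot>\<^sub>v ?e \<in> carrier_vec (vdim W i)" if "a \<le> i" "i \<le> Suc b" for c i
        using dW[OF that] by simp
      have hc: "h i \<in> carrier_vec (vdim X i)" if "a \<le> i" "i \<le> b" for i
      proof -
        have "i \<in> {1..n}" "i \<le> Suc b" using that eA by auto
        then show ?thesis unfolding h_def using mult_mat_vec_carrier[OF fc wc] that(1) by blast
      qed
      have Xh: "arrow X i *\<^sub>v h i = f (Suc i) *\<^sub>v ((?\<beta> i * (\<gamma> * G i)) \<cdot>\<^sub>v ?e)" if "a \<le> i" "i \<le> b"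
          for i
      proof -
        have iD: "i \<in> {1..<n}" "i \<in> {1..n}" "Suc i \<in> {1..n}" "Suc i \<le> Suc b" "i \<le> Suc b"
          using that eA True by auto
        note w = wc[OF that(1) iD(5)]
        have "arrow X i *\<^sub>v h i = (arrow X i * f i) *\<^sub>v ((\<gamma> * G i) \<cdot>\<^sub>v ?e)"
          unfolding h_def using assoc_mult_mat_vec[OF XA[OF iD(1)] fc[OF iD(2)] w] by simp
        also have "\<dots> = f (Suc i) *\<^sub>v (arrow W i *\<^sub>v ((\<gamma> * G i) \<cdot>\<^sub>v ?e))"
          unfolding fs[OF iD(1), symmetric]
              using assoc_mult_mat_vec[OF fc[OF iD(3)] WA[OF iD(1)] w] .
        also have "arrow W i *\<^sub>v ((\<gamma> * G i) \<cdot>\<^sub>v ?e) = (?\<beta> i * (\<gamma> * G i)) \<cdot>\<^sub>v ?e"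
          by (rule scal) (use WA[OF iD(1)] dW[of i] dW[of "Suc i"] that(1) iD in auto)
        finally show ?thesis .
      qed
      have gh: "g i *\<^sub>v h i = 0\<^sub>v (vdim V i)" if "a \<le> i" "i \<le> b" for i
      proof -
        have iD: "i \<in> {1..n}" "i \<le> Suc b" using that eA by auto
        have "h i \<in> (*\<^sub>v) (f i) ` carrier_vec (vdim W i)" using wc[OF that(1) iD(2)]
            unfolding h_def by blast
        then have "h i \<in> mat_kernel (g i)" using ker[OF iD(1)] by simp
        then show ?thesis using mat_kernelD[OF gc[OF iD(1)]] by blast
      qed
      define z where "z i = y i - h i" for i
      have "good z" unfolding good_def
      proof (intro conjI allI impI)
        fix i assume "a \<le> i \<and> i \<le> b"
        then have i: "a \<le> i" "i \<le> b" by auto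
        then have iD: "i \<in> {1..n}" using eA by auto
        show "z i \<in> carrier_vec (vdim X i)" using y[OF i] hc[OF i] by (simp add: z_def)
        have "g i *\<^sub>v z i = ?e - 0\<^sub>v (vdim V i)"
          unfolding z_def using mult_minus_distrib_mat_vec[OF gc[OF iD]] y[OF i] hc[OF i] gh[OF i]
              by simp
        then show "g i *\<^sub>v z i = ?e" using dV[OF i] by simp
      next
        fix i assume "a \<le> i \<and> i < b"
        then have i: "a \<le> i" "i < b" by auto
        have iD: "i \<in> {1..<n}" "Suc i \<in> {1..n}" using i eA by auto
        have f1: "f (Suc i) \<in> carrier_mat (vdim X (Suc i)) 1" using fc[OF iD(2)] dW[of "Suc i"] i
            by auto
        have hS: "arrow X i *\<^sub>v h i = ?\<alpha> i \<cdot>\<^sub>v h (Suc i)"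
        proof -
          have "arrow X i *\<^sub>v h i = f (Suc i) *\<^sub>v ((?\<alpha> i * (\<gamma> * G (Suc i))) \<cdot>\<^sub>v ?e)"
            using Xh[of i] i G_Suc[OF i] by (simp add: mult.left_commute)
          also have "\<dots> = f (Suc i) *\<^sub>v (?\<alpha> i \<cdot>\<^sub>v ((\<gamma> * G (Suc i)) \<cdot>\<^sub>v ?e))"
            by (simp add: smult_smult_assoc)
          also have "\<dots> = ?\<alpha> i \<cdot>\<^sub>v h (Suc i)" unfolding h_def by (rule mult_mat_vec[OF f1]) simp
          finally show ?thesis .
        qed
        have "arrow X i *\<^sub>v z i = ?\<alpha> i \<cdot>\<^sub>v y (Suc i) - ?\<alpha> i \<cdot>\<^sub>v h (Suc i)"
          unfolding z_def using mult_minus_distrib_mat_vec[OF XA[OF iD(1)]] y[of i] hc[of i] i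
              y_arrow[OF i] hS by simp
        also have "\<dots> = ?\<alpha> i \<cdot>\<^sub>v z (Suc i)"
          unfolding z_def using y[of "Suc i"] hc[of "Suc i"] i
              by (intro eq_vecI) (auto simp: algebra_simps)
        finally show "arrow X i *\<^sub>v z i = ?\<alpha> i \<cdot>\<^sub>v z (Suc i)" .
      qed
      moreover have "arrow X b *\<^sub>v z b = 0\<^sub>v (vdim X (Suc b))"
      proof -
        have "(?\<beta> b * (\<gamma> * G b)) \<cdot>\<^sub>v ?e = t"
          using t(1) dW[of "Suc b"] aD eA \<beta>b Gb by (intro eq_vecI) (auto simp: \<gamma>_def)
        then have "arrow X b *\<^sub>v h b = ?u" using Xh[of b] aD t(2) by simp
        then have "arrow X b *\<^sub>v z b = ?u - ?u"
          unfolding z_def using mult_minus_distrib_mat_vec[OF XAb yb(1) hc[OF aD(5)]] by simp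
        then show ?thesis using uc by simp
      qed
      ultimately show ?thesis by blast
    qed
  qed
  then obtain z where z: "good z" and end_z: "Suc b \<le> n \<Longrightarrow> arrow X b *\<^sub>v z b = 0\<^sub>v (vdim X (Suc b))"
    by blast
  have zc: "z i \<in> carrier_vec (vdim X i)" "g i *\<^sub>v z i = ?e" if "a \<le> i" "i \<le> b" for i
    using z that unfolding good_def by blast+
  define s where "s i = (if i \<in> pts A then mat (vdim X i) 1 (\<lambda>(r, _). z i $ r) else 0\<^sub>m (vdim X i)
      0)" for i
  have sin: "s i = mat (vdim X i) 1 (\<lambda>(r, _). z i $ r)" if "a \<le> i" "i \<le> b" for i
    using that pA by (simp add: s_def)
  have sc: "s i \<in> carrier_mat (vdim X i) (vdim V i)" if "i \<in> {1..n}" for i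
    using Vd[OF that] by (auto simp: s_def)
  have ms: "M * s i = mat r 1 (\<lambda>(j, _). (M *\<^sub>v z i) $ j)"
    if "M \<in> carrier_mat r (vdim X i)" "a \<le> i" "i \<le> b" for M r i
  proof -
    have "col (s i) 0 = z i" using zc(1)[OF that(2,3)]
        by (intro eq_vecI) (auto simp: sin[OF that(2,3)])
    then show ?thesis using that(1) by (intro eq_matI) (auto simp: sin[OF that(2,3)])
  qed
  have "s \<in> rep_hom n V X"
    unfolding rep_hom_def
  proof (intro CollectI conjI ballI sc)
    fix i assume i: "i \<in> {1..<n}"
    have iD: "i \<in> {1..n}" "Suc i \<in> {1..n}" using i by auto
    have lc: "s (Suc i) * arrow V i \<in> carrier_mat (vdim X (Suc i)) (vdim V i)"
        using sc[OF iD(2)] VA[OF i] by auto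
    have rc: "arrow X i * s i \<in> carrier_mat (vdim X (Suc i)) (vdim V i)"
        using sc[OF iD(1)] XA[OF i] by auto
    consider "a \<le> i" "i < b" | "i = b" | "\<not> (a \<le> i \<and> i \<le> b)" by linarith
    then show "s (Suc i) * arrow V i = arrow X i * s i"
    proof cases
      case 1
      have d: "vdim V i = 1" "vdim V (Suc i) = 1" using dV 1 by auto
      have aS: "a \<le> Suc i" "Suc i \<le> b" using 1 by auto
      have "arrow X i *\<^sub>v z i = ?\<alpha> i \<cdot>\<^sub>v z (Suc i)" using z 1 unfolding good_def by blast
      then have R: "arrow X i * s i = mat (vdim X (Suc i)) 1 (\<lambda>(j, _). (?\<alpha> i \<cdot>\<^sub>v z (Suc i)) $ j)"
        using ms[OF XA[OF i], of ] 1 by simp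
      have "(s (Suc i) * arrow V i) $$ (r, 0) = z (Suc i) $ r * ?\<alpha> i" if "r < vdim X (Suc i)" for r
        using mult_mat_inner1[of "s (Suc i)" "vdim X (Suc i)" "arrow V i" 1 r 0] sc[OF iD(2)]
            VA[OF i] d that
        by (simp add: sin[OF aS])
      then show ?thesis unfolding R using lc d zc(1)[OF aS] by (intro eq_matI) auto
    next
      case 2
      then have bn: "Suc b \<le> n" "Suc i = Suc b" using i by auto
      have d: "vdim V i = 1" "vdim V (Suc i) = 0" using dV[of i] 2 aD Vd[OF iD(2)] pA[of "Suc i"]
          by auto
      have "s (Suc i) * arrow V i = 0\<^sub>m (vdim X (Suc i)) 1"
        by (rule mult_mat_inner0) (use sc[OF iD(2)] VA[OF i] d in auto)
      moreover have "arrow X i * s i = mat (vdim X (Suc i)) 1 (\<lambda>(j, _). 0\<^sub>v (vdim X (Suc i)) $ j)"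
        using ms[OF XA[OF i]] 2 aD end_z[OF bn(1)] bn(2) by simp
      moreover have "\<dots> = 0\<^sub>m (vdim X (Suc i)) 1" by (intro eq_matI) auto
      ultimately show ?thesis by simp
    next
      case 3
      then have "vdim V i = 0" using Vd[OF iD(1)] pA[of i] by auto
      then show ?thesis using lc rc by (intro eq_mat_no_cols) auto
    qed
  qed
  moreover have "g i * s i = 1\<^sub>m (vdim V i)" if i: "i \<in> {1..n}" for i
  proof (cases "a \<le> i \<and> i \<le> b")
    case True
    then have "g i * s i = mat (vdim V i) 1 (\<lambda>(j, _). ?e $ j)" using ms[OF gc[OF i]] zc(2)[of i]
        by simp
    then show ?thesis using dV[of i] True by (intro eq_matI) auto
  next
    case False
    then have d: "vdim V i = 0" using Vd[OF i] pA[of i] by auto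
    then show ?thesis using gc[OF i] sc[OF i] by (intro eq_matI) auto
  qed
  ultimately show "\<exists>s\<in>rep_hom n V X. \<forall>i\<in>{1..n}. g i * s i = 1\<^sub>m (vdim V i)" by blast
qed

lemma eq_mat_by_vec:
  fixes A B :: "'k::field mat"
  assumes A: "A \<in> carrier_mat r c" and B: "B \<in> carrier_mat r c"
    and eq: "\<And>v. v \<in> carrier_vec c \<Longrightarrow> A *\<^sub>v v = B *\<^sub>v v"
  shows "A = B"
proof (rule eq_matI)
  fix i j assume ij: "i < dim_row B" "j < dim_col B"
  have "(A *\<^sub>v unit_vec c j) $ i = (B *\<^sub>v unit_vec c j) $ i" using eq by simp
  then show "A $$ (i, j) = B $$ (i, j)" using ij A B by simp
qed (use A B in auto)

text \<open>The extension is given by the cocycle \<open>\<eta>\<close> supported at the last vertex of \<open>V\<close>. The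
  \<open>W\<close>-component of a section would be nonzero at that vertex and zero at the first vertex of
  \<open>W\<close>.\<close>
lemma ext1_nonvanishing_interval:
  fixes V W :: "'k::field quiver_rep"
  assumes A: "edge n A" and B: "edge n B" and V: "interval_rep n A V" and W: "interval_rep n B W"
    and c: "fst A < fst B" "fst B \<le> snd A" "snd A < snd B"
  shows "\<not> ext1_vanishes n V W"
proof
  assume van: "ext1_vanishes n V W"
  note VA = arrow_carrier[OF interval_rep_is_rep[OF V]] and WA = arrow_carrier[OF
      interval_rep_is_rep[OF W]]
  note Vd = interval_rep_dim[OF V] and Wd = interval_rep_dim[OF W]
  obtain b where b: "snd A = Suc b" using c by (cases "snd A") auto
  have eA: "1 \<le> fst A" "fst A \<le> b" "Suc b \<le> n" "fst B \<le> Suc b" "Suc b < snd B" "snd B \<le> Suc n"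
    using A B b c by (auto simp: edge_def)
  define \<eta> where "\<eta> i = (if i =
      b then mat 1 1 (\<lambda>_. 1) else 0\<^sub>m (vdim W (Suc i)) (vdim V i) :: 'k mat)" for i
  have dVb: "vdim V b = 1" and dWb: "vdim W (Suc b) = 1" and dVSb: "vdim V (Suc b) = 0"
    using Vd[of b] Wd[of "Suc b"] Vd[of "Suc b"] eA b by (auto simp: pts_def)
  have \<eta>c: "\<eta> i \<in> carrier_mat (vdim W (Suc i)) (vdim V i)" for i
    using dVb dWb by (simp add: \<eta>_def)
  define X where "X = \<lparr>vdim = (\<lambda>i. vdim W i + vdim V i),
    arrow = (\<lambda>i. four_block_mat (arrow W i) (\<eta> i) (0\<^sub>m (vdim V (Suc i)) (vdim W i)) (arrow V i))\<rparr>"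
  have Xd: "vdim X i = vdim W i + vdim V i" for i by (simp add: X_def)
  have XA: "arrow X i \<in> carrier_mat (vdim X (Suc i)) (vdim X i)" if "i \<in> {1..<n}" for i
    using VA[OF that] WA[OF that] by (simp add: X_def)
  have Xv: "arrow X i *\<^sub>v (w @\<^sub>v v) = (arrow W i *\<^sub>v w + \<eta> i *\<^sub>v v) @\<^sub>v (arrow V i *\<^sub>v v)"
    if i: "i \<in> {1..<n}" and wv: "w \<in> carrier_vec (vdim W i)" "v \<in> carrier_vec (vdim V i)" for i w v
  proof -
    have "arrow X i *\<^sub>v (w @\<^sub>v v) =
        (arrow W i *\<^sub>v w + \<eta> i *\<^sub>v v) @\<^sub>v (0\<^sub>m (vdim V (Suc i)) (vdim W i) *\<^sub>v w + arrow V i *\<^sub>v v)"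
      unfolding X_def using four_block_mat_mult_vec[OF WA[OF i] \<eta>c zero_carrier_mat VA[OF i] wv]
          by simp
    also have "0\<^sub>m (vdim V (Suc i)) (vdim W i) *\<^sub>v w + arrow V i *\<^sub>v v = arrow V i *\<^sub>v v"
      using VA[OF i] wv by (intro eq_vecI) auto
    finally show ?thesis .
  qed
  define f :: "nat \<Rightarrow> 'k mat" where
    "f i = mat (vdim W i + vdim V i) (vdim W i) (\<lambda>(r, s). if r = s then 1 else 0)" for i
  define g :: "nat \<Rightarrow> 'k mat" where
    "g i = mat (vdim V i) (vdim W i + vdim V i) (\<lambda>(r, s). if s = vdim W i + r then 1 else 0)" for i
  have fc: "f i \<in> carrier_mat (vdim X i) (vdim W i)" and gc: "g i \<in> carrier_mat (vdim V i) (vdim X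
      i)" for i
    by (simp_all add: f_def g_def Xd)
  have fv: "f i *\<^sub>v w = w @\<^sub>v 0\<^sub>v (vdim V i)" if "w \<in> carrier_vec (vdim W i)" for i w
  proof (rule eq_vecI)
    fix r assume "r < dim_vec (w @\<^sub>v 0\<^sub>v (vdim V i))"
    then have r: "r < vdim W i + vdim V i" using that by simp
    have "(f i *\<^sub>v w) $ r = (\<Sum>s = 0..<vdim W i. (if r = s then 1 else 0) * w $ s)"
      using r that by (simp add: f_def scalar_prod_def)
    also have "\<dots> = (w @\<^sub>v 0\<^sub>v (vdim V i)) $ r" using r that
        by (simp add: if_distrib[of "\<lambda>x. x * _"] cong: if_cong)
    finally show "(f i *\<^sub>v w) $ r = (w @\<^sub>v 0\<^sub>v (vdim V i)) $ r" .
  qed (use that in \<open>simp add: f_def\<close>)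
  have gv: "g i *\<^sub>v (w @\<^sub>v v) = v" if "w \<in> carrier_vec (vdim W i)" "v \<in> carrier_vec (vdim V i)"
      for i w v
  proof (rule eq_vecI)
    fix r assume "r < dim_vec v"
    then have r: "r < vdim V i" using that by simp
    have "(g i *\<^sub>v (w @\<^sub>v v)) $ r =
        (\<Sum>s = 0..<vdim W i + vdim V i. (if s = vdim W i + r then 1 else 0) * (w @\<^sub>v v) $ s)"
      using r that by (simp add: g_def scalar_prod_def)
    also have "\<dots> = v $ r" using r that by (simp add: if_distrib[of "\<lambda>x. x * _"] cong: if_cong)
    finally show "(g i *\<^sub>v (w @\<^sub>v v)) $ r = v $ r" .
  qed (use that in \<open>simp add: g_def\<close>)
  have split: "\<exists>w v. x = w @\<^sub>v v \<and> w \<in> carrier_vec (vdim W i) \<and> v \<in> carrier_vec (vdim V i)"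
    if "x \<in> carrier_vec (vdim X i)" for x :: "'k vec" and i
    using that by (intro exI[of _ "vec_first x (vdim W i)"] exI[of _ "vec_last x (vdim V i)"])
        (simp add: Xd)
  have X: "is_rep n X" using XA by (simp add: is_rep_def)
  have fh: "f \<in> rep_hom n W X" unfolding rep_hom_def
  proof (intro CollectI conjI ballI fc)
    fix i assume i: "i \<in> {1..<n}"
    show "f (Suc i) * arrow W i = arrow X i * f i"
    proof (rule eq_mat_by_vec)
      show "f (Suc i) * arrow W i \<in> carrier_mat (vdim X (Suc i)) (vdim W i)"
        "arrow X i * f i \<in> carrier_mat (vdim X (Suc i)) (vdim W i)"
        using mult_carrier_mat[OF fc WA[OF i]] mult_carrier_mat[OF XA[OF i] fc] by auto
      fix w :: "'k vec" assume w: "w \<in> carrier_vec (vdim W i)"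
      have Ww: "arrow W i *\<^sub>v w \<in> carrier_vec (vdim W (Suc i))"
          using mult_mat_vec_carrier[OF WA[OF i] w] .
      have "f (Suc i) * arrow W i *\<^sub>v w = (arrow W i *\<^sub>v w) @\<^sub>v 0\<^sub>v (vdim V (Suc i))"
        using assoc_mult_mat_vec[OF fc WA[OF i] w] fv[OF Ww] by simp
      moreover have "arrow X i * f i *\<^sub>v w = arrow X i *\<^sub>v (w @\<^sub>v 0\<^sub>v (vdim V i))"
        using assoc_mult_mat_vec[OF XA[OF i] fc w] fv[OF w] by simp
      moreover have "\<eta> i *\<^sub>v 0\<^sub>v (vdim V i) = 0\<^sub>v (vdim W (Suc i))"
          "arrow V i *\<^sub>v 0\<^sub>v (vdim V i) = 0\<^sub>v (vdim V (Suc i))"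
        using \<eta>c[of i] VA[OF i] by (auto intro!: eq_vecI)
      ultimately show "f (Suc i) * arrow W i *\<^sub>v w = arrow X i * f i *\<^sub>v w"
        using Xv[OF i w, of "0\<^sub>v (vdim V i)"] Ww by simp
    qed
  qed
  have gh: "g \<in> rep_hom n X V" unfolding rep_hom_def
  proof (intro CollectI conjI ballI gc)
    fix i assume i: "i \<in> {1..<n}"
    show "g (Suc i) * arrow X i = arrow V i * g i"
    proof (rule eq_mat_by_vec)
      show "g (Suc i) * arrow X i \<in> carrier_mat (vdim V (Suc i)) (vdim X i)"
        "arrow V i * g i \<in> carrier_mat (vdim V (Suc i)) (vdim X i)"
        using mult_carrier_mat[OF gc XA[OF i]] mult_carrier_mat[OF VA[OF i] gc] by auto
      fix x :: "'k vec" assume x: "x \<in> carrier_vec (vdim X i)"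
      obtain w v where wv: "x = w @\<^sub>v v" "w \<in> carrier_vec (vdim W i)" "v \<in> carrier_vec (vdim V i)"
        using split[OF x] by blast
      have "arrow W i *\<^sub>v w + \<eta> i *\<^sub>v v \<in> carrier_vec (vdim W (Suc i))"
        using mult_mat_vec_carrier[OF WA[OF i] wv(2)] mult_mat_vec_carrier[OF \<eta>c wv(3)] by simp
      then show "g (Suc i) * arrow X i *\<^sub>v x = arrow V i * g i *\<^sub>v x"
        using assoc_mult_mat_vec[OF gc XA[OF i] x] assoc_mult_mat_vec[OF VA[OF i] gc x]
          gv[OF _ mult_mat_vec_carrier[OF VA[OF i] wv(3)]] gv[OF wv(2,3)] Xv[OF i wv(2,3)] wv(1)
              by simp
    qed
  qed
  have "short_exact n W f X g V" unfolding short_exact_def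
  proof (intro conjI ballI fh gh)
    fix i assume "i \<in> {1..n}"
    show "inj_on ((*\<^sub>v) (f i)) (carrier_vec (vdim W i))"
    proof (rule inj_onI)
      fix x y :: "'k vec" assume "x \<in> carrier_vec (vdim W i)" "y \<in> carrier_vec (vdim W i)"
          "f i *\<^sub>v x = f i *\<^sub>v y"
      then show "x = y" using fv append_vec_eq[of x "vdim W i" y] by simp
    qed
    show "(*\<^sub>v) (f i) ` carrier_vec (vdim W i) = mat_kernel (g i)"
    proof (intro equalityI subsetI)
      fix x :: "'k vec" assume "x \<in> (*\<^sub>v) (f i) ` carrier_vec (vdim W i)"
      then obtain w where w: "w \<in> carrier_vec (vdim W i)" "x = f i *\<^sub>v w" by blast
      then have "g i *\<^sub>v x = 0\<^sub>v (vdim V i)" using fv gv by simp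
      moreover have "x \<in> carrier_vec (vdim X i)" using w mult_mat_vec_carrier[OF fc] by blast
      ultimately show "x \<in> mat_kernel (g i)" using mat_kernelI[OF gc] by blast
    next
      fix x :: "'k vec" assume "x \<in> mat_kernel (g i)"
      then have x: "x \<in> carrier_vec (vdim X i)" "g i *\<^sub>v x = 0\<^sub>v (vdim V i)"
          using mat_kernelD[OF gc] by blast+
      obtain w v where wv: "x = w @\<^sub>v v" "w \<in> carrier_vec (vdim W i)" "v \<in> carrier_vec (vdim V i)"
        using split[OF x(1)] by blast
      then have "x = f i *\<^sub>v w" using x(2) gv[OF wv(2,3)] fv[OF wv(2)] by simp
      then show "x \<in> (*\<^sub>v) (f i) ` carrier_vec (vdim W i)" using wv(2) by blast
    qed
    show "(*\<^sub>v) (g i) ` carrier_vec (vdim X i) = carrier_vec (vdim V i)"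
    proof (intro equalityI subsetI)
      fix v :: "'k vec" assume v: "v \<in> carrier_vec (vdim V i)"
      have "0\<^sub>v (vdim W i) @\<^sub>v v \<in> carrier_vec (vdim X i)" using v by (simp add: Xd)
      then show "v \<in> (*\<^sub>v) (g i) ` carrier_vec (vdim X i)" using gv[of "0\<^sub>v (vdim W i)" i v] v
        by (metis image_eqI zero_carrier_vec)
    qed (use mult_mat_vec_carrier[OF gc] in blast)
  qed
  then obtain s where s: "s \<in> rep_hom n V X" and gs: "\<And>i. i \<in> {1..n} \<Longrightarrow> g i * s i = 1\<^sub>m (vdim V i)"
    using van X unfolding ext1_vanishes_def by blast
  have sc: "s i \<in> carrier_mat (vdim X i) (vdim V i)" if "i \<in> {1..n}" for i
    using s that by (simp add: rep_hom_def)
  have sq: "s (Suc i) * arrow V i = arrow X i * s i" if "i \<in> {1..<n}" for i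
    using s that by (simp add: rep_hom_def)
  \<comment> \<open>In \<open>W\<close> followed by \<open>V\<close>, row \<open>vdim W i\<close> is
    the component in \<open>V\<close>, and \<open>g\<close> forces it to be the identity.\<close>
  have s1: "s i $$ (vdim W i, 0) = 1" if i: "i \<in> {1..n}" "vdim V i = 1" for i
  proof -
    have "1 = (g i * s i) $$ (0, 0)" using gs[OF i(1)] i by simp
    also have "\<dots> = (\<Sum>k = 0..<vdim X i. g i $$ (0, k) * s i $$ (k, 0))"
      using sc[OF i(1)] gc[of i] i by (simp add: scalar_prod_def)
    also have "\<dots> = (\<Sum>k = 0..<vdim X i. (if k = vdim W i then 1 else 0) * s i $$ (k, 0))"
      using i by (intro sum.cong) (auto simp: g_def Xd)
    also have "\<dots> = s i $$ (vdim W i, 0)" using i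
        by (simp add: Xd if_distrib[of "\<lambda>x. x * _"] cong: if_cong)
    finally show ?thesis by simp
  qed
  have entry: "(arrow X i * s i) $$ (0, 0) =
      (\<Sum>k = 0..<vdim W i. arrow W i $$ (0, k) * s i $$ (k, 0)) + \<eta> i $$ (0, 0)"
    if i: "i \<in> {1..<n}" "vdim V i = 1" "vdim W (Suc i) = 1" for i
  proof -
    have iD: "i \<in> {1..n}" using i by auto
    have "(arrow X i * s i) $$ (0, 0) = (\<Sum>k = 0..<vdim X i. arrow X i $$ (0, k) * s i $$ (k, 0))"
      using sc[OF iD] XA[OF i(1)] i by (simp add: scalar_prod_def Xd)
    also have "\<dots> = (\<Sum>k = 0..<vdim W i. arrow X i $$ (0, k) * s i $$ (k, 0))
        + arrow X i $$ (0, vdim W i) * s i $$ (vdim W i, 0)"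
      using i by (simp add: Xd)
    also have "(\<Sum>k = 0..<vdim W i. arrow X i $$ (0, k) * s i $$ (k, 0)) =
        (\<Sum>k = 0..<vdim W i. arrow W i $$ (0, k) * s i $$ (k, 0))"
      using WA[OF i(1)] VA[OF i(1)] i by (intro sum.cong) (auto simp: X_def)
    also have "arrow X i $$ (0, vdim W i) = \<eta> i $$ (0, 0)"
      using WA[OF i(1)] VA[OF i(1)] i by (auto simp: X_def)
    finally show ?thesis using s1[OF iD i(2)] by simp
  qed
  have dV: "vdim V i = 1" if "fst A \<le> i" "i \<le> b" for i
    using Vd[of i] that eA b by (auto simp: pts_def)
  have dW: "vdim W i = 1" if "fst B \<le> i" "i \<le> Suc b" for i
    using Wd[of i] that eA c by (auto simp: pts_def)
  have bD: "b \<in> {1..<n}" "b \<in> {1..n}" "Suc b \<in> {1..n}" using eA by auto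
  have "s (Suc b) * arrow V b = 0\<^sub>m (vdim X (Suc b)) 1"
    by (rule mult_mat_inner0) (use sc[OF bD(3)] VA[OF bD(1)] dVSb dVb in auto)
  then have "(arrow X b * s b) $$ (0, 0) = 0" unfolding sq[OF bD(1), symmetric] using dWb
      by (simp add: Xd)
  \<comment> \<open>The arrow of \<open>V\<close> at \<open>b\<close> ends in the zero space, so the
    entry 1 of the cocycle must be cancelled by the \<open>W\<close>-component of the section at
    \<open>b\<close>.\<close>
  then have last: "(\<Sum>k = 0..<vdim W b. arrow W b $$ (0, k) * s b $$ (k, 0)) + 1 = 0"
    using entry[OF bD(1) dVb dWb] by (simp add: \<eta>_def)
  show False
  proof (cases "fst B = Suc b")
    case True
    \<comment> \<open>If \<open>W\<close> starts right behind \<open>V\<close>, there is no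
      component at \<open>b\<close> that could cancel the 1.\<close>
    then have "vdim W b = 0" using Wd[OF bD(2)] by (simp add: pts_def)
    then show False using last by simp
  next
    case False
    then have cb: "fst B \<le> b" using eA by simp
    have sV: "(s (Suc i) * arrow V i) $$ (0, 0) = s (Suc i) $$ (0, 0) * arrow V i $$ (0, 0)"
      if "fst A \<le> i" "i < b" "fst B \<le> Suc i" for i
    proof -
      have iD: "i \<in> {1..<n}" "Suc i \<in> {1..n}" using that eA by auto
      show ?thesis
        by (rule mult_mat_inner1[of _ "vdim X (Suc i)" _ 1])
          (use sc[OF iD(2)] VA[OF iD(1)] dV[of i] dV[of "Suc i"] dW[of "Suc i"] that in \<open>auto
              simp: Xd\<close>)
    qed
    have \<alpha>: "arrow V i $$ (0, 0) \<noteq> 0" if "fst A \<le> i" "i < b" for i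
      using interval_rep_arrow[OF V, of i] that eA b by (auto simp: pts_def)
    have \<beta>: "arrow W i $$ (0, 0) \<noteq> 0" if "fst B \<le> i" "i \<le> b" for i
      using interval_rep_arrow[OF W, of i] that eA c by (auto simp: pts_def)
    \<comment> \<open>Before \<open>b\<close> the cocycle is zero, so there the
      \<open>W\<close>-component commutes with the arrows.\<close>
    have step: "s i $$ (0, 0) = 0 \<longleftrightarrow> s (Suc i) $$ (0, 0) = 0" if i: "fst B \<le> i" "i < b" for i
    proof -
      have iD: "i \<in> {1..<n}" "fst A \<le> i" using i eA c by auto
      have "s (Suc i) $$ (0, 0) * arrow V i $$ (0, 0) = arrow W i $$ (0, 0) * s i $$ (0, 0)"
        using entry[OF iD(1) dV dW] sV[of i] sq[OF iD(1)] dV[of i] dW[of i] dW[of "Suc i"] iD i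
        by (simp add: \<eta>_def)
      then show ?thesis using \<alpha>[of i] \<beta>[of i] i iD by auto
    qed
    \<comment> \<open>The vertex before \<open>fst B\<close> belongs to \<open>V\<close> but not to
      \<open>W\<close>, so the component enters \<open>W\<close> with the value 0.\<close>
    have "s (fst B) $$ (0, 0) = 0"
    proof -
      obtain j where j: "fst B = Suc j" using c by (cases "fst B") auto
      have jD: "j \<in> {1..<n}" "j \<in> {1..n}" "fst A \<le> j" "j < b" using j eA c cb by auto
      have "vdim W j = 0" using Wd[OF jD(2)] j by (simp add: pts_def)
      then have "s (Suc j) $$ (0, 0) * arrow V j $$ (0, 0) = 0"
        using entry[OF jD(1) dV dW] sV[of j] sq[OF jD(1)] dV[of j] dW[of "Suc j"] j jD cb
            by (simp add: \<eta>_def)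
      then show ?thesis using \<alpha>[OF jD(3,4)] j by simp
    qed
    moreover have "s (fst B) $$ (0, 0) = 0 \<longleftrightarrow> s b $$ (0, 0) = 0"
      by (rule telescope_eq[where e = "\<lambda>i. s i $$ (0, 0) = 0"]) (use cb step in auto)
    ultimately have "s b $$ (0, 0) = 0" by blast
    then show False using last dW[of b] cb by simp
  qed
qed

section \<open>The braid group action\<close>

lemma ext1_vanishes_iff_interval:
  fixes V W :: "'k::field quiver_rep"
  assumes "edge n A" "edge n B" "interval_rep n A V" "interval_rep n B W"
  shows "ext1_vanishes n V W \<longleftrightarrow> \<not> (fst A < fst B \<and> fst B \<le> snd A \<and> snd A < snd B)"
  using ext1_vanishes_interval[OF assms] ext1_nonvanishing_interval[OF assms] by blast

lemma exc_iff_vanishing: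
  fixes V W :: "'k::field quiver_rep"
  assumes "edge n A" "edge n B" "interval_rep n A V" "interval_rep n B W"
  shows "exc A B \<longleftrightarrow> hom_vanishes n W V \<and> ext1_vanishes n W V"
  unfolding exc_iff[OF assms(1,2)] hom_vanishes_interval[OF assms(2,1,4,3)]
    ext1_vanishes_iff_interval[OF assms(2,1,4,3)] by blast

lemma rigid_indecomposable_iff:
  fixes V :: "'k::field quiver_rep"
  shows "rigid_indecomposable n V \<longleftrightarrow> (\<exists>A. edge n A \<and> interval_rep n A V)"
proof
  assume "rigid_indecomposable n V"
  then show "\<exists>A. edge n A \<and> interval_rep n A V"
    using indecomposable_imp_interval by (auto simp: rigid_indecomposable_def)
next
  assume "\<exists>A. edge n A \<and> interval_rep n A V"
  then obtain A where A: "edge n A" "interval_rep n A V" by blast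
  then show "rigid_indecomposable n V"
    using interval_rep_is_rep[OF A(2)] indecomposable_interval_rep[OF A]
      ext1_vanishes_interval[OF A(1,1) A(2,2)] by (simp add: rigid_indecomposable_def)
qed

lemma interval_rep_unique:
  assumes "edge n A" "edge n B" "interval_rep n A V" "interval_rep n B V"
  shows "A = B"
proof -
  have "pts A = pts B"
    using supp_interval_rep[OF assms(1,3)] supp_interval_rep[OF assms(2,4)] by simp
  then show ?thesis using assms(1,2)
    by (simp add: edge_def pts_def atLeastLessThan_eq_iff prod_eq_iff)
qed

definition has_intervals :: "nat \<Rightarrow> (nat \<Rightarrow> 'k::field quiver_rep) \<Rightarrow> (nat \<Rightarrow> nat \<times> nat) \<Rightarrow> bool" where
  "has_intervals n E T \<longleftrightarrow> (\<forall>i\<in>{1..n}. edge n (T i) \<and> interval_rep n (T i) (E i))"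

lemma complete_exceptional_iff:
  "complete_exceptional n E \<longleftrightarrow> (\<exists>T. ces n T \<and> has_intervals n E T)"
proof -
  have iff: "complete_exceptional n E \<longleftrightarrow> ces n T" if T: "has_intervals n E T" for T
  proof -
    have "rigid_indecomposable n (E i)" if "i \<in> {1..n}" for i
      using T that unfolding rigid_indecomposable_iff has_intervals_def by blast
    moreover have "edge n (T i)" if "i \<in> {1..n}" for i using T that by (simp add: has_intervals_def)
    moreover have "exc (T i) (T j) \<longleftrightarrow> hom_vanishes n (E j) (E i) \<and> ext1_vanishes n (E j) (E i)"
      if "i \<in> {1..n}" "j \<in> {1..n}" for i j
      using T that by (intro exc_iff_vanishing) (simp_all add: has_intervals_def)
    ultimately show ?thesis unfolding complete_exceptional_def ces_def by simp
  qed
  show ?thesis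
  proof
    assume c: "complete_exceptional n E"
    then have "\<forall>i\<in>{1..n}. \<exists>A. edge n A \<and> interval_rep n A (E i)"
      by (simp add: complete_exceptional_def rigid_indecomposable_iff)
    then obtain T where "\<forall>i\<in>{1..n}. edge n (T i) \<and> interval_rep n (T i) (E i)" by metis
    then have "has_intervals n E T" by (simp add: has_intervals_def)
    then show "\<exists>T. ces n T \<and> has_intervals n E T" using iff c by blast
  qed (use iff in blast)
qed

lemma forest_of_eq_hasse:
  assumes "has_intervals n E T"
  shows "forest_of n E = hasse n T"
proof -
  have s: "supp n (E i) = pts (T i)" if "i \<in> {1..n}" for i
    using assms that supp_interval_rep[of n "T i" "E i"] by (simp add: has_intervals_def)
  show ?thesis
    by (intro equalityI subrelI) (simp_all add: forest_of_def hasse_def s cong: conj_cong)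
qed

lemma ex_has_intervals:
  assumes "\<And>i. i \<in> {1..n} \<Longrightarrow> edge n (T i)"
  shows "\<exists>E :: nat \<Rightarrow> 'k::field quiver_rep. has_intervals n E T"
proof -
  have "\<forall>i. \<exists>V :: 'k quiver_rep. interval_rep n (T i) V" using ex_interval_rep by blast
  then obtain E :: "nat \<Rightarrow> 'k quiver_rep" where "\<forall>i. interval_rep n (T i) (E i)" by metis
  then show ?thesis using assms by (auto simp: has_intervals_def)
qed

section \<open>Generators and the Garside element on sequences\<close>

lemma ces_cong: "ces n T \<Longrightarrow> (\<And>i. i \<in> {1..n} \<Longrightarrow> T i = T' i) \<Longrightarrow> ces n T'"
  by (simp add: ces_def)

text \<open>The new module is an arbitrary choice, hence the unspecified \<open>X\<close>. The
  sequence chosen for the forest has the intervals \<open>T\<close> by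
  \<open>hasse_determines_sequence\<close>, and supports identify the terms that are kept.\<close>

lemma braid_gen_hasse:
  assumes T: "ces n T" and i: "1 \<le> i" "i < n"
  shows "\<exists>X. ces n (T(i := X, Suc i := T i)) \<and>
    braid_gen TYPE('k::field) n i (hasse n T) = hasse n (T(i := X, Suc i := T i))"
proof -
  define E :: "nat \<Rightarrow> 'k quiver_rep" where "E = seq_of_forest n (hasse n T)"
  obtain E0 :: "nat \<Rightarrow> 'k quiver_rep" where "has_intervals n E0 T"
    using ex_has_intervals ces_edge[OF T] by blast
  then have "\<exists>E :: nat \<Rightarrow> 'k quiver_rep. complete_exceptional n E \<and> forest_of n E = hasse n T"
    using T forest_of_eq_hasse complete_exceptional_iff by blast
  from someI_ex[OF this] have E: "complete_exceptional n E" "forest_of n E = hasse n T"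
    unfolding E_def seq_of_forest_def by auto
  obtain S where S: "ces n S" "has_intervals n E S" using E(1) complete_exceptional_iff by blast
  have ST: "S j = T j" if "j \<in> {1..n}" for j
    using hasse_determines_sequence[OF S(1) T _ that] E(2) forest_of_eq_hasse[OF S(2)] by simp
  have ET: "has_intervals n E T" using S(2) ST by (simp add: has_intervals_def)
  have iD: "i \<in> {1..n}" "Suc i \<in> {1..n}" using i by auto
  let ?M = "T(i := mutate (T i) (T (Suc i)), Suc i := T i)"
  have M: "ces n ?M" using ces_mutate[OF T i] .
  obtain X0 :: "'k quiver_rep" where X0: "interval_rep n (mutate (T i) (T (Suc i))) X0"
    using ex_interval_rep by blast
  have "edge n (mutate (T i) (T (Suc i)))" using ces_edge[OF M iD(1)] by simp
  then have "has_intervals n (E(i := X0, Suc i := E i)) ?M"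
    using ET X0 iD by (auto simp: has_intervals_def)
  then have "\<exists>X. complete_exceptional n (E(i := X, Suc i := E i))"
    using M complete_exceptional_iff by blast
  from someI_ex[OF this] have B: "complete_exceptional n (braid_seq n i E)"
      by (simp add: braid_seq_def)
  then obtain R where R: "ces n R" "has_intervals n (braid_seq n i E) R"
    using complete_exceptional_iff by blast
  have same: "R j = (T(i := R i, Suc i := T i)) j" if j: "j \<in> {1..n}" for j
  proof -
    have r: "edge n (R j)" "interval_rep n (R j) (braid_seq n i E j)"
      using R(2) j by (simp_all add: has_intervals_def)
    have t: "edge n (T k)" "interval_rep n (T k) (E k)" if "k \<in> {1..n}" for k
      using ET that by (simp_all add: has_intervals_def)
    consider "j = i" | "j = Suc i" | "j \<noteq> i" "j \<noteq> Suc i" by blast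
    then show ?thesis
    proof cases
      case 2
      then show ?thesis using interval_rep_unique[OF r(1) t(1)[OF iD(1)] r(2)] t(2)[OF iD(1)]
        by (simp add: braid_seq_def)
    next
      case 3
      then show ?thesis using interval_rep_unique[OF r(1) t(1)[OF j] r(2)] t(2)[OF j]
        by (simp add: braid_seq_def)
    qed simp
  qed
  have "braid_gen TYPE('k) n i (hasse n T) = hasse n R"
    using forest_of_eq_hasse[OF R(2)] by (simp add: braid_gen_def E_def)
  also have "\<dots> = hasse n (T(i := R i, Suc i := T i))" by (rule hasse_cong[OF same])
  finally show ?thesis using ces_cong[OF R(1) same] by blast
qed

text \<open>The generator \<open>k\<close> acts first. Each generator moves its left term one place
  to the right, onto the new term made by the generator before it. So only the new term at
  \<open>i\<close> stays unknown, and \<open>Z (Suc k)\<close> disappears.\<close>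

lemma braid_act_interval:
  assumes Z: "ces n Z" and i: "1 \<le> i" "i \<le> Suc k" "Suc k \<le> n"
  shows "\<exists>X. let R = (\<lambda>m. if m = i then X else if i < m \<and> m \<le> Suc k then Z (m - 1) else Z m)
    in ces n R \<and> braid_act TYPE('k::field) n [i..<Suc k] (hasse n Z) = hasse n R"
  using i(2,1)
proof (induction i rule: inc_induct)
  case base
  have "(\<lambda>m. if m = Suc k then Z (Suc k) else if Suc k < m \<and> m \<le> Suc k then Z (m - 1) else Z m) = Z"
    by auto
  \<comment> \<open>For the empty word the inserted term is the one already in its place.\<close>
  then show ?case using Z by (intro exI[of _ "Z (Suc k)"]) (simp add: braid_act_def)
next
  case (step i)
  define R where "R X m = (if m = Suc i then X else if Suc i < m \<and>
      m \<le> Suc k then Z (m - 1) else Z m)" for X m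
  obtain X where X: "ces n (R X)" "braid_act TYPE('k) n [Suc i..<Suc k] (hasse n Z) = hasse n (R X)"
    using step.IH unfolding Let_def R_def by auto
  have i: "1 \<le> i" "i < n" using step.prems step.hyps assms by auto
  obtain Y where Y: "ces n ((R X)(i := Y, Suc i := R X i))"
    "braid_gen TYPE('k) n i (hasse n (R X)) = hasse n ((R X)(i := Y, Suc i := R X i))"
    using braid_gen_hasse[OF X(1) i, where 'k = 'k] by blast
  have "(R X)(i := Y, Suc i := R X i) =
      (\<lambda>m. if m = i then Y else if i < m \<and> m \<le> Suc k then Z (m - 1) else Z m)"
    using step.hyps by (auto simp: R_def fun_eq_iff)
  note new = this
  have "[i..<Suc k] = i # [Suc i..<Suc k]" using step.hyps by (simp add: upt_conv_Cons)
  then have "braid_act TYPE('k) n [i..<Suc k] (hasse n Z) = hasse n ((R X)(i := Y, Suc i := R X i))"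
    using X(2) Y(2) by (simp add: braid_act_def)
  then show ?case using Y(1) unfolding Let_def new by blast
qed

text \<open>The first term stands before all others, so its relations have exactly the one-sided
  form that \<open>edge_determined\<close> asks for.\<close>

lemma ces_first_determined:
  assumes R: "ces n R" and Z: "ces n Z" and eq: "\<And>m. m \<in> {2..n} \<Longrightarrow> R m = Z m" and m: "m \<in> {1..n}"
  shows "R m = Z m"
proof (cases "m = 1")
  case True
  interpret exc_seq n Z by unfold_locales (rule Z)
  have one: "1 \<in> {1..n}" using m by auto
  have "R 1 = Z 1"
  proof (rule edge_determined[OF one])
    show "edge n (R 1)" "edge n (Z 1)" using ces_edge[OF R one] ces_edge[OF Z one] .
    fix j assume j: "j \<in> {1..n}" "j \<noteq> 1"
    then have "1 < j" "j \<in> {2..n}" by auto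
    then show "exc (R 1) (Z j)" "exc (Z 1) (Z j)"
      using ces_exc[OF R one j(1)] ces_exc[OF Z one j(1)] eq[of j] by simp_all
  qed
  then show ?thesis using True by simp
qed (use m eq in auto)

context exc_seq begin

text \<open>Moving the first \<open>k\<close> terms one place to the right already gives stage
  \<open>Suc k\<close> from the second place on. The unknown first term must then be the dual edge
  of \<open>Suc k\<close>.\<close>

lemma delta_word_stage:
  assumes k: "1 \<le> k" "Suc k \<le> n"
  shows "braid_act TYPE('k::field) n (delta_word k) (hasse n (garside_stage n T k)) =
    hasse n (garside_stage n T (Suc k))"
proof -
  let ?Z = "garside_stage n T k"
  obtain X where X: "ces n (\<lambda>m. if m = 1 then X else if 1 < m \<and>
      m \<le> Suc k then ?Z (m - 1) else ?Z m)"
    "braid_act TYPE('k) n [1..<Suc k] (hasse n ?Z) =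
      hasse n (\<lambda>m. if m = 1 then X else if 1 < m \<and> m \<le> Suc k then ?Z (m - 1) else ?Z m)"
    using braid_act_interval[OF ces_garside_stage, of k 1 k, where 'k = 'k] k unfolding Let_def
        by auto
  have "hasse n (\<lambda>m. if m = 1 then X else if 1 < m \<and> m \<le> Suc k then ?Z (m - 1) else ?Z m) =
      hasse n (garside_stage n T (Suc k))"
  proof (rule hasse_cong, rule ces_first_determined[OF X(1) ces_garside_stage[OF k(2)]])
    fix m assume "m \<in> {2..n}"
    then show "(if m = 1 then X else if 1 < m \<and> m \<le> Suc k then ?Z (m - 1) else ?Z m) =
        garside_stage n T (Suc k) m"
      by (auto simp: garside_stage_def Suc_diff_le)
  qed
  then show ?thesis using X(2) by (simp add: delta_word_def)
qed

lemma garside_hasse: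
  assumes n: "1 \<le> n"
  shows "garside TYPE('k::field) n (hasse n T) = hasse n (garside_stage n T n)"
proof -
  have "braid_act TYPE('k) n (concat (map delta_word (rev [1..<k]))) (hasse n T) =
      hasse n (garside_stage n T k)"
    if "1 \<le> k" "k \<le> n" for k
    using that
  proof (induction k rule: dec_induct)
    case base
    \<comment> \<open>No generator has acted yet, and stage 1 can differ from \<open>T\<close> only
      in the first place. By uniqueness the first edge is its own dual edge.\<close>
    have "hasse n T = hasse n (garside_stage n T 1)"
      by (rule hasse_cong, rule ces_first_determined[OF ces ces_garside_stage[OF n]])
        (auto simp: garside_stage_def)
    then show ?case by (simp add: braid_act_def)
  next
    case (step k)
    have "[1..<Suc k] = [1..<k] @ [k]" using step.hyps by simp
    then show ?case using step delta_word_stage[of k, where 'k = 'k] by (simp add: braid_act_def)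
  qed
  then show ?thesis using n by (simp add: garside_def garside_word_def)
qed

lemma conjugation_hasse:
  "1 \<le> n \<Longrightarrow> conjugation TYPE('k::field) n (hasse n T) = hasse n (conj_seq n T)"
  by (simp add: conjugation_def garside_hasse hasse_conj_seq)

end

section \<open>Conjugation and the inverse Garside element on forests\<close>

lemma rooted_forestE:
  assumes "rooted_forest n F"
  obtains T where "exc_seq n T" "F = hasse n T"
proof -
  obtain T where "ces n T" "hasse n T = F" using assms rooted_forest_iff_hasse by blast
  then show ?thesis using that[of T] by (simp add: exc_seq_def)
qed

lemma rooted_forest_conjugation:
  assumes n: "1 \<le> n" and F: "rooted_forest n F"
  shows "rooted_forest n (conjugation TYPE('k::field) n F)"
    and "conjugation TYPE('k) n (conjugation TYPE('k) n F) = F"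
proof -
  obtain T where T: "exc_seq n T" "F = hasse n T" using rooted_forestE[OF F] .
  interpret exc_seq n T by fact
  interpret D: exc_seq n "conj_seq n T" by unfold_locales (rule ces_conj_seq)
  have c: "conjugation TYPE('k) n F = hasse n (conj_seq n T)"
    using conjugation_hasse[OF n, where 'k = 'k] T(2) by simp
  show "rooted_forest n (conjugation TYPE('k) n F)" unfolding c by (rule D.rooted_forest_hasse)
  have "conjugation TYPE('k) n (conjugation TYPE('k) n F) = hasse n (conj_seq n (conj_seq n T))"
    unfolding c by (rule D.conjugation_hasse[OF n])
  also have "\<dots> = F" unfolding T(2) by (rule hasse_cong) (rule conj_conj_seq)
  finally show "conjugation TYPE('k) n (conjugation TYPE('k) n F) = F" .
qed

lemma rooted_forest_dual:
  assumes "rooted_forest n F"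
  shows "rooted_forest n (dual n F)"
proof -
  obtain T where T: "exc_seq n T" "F = hasse n T" using rooted_forestE[OF assms] .
  interpret exc_seq n T by fact
  have "dual n F = hasse n (rev_seq n T)" using hasse_rev_seq ces_edge[OF ces] T(2) by simp
  then show ?thesis using rooted_forest_iff_hasse ces_rev_seq[OF ces] by blast
qed

lemma rooted_forest_subset: "rooted_forest n F \<Longrightarrow> F \<subseteq> {1..n} \<times> {1..n}"
  by (simp add: rooted_forest_def)

lemma roots_nonempty:
  assumes "1 \<le> n" "rooted_forest n F"
  shows "roots n F \<noteq> {}"
proof -
  obtain T where "exc_seq n T" "F = hasse n T" using rooted_forestE[OF assms(2)] .
  then show ?thesis using exc_seq.roots_nonempty assms(1) by blast
qed

text \<open>Since \<open>C = D \<Delta>\<close> and both C and D are involutions, the inverse of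
  \<Delta> is \<open>C D\<close>. The involution property of C also yields the injectivity of
  \<Delta> behind \<open>inv_into\<close>.\<close>

lemma garside_inv_eq:
  assumes n: "1 \<le> n" and F: "rooted_forest n F"
  shows "garside_inv TYPE('k::field) n F = conjugation TYPE('k) n (dual n F)"
proof -
  let ?g = "garside TYPE('k) n" and ?c = "conjugation TYPE('k) n"
  have sub: "?g G \<subseteq> {1..n} \<times> {1..n}" if G: "rooted_forest n G" for G
  proof -
    obtain T where T: "exc_seq n T" "G = hasse n T" using rooted_forestE[OF G] .
    then show ?thesis using exc_seq.garside_hasse[OF T(1) n, where 'k = 'k] hasse_subset by simp
  qed
  have g: "?g G = dual n (?c G)" if "rooted_forest n G" for G
    using dual_dual[OF sub[OF that]] by (simp add: conjugation_def)
  have inj: "inj_on ?g {F. rooted_forest n F}"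
  proof (rule inj_onI)
    fix G H assume "G \<in> {F. rooted_forest n F}" "H \<in> {F. rooted_forest n F}" "?g G = ?g H"
    then have "rooted_forest n G" "rooted_forest n H" "?c G = ?c H" by (auto simp: conjugation_def)
    then show "G = H" using rooted_forest_conjugation(2)[OF n, where 'k = 'k] by metis
  qed
  have d: "rooted_forest n (dual n F)" using rooted_forest_dual[OF F] .
  have H: "rooted_forest n (?c (dual n F))" using rooted_forest_conjugation(1)[OF n d] .
  have "?g (?c (dual n F)) = F"
    unfolding g[OF H] rooted_forest_conjugation(2)[OF n d]
        by (rule dual_dual[OF rooted_forest_subset[OF F]])
  then show ?thesis unfolding garside_inv_def using inv_into_f_f[OF inj] H by (metis mem_Collect_eq)
qed

lemma last_injective_iff:
  assumes n: "1 \<le> n" and F: "rooted_forest n F" and l: "l \<in> {1..n}"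
  shows "last_injective n F l \<longleftrightarrow> first_projective n (dual n F) (Suc n - l)"
proof -
  note sF = rooted_forest_subset[OF F] and dF = rooted_forest_dual[OF F]
  let ?f = "\<lambda>x. Suc n - x"
  have inj: "injective_vertices n F ks \<longleftrightarrow> projective_vertices n (dual n F) (rev (map ?f ks))"
    if "set ks \<subseteq> {1..n}" for ks
    by (rule injective_iff_projective_dual[OF sF roots_nonempty[OF n F] that])
  have ff: "rev (map ?f (rev (map ?f ks))) = ks" if "set ks \<subseteq> {1..n}" for ks
    using that by (auto simp: rev_map intro!: map_idI flip_flip)
  show ?thesis
  proof
    assume "last_injective n F l"
    then obtain ks where ks: "injective_vertices n F ks" "last ks = l"
        by (auto simp: last_injective_def)
    then have m: "set ks \<subseteq> {1..n}" "ks \<noteq> []"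
      using injective_vertices_mem[OF sF roots_nonempty[OF n F]]
          by (auto simp: injective_vertices_def)
    have "hd (rev (map ?f ks)) = ?f l" using ks(2) m(2) by (simp add: hd_rev last_map)
    then show "first_projective n (dual n F) (?f l)"
      using inj[OF m(1)] ks(1) by (auto simp: first_projective_def)
  next
    assume "first_projective n (dual n F) (?f l)"
    then obtain js where js: "projective_vertices n (dual n F) js" "hd js = ?f l"
      by (auto simp: first_projective_def)
    obtain T where T: "exc_seq n T" "dual n F = hasse n T" using rooted_forestE[OF dF] .
    have m: "set js \<subseteq> {1..n}" "js \<noteq> []"
      using js(1) exc_seq.projective_vertices_hasse[OF T(1) n] T(2)
          by (auto simp: projective_vertices_def)
    let ?ks = "rev (map ?f js)"
    have km: "set ?ks \<subseteq> {1..n}" using m(1) flip_mem by auto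
    have "injective_vertices n F ?ks" using inj[OF km] js(1) ff[OF m(1)] by simp
    moreover have "last ?ks = l" using m(2) js(2) l by (simp add: last_rev hd_map)
    ultimately show "last_injective n F l" by (auto simp: last_injective_def)
  qed
qed

theorem proposition4p20:
  fixes n :: nat and F F' F'' :: forest
  assumes "n \<ge> 1"
    and "rooted_forest n F"
    and "F' = conjugation TYPE('k::field) n F"
    and "F'' = dual n (garside_inv TYPE('k) n F)"
  shows "rooted_forest n F' \<and> F = conjugation TYPE('k) n F' \<and>
    (\<forall>js. projective_vertices n F js \<longleftrightarrow> sorted_wrt (<) js \<and> set js = roots n F') \<and>
    (\<forall>k ks. injective_vertices n F (k # ks) \<longleftrightarrow>
       first_projective n F' k \<and> sorted_wrt (<) ks \<and> set ks = children F' k) \<and>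
    (\<forall>l ls. last_injective n F l \<and> sorted_wrt (<) ls \<and> set ls = children F l \<longleftrightarrow>
       projective_vertices n F'' (ls @ [l]))"
proof (intro conjI allI)
  note n = assms(1) and F = assms(2)
  show "rooted_forest n F'" unfolding assms(3) by (rule rooted_forest_conjugation(1)[OF n F])
  show "F = conjugation TYPE('k) n F'" unfolding assms(3) rooted_forest_conjugation(2)[OF n F] ..
  have conj: "projective_vertices n G js \<longleftrightarrow> sorted_wrt (<) js \<and> set js =
      roots n (conjugation TYPE('k) n G)"
    "injective_vertices n G (k # ks) \<longleftrightarrow>
       first_projective n (conjugation TYPE('k) n G) k \<and> sorted_wrt (<) ks \<and>
       set ks = children (conjugation TYPE('k) n G) k"
    if G: "rooted_forest n G" for G js k ks
  proof -
    obtain T where T: "exc_seq n T" "G = hasse n T" using rooted_forestE[OF G] .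
    interpret exc_seq n T by fact
    show "projective_vertices n G js \<longleftrightarrow> sorted_wrt (<) js \<and> set js =
        roots n (conjugation TYPE('k) n G)"
      unfolding T(2) conjugation_hasse[OF n] by (rule projective_vertices_conj[OF n])
    show "injective_vertices n G (k # ks) \<longleftrightarrow>
       first_projective n (conjugation TYPE('k) n G) k \<and> sorted_wrt (<) ks \<and>
       set ks = children (conjugation TYPE('k) n G) k"
      unfolding T(2) conjugation_hasse[OF n] by (rule injective_vertices_conj[OF n])
  qed
  show "projective_vertices n F js \<longleftrightarrow> sorted_wrt (<) js \<and> set js = roots n F'" for js
    unfolding assms(3) by (rule conj(1)[OF F])
  show "injective_vertices n F (k # ks) \<longleftrightarrow>
      first_projective n F' k \<and> sorted_wrt (<) ks \<and> set ks = children F' k" for k ks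
    unfolding assms(3) by (rule conj(2)[OF F])
  fix l ls
  let ?f = "\<lambda>x. Suc n - x" and ?c = "conjugation TYPE('k) n"
  have dF: "rooted_forest n (dual n F)" using rooted_forest_dual[OF F] .
  define G where "G = ?c (dual n F)"
  have G: "rooted_forest n G" "?c G = dual n F"
    using rooted_forest_conjugation[OF n dF, where 'k = 'k] by (simp_all add: G_def)
  \<comment> \<open>Thus \<open>F''\<close> is \<open>D C D F\<close>, and the conjugate of
    \<open>G\<close> is \<open>D F\<close>: the third item is the second one for \<open>G\<close>,
    read through the duality.\<close>
  have F'': "F'' = dual n G" using assms(4) garside_inv_eq[OF n F, where 'k = 'k]
      by (simp add: G_def)
  note sF = rooted_forest_subset[OF F] and sG = rooted_forest_subset[OF G(1)]
  have main: "last_injective n F l \<and> sorted_wrt (<) ls \<and> set ls = children F l \<longleftrightarrow>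
      projective_vertices n F'' (ls @ [l])" if m: "l \<in> {1..n}" "set ls \<subseteq> {1..n}"
  proof -
    \<comment> \<open>The flip reverses the order, so the last entry \<open>l\<close> becomes the
      head, the candidate for the first projective vertex of \<open>D F\<close>.\<close>
    let ?ks = "?f l # rev (map ?f ls)"
    have km: "set ?ks \<subseteq> {1..n}" using m flip_mem by auto
    have "map (?f \<circ> ?f) ls = ls" using m(2) by (intro map_idI) auto
    then have "rev (map ?f ?ks) = ls @ [l]" using m(1) by (simp add: rev_map)
    then have "projective_vertices n F'' (ls @ [l]) \<longleftrightarrow> injective_vertices n G ?ks"
      using injective_iff_projective_dual[OF sG roots_nonempty[OF n G(1)] km] F'' by simp
    also have "\<dots> \<longleftrightarrow> first_projective n (dual n F) (?f l) \<and> sorted_wrt (<) (rev (map ?f ls)) \<and>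
        ?f ` set ls = ?f ` children F l"
      unfolding conj(2)[OF G(1)] G(2) children_dual[OF sF m(1)] by simp
    also have "\<dots> \<longleftrightarrow> last_injective n F l \<and> sorted_wrt (<) ls \<and> set ls = children F l"
      unfolding last_injective_iff[OF n F m(1)] sorted_flip[OF m(2)]
        image_flip_eq_iff[OF m(2) children_subset[OF sF]] ..
    finally show ?thesis by blast
  qed
  show "last_injective n F l \<and> sorted_wrt (<) ls \<and> set ls = children F l \<longleftrightarrow>
      projective_vertices n F'' (ls @ [l])"
  proof
    assume L: "last_injective n F l \<and> sorted_wrt (<) ls \<and> set ls = children F l"
    then obtain ks where ks: "injective_vertices n F ks" "last ks = l"
        by (auto simp: last_injective_def)
    then have "ks \<noteq> []" "set ks \<subseteq> {1..n}"
      using injective_vertices_mem[OF sF roots_nonempty[OF n F]]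
          by (auto simp: injective_vertices_def)
    then have "l \<in> {1..n}" using ks(2) last_in_set by blast
    then show "projective_vertices n F'' (ls @ [l])" using main L children_subset[OF sF] by blast
  next
    assume P: "projective_vertices n F'' (ls @ [l])"
    have "rooted_forest n F''" unfolding F'' by (rule rooted_forest_dual[OF G(1)])
    \<comment> \<open>The first item, applied to \<open>F''\<close>, shows that the entries of the
      list are labels of vertices.\<close>
    then have "set (ls @ [l]) = roots n (?c F'')" using conj(1) P by blast
    then have "l \<in> {1..n}" "set ls \<subseteq> {1..n}" by (auto simp: roots_def)
    then show "last_injective n F l \<and> sorted_wrt (<) ls \<and> set ls = children F l" using main P
        by blast
  qed
qed

end
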